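(* Let $m\ge 2$, $I=\mathbb Z/m\mathbb Z$, $\alpha\in(\mathbb Z_{>0})^I$, $q=(q_i)_{i\in I}\in(\mathbb C^\times)^I$, and let $\mathcal M_{\alpha,q}$ be the multiplicative quiver variety of the framed cyclic quiver with $m$ cyclic vertices, with its Poisson bracket on $\mathcal O(\mathcal M_{\alpha,q})$, and let $X,Y$ be the associated matrices (see context). Then each of the following families consists of pairwise Poisson commuting functions on $\mathcal M_{\alpha,q}$: $$\{\operatorname{tr}X^{jm}\mid j\in\mathbb N\},\quad \{\operatorname{tr}Y^{jm}\mid j\in\mathbb N\},\quad \{\operatorname{tr}(1+XY)^j\mid j\in\mathbb Z\},\quad \{\operatorname{tr}(Y+X^{-1})^{jm}\mid j\in\mathbb Z\},$$ where the last family is viewed on the open subset $\mathcal M^0_{\alpha,q}\subset\mathcal M_{\alpha,q}$ on which $X$ is invertible (members with a negative exponent $jm$ being regarded as functions where they are defined).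
   Context: **Quiver and algebra.** The framed cyclic quiver $\widetilde Q$ has vertex set $I\sqcup\{\infty\}$, $I=\mathbb Z/m\mathbb Z$, and arrows $x_i:i\to i+1$ ($i\in I$), $v:0\to\infty$. Its double $\bar Q$ has in addition the opposite arrows $y_i=x_i^*:i+1\to i$ and $w=v^*:\infty\to 0$; $(a^* )^*=a$. For $a\in\bar Q$, $t(a),h(a)$ are its tail and head; $\epsilon(x_i)=\epsilon(v)=1$, $\epsilon(y_i)=\epsilon(w)=-1$. Paths in the path algebra $\mathbb C\bar Q$ are composed from left to right ($ab$ is "$a$ followed by $b$", zero unless $h(a)=t(b)$), $e_i$ are the vertex idempotents, $B=\bigoplus_{i\in I\sqcup\{\infty\}}\mathbb C e_i$. $A$ is obtained from $\mathbb C\bar Q$ by adjoining inverses of all $1+aa^*$, $a\in\bar Q$. Set $x=\sum_i x_i$, $y=\sum_i y_i$. **Double bracket.** Write $u=u'\otimes u''$ for elements of $A\otimes A$ (sum suppressed), $u^\circ=u''\otimes u'$. A double derivation is a $B$-linear derivation $\delta:A\to A\otimes A$ for the outer bimodule structure $b(u'\otimes u'')c=bu'\otimes u''c$; double derivations form an $A$-bimodule by $(b\delta c)(a)=\delta(a)'c\otimes b\,\delta(a)''$. For $a\in\bar Q$, $\frac{\partial}{\partial a}$ is the double derivation with $\frac{\partial b}{\partial a}=e_{t(a)}\otimes e_{h(a)}$ if $b=a$, and $0$ for other arrows $b$. A product $\delta_1\delta_2$ defines $\{\!\{a,b\}\!\}_{\delta_1\delta_2}=\delta_2(b)'\delta_1(a)''\otimes\delta_1(a)'\delta_2(b)''-\delta_1(b)'\delta_2(a)''\otimes\delta_2(a)'\delta_1(b)''$,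 extended additively to sums of products. The double bracket on $A$ is $\{\!\{-,-\}\!\}=\{\!\{-,-\}\!\}_{P}$ with $$P=\tfrac12\sum_{a\in\bar Q}\epsilon(a)(1+a^*a)\tfrac{\partial}{\partial a}\tfrac{\partial}{\partial a^*}-\tfrac12\sum_{i}\sum_{a<b,\ t(a)=t(b)=i}F_aF_b,\qquad F_a=\tfrac{\partial}{\partial a^*}a^*-a\tfrac{\partial}{\partial a},$$ $i$ running over $I\sqcup\{\infty\}$, with the arrows starting at each vertex ordered by $y_{i-1}<x_i$ at $i\ne0$ and $y_{m-1}<x_0<v$ at $0$. **Variety.** Put $q_\infty=\prod_{i\in I}q_i^{-\alpha_i}$, $\widetilde q=q_\infty e_\infty+\sum_{i\in I} q_ie_i$, $\widetilde\alpha=(1,\alpha)$ ($\alpha_\infty=1$). The multiplicative preprojective algebra $\Lambda^{\widetilde q}$ is the quotient of $A$ by $(e_i+y_{i-1}x_{i-1})^{-1}(e_i+x_iy_i)=q_ie_i$ ($i\ne0$), $(e_0+y_{m-1}x_{m-1})^{-1}(e_0+x_0y_0)(e_0+vw)=q_0e_0$, $(e_\infty+wv)^{-1}=q_\infty e_\infty$. $\operatorname{Rep}(\cdot,\widetilde\alpha)$ is the affine scheme of algebra homomorphisms to $\operatorname{Mat}_N(\mathbb C)$, $N=1+\sum_{i\in I}\alpha_i$, sending $e_i$ to the identity of the $i$th diagonal block of size $\alpha_i$. Thus an arrow $a$ is represented by an $\alpha_{t(a)}\times\alpha_{h(a)}$ matrix. Write $X_i,Y_i,V,W$ for the matrices of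 $x_i,y_i,v,w$, and $X=\sum_iX_i$, $Y=\sum_iY_i$, endomorphisms of $\bigoplus_{i\in I}\mathbb C^{\alpha_i}$ ($1$ is the identity there). The group $\operatorname{GL}_\alpha=\prod_{i\in I}\operatorname{GL}_{\alpha_i}$ acts by conjugation, and $\mathcal M_{\alpha,q}=\operatorname{Rep}(\Lambda^{\widetilde q},\widetilde\alpha)/\!/\operatorname{GL}_\alpha$. **Poisson bracket.** For $a\in A$ let $a_{ij}$ be the matrix entry functions on $\operatorname{Rep}(A,\widetilde\alpha)$. The rule $\{a_{ij},b_{uv}\}=\{\!\{a,b\}\!\}'_{uj}\,\{\!\{a,b\}\!\}''_{iv}$ defines an antisymmetric biderivation on $\mathcal O(\operatorname{Rep}(A,\widetilde\alpha))$, which induces (by quasi-Hamiltonian reduction) a Poisson bracket on $\mathcal O(\mathcal M_{\alpha,q})=\mathcal O(\operatorname{Rep}(\Lambda^{\widetilde q},\widetilde\alpha))^{\operatorname{GL}_\alpha}$. *)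

theory Defs
  imports
    "Jordan_Normal_Form.Determinant"
    "Berlekamp_Zassenhaus.Finite_Field"
    "HOL-Algebra.QuotRing"
begin

section \<open>The framed cyclic quiver and its double\<close>

text \<open>The cyclic vertex set \<open>I = \<int>/m\<int>\<close> is the type \<open>'m mod_ring\<close>, where \<open>'m\<close> ranges over the
  types of class \<open>nontriv\<close>; thus \<open>m = CARD('m) \<ge> 2\<close>.\<close>

datatype 'i vertex = Cyc 'i | Infty

text \<open>\<open>Ax i : i \<rightarrow> i + 1\<close>, its opposite \<open>Ay i : i + 1 \<rightarrow> i\<close>, the framing arrow \<open>Av : 0 \<rightarrow> \<infinity>\<close> and its
  opposite \<open>Aw : \<infinity> \<rightarrow> 0\<close>.\<close>

datatype 'i arrow = Ax 'i | Ay 'i | Av | Aw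

fun tail :: "'m::nontriv mod_ring arrow \<Rightarrow> 'm mod_ring vertex" where
  "tail (Ax i) = Cyc i"
| "tail (Ay i) = Cyc (i + 1)"
| "tail Av = Cyc 0"
| "tail Aw = Infty"

fun opp :: "'i arrow \<Rightarrow> 'i arrow" where
  "opp (Ax i) = Ay i"
| "opp (Ay i) = Ax i"
| "opp Av = Aw"
| "opp Aw = Av"

definition head :: "'m::nontriv mod_ring arrow \<Rightarrow> 'm mod_ring vertex" where
  "head a = tail (opp a)"

fun eps :: "'i arrow \<Rightarrow> complex" where
  "eps (Ax i) = 1"
| "eps (Ay i) = -1"
| "eps Av = 1"
| "eps Aw = -1"

fun arrow_rank :: "'i arrow \<Rightarrow> nat" where
  "arrow_rank (Ay i) = 0"
| "arrow_rank (Ax i) = 1"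
| "arrow_rank Av = 2"
| "arrow_rank Aw = 3"

text \<open>The arrows starting at \<open>i\<close> are \<open>y\<^sub>i\<^sub>-\<^sub>1 < x\<^sub>i\<close>, followed by \<open>v\<close> if \<open>i = 0\<close>; the only arrow
  starting at \<open>\<infinity>\<close> is \<open>w\<close>.\<close>

definition arrow_less :: "'m::nontriv mod_ring arrow \<Rightarrow> 'm mod_ring arrow \<Rightarrow> bool" where
  "arrow_less a b \<longleftrightarrow> tail a = tail b \<and> arrow_rank a < arrow_rank b"

text \<open>The vertices in the order in which the diagonal blocks are arranged: \<open>0, \<dots>, m - 1, \<infinity>\<close>.\<close>

definition vertices :: "'m::nontriv mod_ring vertex list" where
  "vertices = map (\<lambda>k. Cyc (of_nat k)) [0..<CARD('m)] @ [Infty]"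

lemma UNIV_arrow: "(UNIV :: 'i arrow set) = range Ax \<union> range Ay \<union> {Av, Aw}"
proof -
  have "a \<in> range Ax \<union> range Ay \<union> {Av, Aw}" for a :: "'i arrow"
    by (cases a) auto
  then show ?thesis by blast
qed

lemma finite_UNIV_arrow: "finite (UNIV :: 'm::nontriv mod_ring arrow set)"
proof -
  have "finite (UNIV :: 'm mod_ring set)"
    by (rule card_ge_0_finite) (use nontriv[where ?'a='m] in simp)
  then show ?thesis by (simp add: UNIV_arrow)
qed

lemma opp_opp [simp]: "opp (opp a) = a"
  by (cases a) auto


section \<open>The localised path algebra of the double quiver\<close>

text \<open>The complex algebra \<open>A\<close> is presented by generators and relations. The generators are the
  vertex idempotents, the arrows, and formal inverses \<open>GInv a\<close> of \<open>1 + a a\<^sup>*\<close>.\<close>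

datatype 'i gen = GIdem "'i vertex" | GArr "'i arrow" | GInv "'i arrow"

datatype 'i expr =
    Gen "'i gen" | Scal complex | Plus "'i expr" "'i expr" | Times "'i expr" "'i expr"

inductive alg_eq :: "'m::nontriv mod_ring expr \<Rightarrow> 'm mod_ring expr \<Rightarrow> bool" where
  refl: "alg_eq s s"
| sym: "alg_eq s t \<Longrightarrow> alg_eq t s"
| trans: "alg_eq s t \<Longrightarrow> alg_eq t u \<Longrightarrow> alg_eq s u"
| cong_plus: "alg_eq s s' \<Longrightarrow> alg_eq t t' \<Longrightarrow> alg_eq (Plus s t) (Plus s' t')"
| cong_times: "alg_eq s s' \<Longrightarrow> alg_eq t t' \<Longrightarrow> alg_eq (Times s t) (Times s' t')"
| plus_assoc: "alg_eq (Plus (Plus s t) u) (Plus s (Plus t u))"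
| plus_comm: "alg_eq (Plus s t) (Plus t s)"
| plus_zero: "alg_eq (Plus (Scal 0) s) s"
| plus_minus: "alg_eq (Plus (Times (Scal (-1)) s) s) (Scal 0)"
| times_assoc: "alg_eq (Times (Times s t) u) (Times s (Times t u))"
| times_one_left: "alg_eq (Times (Scal 1) s) s"
| times_one_right: "alg_eq (Times s (Scal 1)) s"
| distrib_right: "alg_eq (Times (Plus s t) u) (Plus (Times s u) (Times t u))"
| distrib_left: "alg_eq (Times s (Plus t u)) (Plus (Times s t) (Times s u))"
| scal_plus: "alg_eq (Plus (Scal z) (Scal z')) (Scal (z + z'))"
| scal_times: "alg_eq (Times (Scal z) (Scal z')) (Scal (z * z'))"
| scal_central: "alg_eq (Times (Scal z) s) (Times s (Scal z))"
| idem_idem: "alg_eq (Times (Gen (GIdem i)) (Gen (GIdem i))) (Gen (GIdem i))"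
| idem_orth: "i \<noteq> j \<Longrightarrow> alg_eq (Times (Gen (GIdem i)) (Gen (GIdem j))) (Scal 0)"
| idem_sum: "alg_eq (foldr (\<lambda>i. Plus (Gen (GIdem i))) vertices (Scal 0)) (Scal 1)"
| tail_arrow: "alg_eq (Times (Gen (GIdem (tail a))) (Gen (GArr a))) (Gen (GArr a))"
| arrow_head: "alg_eq (Times (Gen (GArr a)) (Gen (GIdem (head a)))) (Gen (GArr a))"
| inv_left: "alg_eq (Times (Gen (GInv a))
      (Plus (Scal 1) (Times (Gen (GArr a)) (Gen (GArr (opp a)))))) (Scal 1)"
| inv_right: "alg_eq (Times (Plus (Scal 1) (Times (Gen (GArr a)) (Gen (GArr (opp a)))))
      (Gen (GInv a))) (Scal 1)"

quotient_type (overloaded) 'm dpa = "'m::nontriv mod_ring expr" / alg_eq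
  by (rule equivpI)
     (auto simp: reflp_def symp_def transp_def intro: alg_eq.refl alg_eq.sym alg_eq.trans)

text \<open>The evaluation killing everything but \<open>e\<^sub>\<infinity>\<close>, used only to show \<open>0 \<noteq> 1\<close> in \<open>A\<close>.\<close>

fun aug :: "'i expr \<Rightarrow> complex" where
  "aug (Gen (GIdem i)) = (if i = Infty then 1 else 0)"
| "aug (Gen (GArr a)) = 0"
| "aug (Gen (GInv a)) = 1"
| "aug (Scal z) = z"
| "aug (Plus s t) = aug s + aug t"
| "aug (Times s t) = aug s * aug t"

lemma aug_foldr: "aug (foldr (\<lambda>i. Plus (Gen (GIdem i))) is s)
    = of_nat (count_list is Infty) + aug s"
  by (induction "is") auto

lemma aug_alg_eq: "alg_eq s t \<Longrightarrow> aug s = aug t"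
proof (induction rule: alg_eq.induct)
  case idem_sum
  have "count_list (vertices :: 'a mod_ring vertex list) Infty = 1"
    by (simp add: vertices_def count_list_0_iff image_iff)
  then show ?case by (simp add: aug_foldr)
qed (auto simp: algebra_simps)

instantiation dpa :: (nontriv) ring_1
begin

lift_definition zero_dpa :: "'a dpa" is "Scal 0" .
lift_definition one_dpa :: "'a dpa" is "Scal 1" .
lift_definition plus_dpa :: "'a dpa \<Rightarrow> 'a dpa \<Rightarrow> 'a dpa" is Plus
  by (rule alg_eq.cong_plus)
lift_definition times_dpa :: "'a dpa \<Rightarrow> 'a dpa \<Rightarrow> 'a dpa" is Times
  by (rule alg_eq.cong_times)
lift_definition uminus_dpa :: "'a dpa \<Rightarrow> 'a dpa" is "Times (Scal (-1))"
  by (rule alg_eq.cong_times[OF alg_eq.refl])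
definition minus_dpa :: "'a dpa \<Rightarrow> 'a dpa \<Rightarrow> 'a dpa" where
  "minus_dpa a b = a + - b"

lemma zero_times_dpa: "(0::'a dpa) * a = 0"
proof -
  have eq: "(0::'a dpa) + 0 = 0"
    by transfer (rule alg_eq.plus_zero)
  have assoc: "a + b + c = a + (b + c)" for a b c :: "'a dpa"
    by transfer (rule alg_eq.plus_assoc)
  have neg: "- a + a = 0" for a :: "'a dpa"
    by transfer (rule alg_eq.plus_minus)
  have zero: "0 + a = a" for a :: "'a dpa"
    by transfer (rule alg_eq.plus_zero)
  have distr: "(a + b) * c = a * c + b * c" for a b c :: "'a dpa"
    by transfer (rule alg_eq.distrib_right)
  have "0 * a + 0 * a = 0 * a"
    by (metis eq distr)
  then have "- (0 * a) + (0 * a + 0 * a) = - (0 * a) + 0 * a"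
    by simp
  then show ?thesis
    by (metis assoc neg zero)
qed

instance
proof
  fix a b c :: "'a dpa"
  show "a + b + c = a + (b + c)" by transfer (rule alg_eq.plus_assoc)
  show "a + b = b + a" by transfer (rule alg_eq.plus_comm)
  show "0 + a = a" by transfer (rule alg_eq.plus_zero)
  show "- a + a = 0" by transfer (rule alg_eq.plus_minus)
  show "a - b = a + - b" by (simp add: minus_dpa_def)
  show "a * b * c = a * (b * c)" by transfer (rule alg_eq.times_assoc)
  show "1 * a = a" by transfer (rule alg_eq.times_one_left)
  show "a * 1 = a" by transfer (rule alg_eq.times_one_right)
  show "(a + b) * c = a * c + b * c" by transfer (rule alg_eq.distrib_right)
  show "a * (b + c) = a * b + a * c" by transfer (rule alg_eq.distrib_left)
  show "(0::'a dpa) \<noteq> 1" by transfer (auto dest: aug_alg_eq)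
qed

end

lifting_forget mod_ring.lifting

lift_definition scal :: "complex \<Rightarrow> 'm::nontriv dpa" is Scal .
lift_definition idem :: "'m::nontriv mod_ring vertex \<Rightarrow> 'm dpa" is "\<lambda>i. Gen (GIdem i)" .
lift_definition arr :: "'m::nontriv mod_ring arrow \<Rightarrow> 'm dpa" is "\<lambda>a. Gen (GArr a)" .
lift_definition inv1 :: "'m::nontriv mod_ring arrow \<Rightarrow> 'm dpa" is "\<lambda>a. Gen (GInv a)" .

lemma scal_central_dpa: "scal z * (a :: 'm::nontriv dpa) = a * scal z"
  by transfer (rule alg_eq.scal_central)

lemma scal_zero [simp]: "scal 0 = 0"
  by transfer (rule alg_eq.refl)

lemma scal_one [simp]: "scal 1 = 1"
  by transfer (rule alg_eq.refl)

lemma scal_add: "scal (z + z') = scal z + scal z'"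
  by transfer (rule alg_eq.sym, rule alg_eq.scal_plus)

lemma scal_mult: "scal (z * z') = scal z * scal z'"
  by transfer (rule alg_eq.sym, rule alg_eq.scal_times)

lemma scal_minus_one: "scal (-1) * a = - a"
  by transfer (rule alg_eq.refl)

lemma idem_idem: "idem i * idem i = idem i"
  by transfer (rule alg_eq.idem_idem)

lemma idem_orth: "i \<noteq> j \<Longrightarrow> idem i * idem j = 0"
  by transfer (rule alg_eq.idem_orth)

lemma tail_arr: "idem (tail a) * arr a = arr a"
  by transfer (rule alg_eq.tail_arrow)

lemma arr_head: "arr a * idem (head a) = arr a"
  by transfer (rule alg_eq.arrow_head)

lemma inv1_left: "inv1 a * (1 + arr a * arr (opp a)) = 1"
  by transfer (rule alg_eq.inv_left)

lemma inv1_right: "(1 + arr a * arr (opp a)) * inv1 a = 1"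
  by transfer (rule alg_eq.inv_right)

lemma idem_sum: "foldr (\<lambda>i. (+) (idem i)) vertices 0 = (1 :: 'm::nontriv dpa)"
proof -
  have "foldr (\<lambda>i. (+) (idem i)) is 0 = abs_dpa (foldr (\<lambda>i. Plus (Gen (GIdem i))) is (Scal 0))"
    for "is" :: "'m::nontriv mod_ring vertex list"
    by (induction "is") (simp_all add: zero_dpa_def idem_def plus_dpa.abs_eq)
  moreover have "abs_dpa (foldr (\<lambda>i. Plus (Gen (GIdem i))) vertices (Scal 0)) = 1"
    unfolding one_dpa_def by (simp add: dpa.abs_eq_iff alg_eq.idem_sum)
  ultimately show ?thesis by simp
qed

lifting_forget dpa.lifting

definition x_elem :: "'m::nontriv dpa" where
  "x_elem = (\<Sum>i\<in>UNIV. arr (Ax i))"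

definition y_elem :: "'m::nontriv dpa" where
  "y_elem = (\<Sum>i\<in>UNIV. arr (Ay i))"


section \<open>The tensor square of \<open>A\<close> over the complex numbers\<close>

text \<open>A list of pairs \<open>[(u\<^sub>1, v\<^sub>1), \<dots>, (u\<^sub>n, v\<^sub>n)]\<close> stands for the sum of the \<open>u\<^sub>k \<otimes> v\<^sub>k\<close>.\<close>

inductive tens_eq :: "('m::nontriv dpa \<times> 'm dpa) list \<Rightarrow> ('m dpa \<times> 'm dpa) list \<Rightarrow> bool" where
  refl: "tens_eq u u"
| sym: "tens_eq u v \<Longrightarrow> tens_eq v u"
| trans: "tens_eq u v \<Longrightarrow> tens_eq v w \<Longrightarrow> tens_eq u w"
| append: "tens_eq u u' \<Longrightarrow> tens_eq v v' \<Longrightarrow> tens_eq (u @ v) (u' @ v')"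
| commute: "tens_eq (u @ v) (v @ u)"
| add_left: "tens_eq [(a + b, c)] [(a, c), (b, c)]"
| add_right: "tens_eq [(a, b + c)] [(a, b), (a, c)]"
| scale: "tens_eq [(scal z * a, b)] [(a, scal z * b)]"
| zero: "tens_eq [(0, a)] []"

quotient_type (overloaded) 'm dpa2 = "('m::nontriv dpa \<times> 'm dpa) list" / tens_eq
  by (rule equivpI)
     (auto simp: reflp_def symp_def transp_def intro: tens_eq.refl tens_eq.sym tens_eq.trans)

lemma tens_eq_map:
  assumes "tens_eq u v"
  shows "tens_eq (map (\<lambda>(p, p'). (a * p * b, c * p' * d)) u)
                 (map (\<lambda>(p, p'). (a * p * b, c * p' * d)) v)"
  using assms
proof (induction rule: tens_eq.induct)
  case (refl u)
  show ?case by (rule tens_eq.refl)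
next
  case (sym u v)
  show ?case by (rule tens_eq.sym[OF sym.IH])
next
  case (trans u v w)
  show ?case by (rule tens_eq.trans[OF trans.IH])
next
  case (append u u' v v')
  show ?case using tens_eq.append[OF append.IH] by simp
next
  case (commute u v)
  show ?case by (simp add: tens_eq.commute)
next
  case (add_left p p' p'')
  show ?case by (simp add: Rings.distrib_left Rings.distrib_right tens_eq.add_left)
next
  case (add_right p p' p'')
  show ?case by (simp add: Rings.distrib_left Rings.distrib_right tens_eq.add_right)
next
  case (scale z p p')
  have 1: "a * (scal z * p) * b = scal z * (a * p * b)"
    by (metis mult.assoc scal_central_dpa)
  have 2: "c * (scal z * p') * d = scal z * (c * p' * d)"
    by (metis mult.assoc scal_central_dpa)
  show ?case by (simp add: 1 2 tens_eq.scale)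
next
  case (zero p)
  show ?case by (simp add: tens_eq.zero)
qed

lemma tens_eq_concat:
  assumes "\<And>x. tens_eq (f x) (g x)"
  shows "tens_eq (concat (map f xs)) (concat (map g xs))"
  by (induction xs) (auto intro: tens_eq.refl tens_eq.append assms)

lemma tens_eq_concat_append:
  "tens_eq (concat (map (\<lambda>x. f x @ g x) xs)) (concat (map f xs) @ concat (map g xs))"
proof (induction xs)
  case Nil
  show ?case by (simp add: tens_eq.refl)
next
  case (Cons x xs)
  have "tens_eq (f x @ (g x @ concat (map (\<lambda>x. f x @ g x) xs)))
      (f x @ (g x @ (concat (map f xs) @ concat (map g xs))))"
    by (intro tens_eq.append tens_eq.refl Cons.IH)
  moreover have "tens_eq (f x @ ((g x @ concat (map f xs)) @ concat (map g xs)))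
      (f x @ ((concat (map f xs) @ g x) @ concat (map g xs)))"
    by (intro tens_eq.append tens_eq.refl tens_eq.commute)
  ultimately have "tens_eq (f x @ (g x @ concat (map (\<lambda>x. f x @ g x) xs)))
      (f x @ ((concat (map f xs) @ g x) @ concat (map g xs)))"
    using tens_eq.trans by simp
  then show ?case by simp
qed

instantiation dpa2 :: (nontriv) ab_group_add
begin

lift_definition zero_dpa2 :: "'a dpa2" is "[]" .
lift_definition plus_dpa2 :: "'a dpa2 \<Rightarrow> 'a dpa2 \<Rightarrow> 'a dpa2" is "(@)"
  by (rule tens_eq.append)
lift_definition uminus_dpa2 :: "'a dpa2 \<Rightarrow> 'a dpa2" is "map (\<lambda>(p, p'). (- p, p'))"
  subgoal for u v using tens_eq_map[of u v "-1" 1 1 1] by simp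
  done
definition minus_dpa2 :: "'a dpa2 \<Rightarrow> 'a dpa2 \<Rightarrow> 'a dpa2" where
  "minus_dpa2 u v = u + - v"

lemma tens_eq_neg: "tens_eq (map (\<lambda>(p, p'). (- p, p')) u @ u) []"
proof (induction u)
  case Nil
  show ?case by (simp add: tens_eq.refl)
next
  case (Cons pp u)
  obtain p p' where pp: "pp = (p, p')" by (cases pp)
  let ?n = "map (\<lambda>(p, p'). (- p, p')) u"
  have "tens_eq ([(- p, p')] @ ((?n @ [(p, p')]) @ u)) ([(- p, p')] @ (([(p, p')] @ ?n) @ u))"
    by (intro tens_eq.append tens_eq.refl tens_eq.commute)
  moreover have "tens_eq [(- p + p, p')] []"
    by (simp add: tens_eq.zero)
  then have "tens_eq [(- p, p'), (p, p')] []"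
    by (rule tens_eq.trans[OF tens_eq.sym[OF tens_eq.add_left]])
  then have "tens_eq ([(- p, p'), (p, p')] @ (?n @ u)) ([] @ [])"
    by (rule tens_eq.append[OF _ Cons.IH])
  ultimately show ?case
    using tens_eq.trans[of "[(- p, p')] @ ((?n @ [(p, p')]) @ u)"
        "[(- p, p')] @ (([(p, p')] @ ?n) @ u)" "[]"]
    by (simp add: pp)
qed

instance
proof
  fix u v w :: "'a dpa2"
  show "u + v + w = u + (v + w)" by transfer (simp add: tens_eq.refl)
  show "u + v = v + u" by transfer (rule tens_eq.commute)
  show "0 + u = u" by transfer (simp add: tens_eq.refl)
  show "- u + u = 0" by transfer (rule tens_eq_neg)
  show "u - v = u + - v" by (simp add: minus_dpa2_def)
qed

end

lift_definition tens :: "'m::nontriv dpa \<Rightarrow> 'm dpa \<Rightarrow> 'm dpa2" (infix "\<otimes>\<^sub>A" 75)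
  is "\<lambda>a b. [(a, b)]" .

text \<open>\<open>tmap a b c d u = a u' b \<otimes> c u'' d\<close>. The outer bimodule structure is
  \<open>(b, c) \<mapsto> tmap b 1 1 c\<close>.\<close>

lift_definition tmap :: "'m::nontriv dpa \<Rightarrow> 'm dpa \<Rightarrow> 'm dpa \<Rightarrow> 'm dpa \<Rightarrow> 'm dpa2 \<Rightarrow> 'm dpa2"
  is "\<lambda>a b c d. map (\<lambda>(p, p'). (a * p * b, c * p' * d))"
  by (rule tens_eq_map)

lemma tmap_zero [simp]: "tmap a b c d 0 = 0"
  by transfer (simp add: tens_eq.refl)

lemma tmap_add: "tmap a b c d (u + v) = tmap a b c d u + tmap a b c d v"
  by transfer (simp add: tens_eq.refl)

lemma tmap_uminus: "tmap a b c d (- u) = - tmap a b c d u"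
  by (rule minus_unique[symmetric]) (simp flip: tmap_add)

lemma tmap_tens: "tmap a b c d (p \<otimes>\<^sub>A p') = (a * p * b) \<otimes>\<^sub>A (c * p' * d)"
  by transfer (simp add: tens_eq.refl)

lemma tens_add_left: "(a + b) \<otimes>\<^sub>A c = a \<otimes>\<^sub>A c + b \<otimes>\<^sub>A c"
  by transfer (simp add: tens_eq.add_left)

lemma tens_add_right: "a \<otimes>\<^sub>A (b + c) = a \<otimes>\<^sub>A b + a \<otimes>\<^sub>A c"
  by transfer (simp add: tens_eq.add_right)

lemma tens_scal: "(scal z * a) \<otimes>\<^sub>A b = a \<otimes>\<^sub>A (scal z * b)"
  by transfer (rule tens_eq.scale)

lemma dpa2_induct [case_names zero add]:
  assumes "P 0" and "\<And>a b u. P u \<Longrightarrow> P (a \<otimes>\<^sub>A b + u)"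
  shows "P (u :: 'm::nontriv dpa2)"
proof -
  have "P (abs_dpa2 us)" for us
  proof (induction us)
    case Nil
    show ?case using assms(1) by (simp add: zero_dpa2_def)
  next
    case (Cons ab us)
    show ?case using assms(2)[OF Cons.IH, of "fst ab" "snd ab"]
      by (simp add: tens.abs_eq plus_dpa2.abs_eq)
  qed
  then show ?thesis
    by (metis Quotient3_abs_rep Quotient3_dpa2)
qed

lemma tmap_tmap: "tmap a b c d (tmap a' b' c' d' u) = tmap (a * a') (b' * b) (c * c') (d' * d) u"
  by (induction u rule: dpa2_induct) (simp_all add: tmap_add tmap_tens mult.assoc)

lemma tmap_one [simp]: "tmap 1 1 1 1 u = u"
  by (induction u rule: dpa2_induct) (simp_all add: tmap_add tmap_tens)

lemma tmap_add_left: "tmap (a + a') 1 1 d u = tmap a 1 1 d u + tmap a' 1 1 d u"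
  by (induction u rule: dpa2_induct)
     (simp_all add: tmap_add tmap_tens tens_add_left Rings.distrib_right ac_simps)

lemma tmap_add_right: "tmap a 1 1 (d + d') u = tmap a 1 1 d u + tmap a 1 1 d' u"
  by (induction u rule: dpa2_induct)
     (simp_all add: tmap_add tmap_tens tens_add_right Rings.distrib_left ac_simps)

lemma tmap_scal: "tmap (scal z * a) 1 1 d u = tmap a 1 1 (d * scal z) u"
proof (induction u rule: dpa2_induct)
  case (add p p' u)
  have "(scal z * a * p) \<otimes>\<^sub>A (p' * d) = (a * p) \<otimes>\<^sub>A (p' * (d * scal z))"
    using tens_scal[of z "a * p" "p' * d"] by (simp add: mult.assoc scal_central_dpa)
  then show ?case using add.IH by (simp add: tmap_add tmap_tens)
qed simp

lemma tmap_zero_left [simp]: "tmap 0 1 1 d u = 0"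
  using tmap_add_left[of 0 0 d u] by simp

lemma tmap_zero_right [simp]: "tmap a 1 1 0 u = 0"
  using tmap_add_right[of a 0 0 u] by simp

abbreviation tscale :: "complex \<Rightarrow> 'm::nontriv dpa2 \<Rightarrow> 'm dpa2" where
  "tscale z \<equiv> tmap (scal z) 1 1 1"

text \<open>\<open>tcross u v = v' u'' \<otimes> u' v''\<close>.\<close>

lift_definition tcross :: "'m::nontriv dpa2 \<Rightarrow> 'm dpa2 \<Rightarrow> 'm dpa2"
  is "\<lambda>us vs. concat (map (\<lambda>(u, u'). map (\<lambda>(v, v'). (v * u', u * v')) vs) us)"
proof -
  fix us us' vs vs' :: "('m dpa \<times> 'm dpa) list"
  define f where "f us vs = concat (map (\<lambda>(u, u'). map (\<lambda>(v, v'). (v * u', u * v')) vs) us)"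
    for us vs :: "('m dpa \<times> 'm dpa) list"
  assume us: "tens_eq us us'" and vs: "tens_eq vs vs'"
  have 1: "tens_eq (f us vs) (f us vs')" if "tens_eq vs vs'" for us vs vs'
    unfolding f_def
  proof (rule tens_eq_concat, clarify)
    fix u u'
    show "tens_eq (map (\<lambda>(v, v'). (v * u', u * v')) vs) (map (\<lambda>(v, v'). (v * u', u * v')) vs')"
      using tens_eq_map[OF that, of 1 u' u 1] by simp
  qed
  have single: "f [(u, u')] vs = concat (map (\<lambda>(v, v'). [(v * u', u * v')]) vs)" for u u' vs
    by (induction vs) (auto simp: f_def)
  have 2: "tens_eq (f us vs) (f us' vs)" for vs
    using us
  proof (induction rule: tens_eq.induct)
    case (commute u v)
    show ?case by (simp add: f_def tens_eq.commute)
  next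
    case (append u u' v v')
    then show ?case by (simp add: f_def tens_eq.append)
  next
    case (add_left a b c)
    have "tens_eq (f [(a + b, c)] vs)
        (concat (map (\<lambda>vv. (case vv of (v, v') \<Rightarrow> [(v * c, a * v')])
                         @ (case vv of (v, v') \<Rightarrow> [(v * c, b * v')])) vs))"
      unfolding single
      by (rule tens_eq_concat) (clarsimp simp: Rings.distrib_right tens_eq.add_right)
    then have "tens_eq (f [(a + b, c)] vs) (f [(a, c)] vs @ f [(b, c)] vs)"
      unfolding single by (rule tens_eq.trans) (rule tens_eq_concat_append)
    then show ?case by (simp add: f_def)
  next
    case (add_right a b c)
    have "tens_eq (f [(a, b + c)] vs)
        (concat (map (\<lambda>vv. (case vv of (v, v') \<Rightarrow> [(v * b, a * v')])
                         @ (case vv of (v, v') \<Rightarrow> [(v * c, a * v')])) vs))"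
      unfolding single
      by (rule tens_eq_concat) (clarsimp simp: Rings.distrib_left tens_eq.add_left)
    then have "tens_eq (f [(a, b + c)] vs) (f [(a, b)] vs @ f [(a, c)] vs)"
      unfolding single by (rule tens_eq.trans) (rule tens_eq_concat_append)
    then show ?case by (simp add: f_def)
  next
    case (scale z a b)
    show ?case unfolding single
    proof (rule tens_eq_concat, clarify)
      fix v v'
      have "v * (scal z * b) = scal z * (v * b)"
        by (metis mult.assoc scal_central_dpa)
      then show "tens_eq [(v * b, scal z * a * v')] [(v * (scal z * b), a * v')]"
        by (metis mult.assoc tens_eq.scale tens_eq.sym)
    qed
  next
    case (zero a)
    have "tens_eq [(p, 0)] []" for p :: "'m dpa"
    proof -
      show ?thesis
        using tens_eq.trans[OF tens_eq.sym[OF tens_eq.scale[of 0 p 0]]] tens_eq.zero[of 0]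
        by simp
    qed
    then have "tens_eq (f [(0, a)] vs) (concat (map (\<lambda>_. []) vs))"
      unfolding single by (intro tens_eq_concat) auto
    moreover have "concat (map (\<lambda>_. []) vs) = ([] :: ('m dpa \<times> 'm dpa) list)"
      by simp
    ultimately show ?case by (simp add: f_def del: mult_zero_right)
  next
    case (refl u)
    show ?case by (rule tens_eq.refl)
  next
    case (sym u v)
    show ?case by (rule tens_eq.sym[OF sym.IH])
  next
    case (trans u v w)
    show ?case by (rule tens_eq.trans[OF trans.IH])
  qed
  show "tens_eq (concat (map (\<lambda>(u, u'). map (\<lambda>(v, v'). (v * u', u * v')) vs) us))
      (concat (map (\<lambda>(u, u'). map (\<lambda>(v, v'). (v * u', u * v')) vs') us'))"
    using tens_eq.trans[OF 1[OF vs] 2] unfolding f_def .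
qed


section \<open>Double derivations and the double bracket\<close>

text \<open>\<open>B\<close>-linearity of a derivation means that it vanishes on \<open>B\<close>, the span of the idempotents.\<close>

definition double_derivation :: "('m::nontriv dpa \<Rightarrow> 'm dpa2) \<Rightarrow> bool" where
  "double_derivation \<delta> \<longleftrightarrow>
     (\<forall>a b. \<delta> (a + b) = \<delta> a + \<delta> b) \<and>
     (\<forall>a b. \<delta> (a * b) = tmap a 1 1 1 (\<delta> b) + tmap 1 1 1 b (\<delta> a)) \<and>
     (\<forall>z i. \<delta> (scal z * idem i) = 0)"

text \<open>The bimodule structure \<open>(b \<delta> c)(a) = \<delta>(a)' c \<otimes> b \<delta>(a)''\<close> on double derivations.\<close>

definition dd_bimod ::
    "'m::nontriv dpa \<Rightarrow> ('m dpa \<Rightarrow> 'm dpa2) \<Rightarrow> 'm dpa \<Rightarrow> 'm dpa \<Rightarrow> 'm dpa2" where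
  "dd_bimod b \<delta> c = (\<lambda>a. tmap 1 c b 1 (\<delta> a))"

definition partial :: "'m::nontriv mod_ring arrow \<Rightarrow> 'm dpa \<Rightarrow> 'm dpa2" where
  "partial c = (THE \<delta>. double_derivation \<delta> \<and>
     (\<forall>b. \<delta> (arr b) = (if b = c then idem (tail c) \<otimes>\<^sub>A idem (head c) else 0)))"

definition pd_arr :: "'m::nontriv mod_ring arrow \<Rightarrow> 'm mod_ring arrow \<Rightarrow> 'm dpa2" where
  "pd_arr c b = (if b = c then idem (tail c) \<otimes>\<^sub>A idem (head c) else 0)"

definition pd_arr_opp :: "'m::nontriv mod_ring arrow \<Rightarrow> 'm mod_ring arrow \<Rightarrow> 'm dpa2" where
  "pd_arr_opp c b = tmap (arr b) 1 1 1 (pd_arr c (opp b)) + tmap 1 1 1 (arr (opp b)) (pd_arr c b)"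

fun pd_gen :: "'m::nontriv mod_ring arrow \<Rightarrow> 'm mod_ring gen \<Rightarrow> 'm dpa2" where
  "pd_gen c (GIdem i) = 0"
| "pd_gen c (GArr b) = pd_arr c b"
| "pd_gen c (GInv b) = - tmap (inv1 b) 1 1 (inv1 b) (pd_arr_opp c b)"

primrec pd_expr :: "'m::nontriv mod_ring arrow \<Rightarrow> 'm mod_ring expr \<Rightarrow> 'm dpa2" where
  "pd_expr c (Gen g) = pd_gen c g"
| "pd_expr c (Scal z) = 0"
| "pd_expr c (Plus s t) = pd_expr c s + pd_expr c t"
| "pd_expr c (Times s t) = tmap (abs_dpa s) 1 1 1 (pd_expr c t) + tmap 1 1 1 (abs_dpa t) (pd_expr c s)"

lemma abs_simps:
  "abs_dpa (Scal z) = scal z" "abs_dpa (Gen (GIdem i)) = idem i"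
  "abs_dpa (Gen (GArr a)) = arr a" "abs_dpa (Gen (GInv a)) = inv1 a"
  "abs_dpa (Plus s t) = abs_dpa s + abs_dpa t" "abs_dpa (Times s t) = abs_dpa s * abs_dpa t"
  by (simp_all add: scal_def idem_def arr_def inv1_def plus_dpa.abs_eq times_dpa.abs_eq)

lemma abs_eqI: "alg_eq s t \<Longrightarrow> abs_dpa s = abs_dpa t"
  by (simp add: dpa.abs_eq_iff)

lemma pd_expr_foldr: "pd_expr c (foldr (\<lambda>i. Plus (Gen (GIdem i))) is (Scal 0)) = 0"
  by (induction "is") auto

lemma pd_expr_cong: "alg_eq s t \<Longrightarrow> pd_expr c s = pd_expr c t"
proof (induction rule: alg_eq.induct)
  case (cong_times s s' t t')
  then show ?case by (simp add: abs_eqI)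
next
  case (plus_minus s)
  have "tmap (scal (-1)) 1 1 1 u + u = 0" for u :: "'a dpa2"
  proof -
    have "scal (-1) + (1 :: 'a dpa) = 0"
      by (metis add.left_inverse scal_add scal_one scal_zero)
    then show ?thesis
      using tmap_add_left[of "scal (-1)" 1 1 u] by (metis tmap_one tmap_zero_left)
  qed
  then show ?case by (simp add: abs_simps)
next
  case (scal_central z s)
  show ?case using tmap_scal[of z 1 1] by (simp add: abs_simps)
next
  case (tail_arrow a)
  show ?case by (simp add: abs_simps pd_arr_def tmap_tens idem_idem)
next
  case (arrow_head a)
  show ?case by (simp add: abs_simps pd_arr_def tmap_tens idem_idem)
next
  case (inv_left a)
  show ?case
    by (simp add: abs_simps tmap_uminus tmap_tmap inv1_left flip: pd_arr_opp_def)
next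
  case (inv_right a)
  show ?case
    by (simp add: abs_simps tmap_uminus tmap_tmap inv1_right flip: pd_arr_opp_def)
next
  case idem_sum
  show ?case by (simp add: pd_expr_foldr)
qed (simp_all add: abs_simps tmap_add tmap_tmap tmap_add_left tmap_add_right add_ac)

lemma partial_ex1:
  "\<exists>!\<delta>. double_derivation \<delta> \<and>
     (\<forall>b. \<delta> (arr b) = (if b = c then idem (tail c) \<otimes>\<^sub>A idem (head c) else 0))"
proof (rule ex_ex1I)
  define \<delta> where "\<delta> a = pd_expr c (rep_dpa a)" for a
  have abs: "\<delta> (abs_dpa s) = pd_expr c s" for s
    unfolding \<delta>_def by (rule pd_expr_cong)
      (use Quotient3_rep_abs[OF Quotient3_dpa alg_eq.refl] in blast)
  have ex: "\<exists>s. a = abs_dpa s" for a :: "'a dpa"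
    by (metis Quotient3_abs_rep Quotient3_dpa)
  have "\<delta> (a + b) = \<delta> a + \<delta> b" for a b
  proof -
    obtain s t where st: "a = abs_dpa s" "b = abs_dpa t" using ex by metis
    have "\<delta> (abs_dpa (Plus s t)) = \<delta> a + \<delta> b"
      unfolding abs st by simp
    then show ?thesis by (simp add: abs_simps st)
  qed
  moreover have "\<delta> (a * b) = tmap a 1 1 1 (\<delta> b) + tmap 1 1 1 b (\<delta> a)" for a b
  proof -
    obtain s t where st: "a = abs_dpa s" "b = abs_dpa t" using ex by metis
    have "\<delta> (abs_dpa (Times s t)) = tmap a 1 1 1 (\<delta> b) + tmap 1 1 1 b (\<delta> a)"
      unfolding abs st by simp
    then show ?thesis by (simp add: abs_simps st)
  qed
  moreover have "\<delta> (scal z * idem i) = 0" for z i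
    using abs[of "Times (Scal z) (Gen (GIdem i))"] by (simp add: abs_simps)
  moreover have "\<delta> (arr b) = (if b = c then idem (tail c) \<otimes>\<^sub>A idem (head c) else 0)" for b
    using abs[of "Gen (GArr b)"] by (simp add: abs_simps pd_arr_def)
  ultimately show "\<exists>\<delta>. double_derivation \<delta> \<and>
     (\<forall>b. \<delta> (arr b) = (if b = c then idem (tail c) \<otimes>\<^sub>A idem (head c) else 0))"
    unfolding double_derivation_def by blast
next
  fix \<delta> \<delta>' :: "'a dpa \<Rightarrow> 'a dpa2"
  assume A: "double_derivation \<delta> \<and>
     (\<forall>b. \<delta> (arr b) = (if b = c then idem (tail c) \<otimes>\<^sub>A idem (head c) else 0))"
  assume A': "double_derivation \<delta>' \<and>
     (\<forall>b. \<delta>' (arr b) = (if b = c then idem (tail c) \<otimes>\<^sub>A idem (head c) else 0))"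
  have z: "\<delta> 0 = 0" "\<delta> (scal z) = 0" "\<delta> (inv1 a) =
      - tmap (inv1 a) 1 1 (inv1 a) (\<delta> (arr a * arr (opp a)))"
    if "double_derivation \<delta>" for \<delta> :: "'a dpa \<Rightarrow> 'a dpa2" and z a
  proof -
    have add: "\<delta> (a + b) = \<delta> a + \<delta> b"
      and mult: "\<delta> (a * b) = tmap a 1 1 1 (\<delta> b) + tmap 1 1 1 b (\<delta> a)"
      and B: "\<delta> (scal z * idem i) = 0" for a b z i
      using that unfolding double_derivation_def by blast+
    show zero: "\<delta> 0 = 0" using add[of 0 0] by simp
    have "\<delta> (scal z * foldr (\<lambda>i. (+) (idem i)) is 0) = 0" for z "is"
      by (induction "is") (simp_all add: zero Rings.distrib_left add B)
    then have s: "\<delta> (scal z) = 0" for z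
      by (metis idem_sum mult.right_neutral)
    show "\<delta> (scal z) = 0" by (rule s)
    have one: "\<delta> 1 = 0" using s[of 1] by simp
    let ?p = "1 + arr a * arr (opp a)"
    have "0 = \<delta> (?p * inv1 a)" by (simp add: inv1_right one)
    also have "\<dots> = tmap ?p 1 1 1 (\<delta> (inv1 a)) + tmap 1 1 1 (inv1 a) (\<delta> ?p)" by (rule mult)
    also have "\<delta> ?p = \<delta> (arr a * arr (opp a))" by (simp add: add one)
    finally have "tmap (inv1 a) 1 1 1 (tmap ?p 1 1 1 (\<delta> (inv1 a)))
        + tmap (inv1 a) 1 1 1 (tmap 1 1 1 (inv1 a) (\<delta> (arr a * arr (opp a)))) = 0"
      by (metis tmap_add tmap_zero)
    then show "\<delta> (inv1 a) = - tmap (inv1 a) 1 1 (inv1 a) (\<delta> (arr a * arr (opp a)))"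
      by (simp add: tmap_tmap inv1_left eq_neg_iff_add_eq_0)
  qed
  have "\<delta> (abs_dpa s) = \<delta>' (abs_dpa s)" for s
  proof (induction s)
    case (Gen g)
    show ?case
    proof (cases g)
      case (GIdem i)
      have "\<delta> (scal 1 * idem i) = 0" "\<delta>' (scal 1 * idem i) = 0"
        using A A' unfolding double_derivation_def by blast+
      then show ?thesis by (simp add: GIdem abs_simps)
    next
      case (GArr b)
      show ?thesis using A A' by (simp add: GArr abs_simps)
    next
      case (GInv b)
      have "\<delta> (arr b * arr (opp b)) = \<delta>' (arr b * arr (opp b))"
        using A A' unfolding double_derivation_def by simp
      then show ?thesis using z(3)[of \<delta> b] z(3)[of \<delta>' b] A A' by (simp add: GInv abs_simps)
    qed
  next
    case (Scal z)
    show ?case using A A' by (simp add: abs_simps z)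
  next
    case (Plus s t)
    then show ?case using A A' unfolding double_derivation_def by (simp add: abs_simps)
  next
    case (Times s t)
    then show ?case using A A' unfolding double_derivation_def by (simp add: abs_simps)
  qed
  then show "\<delta> = \<delta>'"
    by (metis Quotient3_abs_rep Quotient3_dpa ext)
qed

definition dbr_prod :: "('m::nontriv dpa \<Rightarrow> 'm dpa2) \<Rightarrow> ('m dpa \<Rightarrow> 'm dpa2) \<Rightarrow>
    'm dpa \<Rightarrow> 'm dpa \<Rightarrow> 'm dpa2" where
  "dbr_prod \<delta>\<^sub>1 \<delta>\<^sub>2 a b = tcross (\<delta>\<^sub>1 a) (\<delta>\<^sub>2 b) - tcross (\<delta>\<^sub>2 a) (\<delta>\<^sub>1 b)"

definition F_der :: "'m::nontriv mod_ring arrow \<Rightarrow> 'm dpa \<Rightarrow> 'm dpa2" where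
  "F_der c = (\<lambda>a. dd_bimod 1 (partial (opp c)) (arr (opp c)) a - dd_bimod (arr c) (partial c) 1 a)"

definition double_bracket :: "'m::nontriv dpa \<Rightarrow> 'm dpa \<Rightarrow> 'm dpa2" ("\<lbrace>_, _\<rbrace>") where
  "double_bracket a b =
     tscale (1/2) (\<Sum>c\<in>UNIV. tscale (eps c)
       (dbr_prod (dd_bimod (1 + arr (opp c) * arr c) (partial c) 1) (partial (opp c)) a b))
   - tscale (1/2) (\<Sum>(c, d)\<in>{(c, d). arrow_less c d}. dbr_prod (F_der c) (F_der d) a b)"


section \<open>Representations and their coordinate rings\<close>

abbreviation M :: "nat \<Rightarrow> complex mat ring" where
  "M n \<equiv> ring_mat TYPE(complex) n ()"

definition dim_cyc :: "('m::nontriv mod_ring \<Rightarrow> nat) \<Rightarrow> nat" where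
  "dim_cyc \<alpha> = (\<Sum>i\<in>UNIV. \<alpha> i)"

abbreviation dim_tot :: "('m::nontriv mod_ring \<Rightarrow> nat) \<Rightarrow> nat" where
  "dim_tot \<alpha> \<equiv> Suc (dim_cyc \<alpha>)"

fun dim_vec :: "('m::nontriv mod_ring \<Rightarrow> nat) \<Rightarrow> 'm mod_ring vertex \<Rightarrow> nat" where
  "dim_vec \<alpha> (Cyc i) = \<alpha> i"
| "dim_vec \<alpha> Infty = 1"

definition block_id :: "('m::nontriv mod_ring \<Rightarrow> nat) \<Rightarrow> 'm mod_ring vertex \<Rightarrow> complex mat" where
  "block_id \<alpha> i = diag_block_mat
     (map (\<lambda>j. if j = i then 1\<^sub>m (dim_vec \<alpha> j) else 0\<^sub>m (dim_vec \<alpha> j) (dim_vec \<alpha> j)) vertices)"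

type_synonym 'm rep = "'m dpa \<Rightarrow> complex mat"

definition Rep :: "('m::nontriv mod_ring \<Rightarrow> nat) \<Rightarrow> 'm rep set" where
  "Rep \<alpha> = {\<rho>. (\<forall>a. \<rho> a \<in> carrier_mat (dim_tot \<alpha>) (dim_tot \<alpha>)) \<and>
     (\<forall>a b. \<rho> (a + b) = \<rho> a + \<rho> b) \<and> (\<forall>a b. \<rho> (a * b) = \<rho> a * \<rho> b) \<and>
     (\<forall>z. \<rho> (scal z) = z \<cdot>\<^sub>m 1\<^sub>m (dim_tot \<alpha>)) \<and> (\<forall>i. \<rho> (idem i) = block_id \<alpha> i)}"

text \<open>The block of a matrix on the part indexed by the cyclic vertices (the block of \<open>\<infinity>\<close> comes last).\<close>

definition cyc_block :: "('m::nontriv mod_ring \<Rightarrow> nat) \<Rightarrow> complex mat \<Rightarrow> complex mat" where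
  "cyc_block \<alpha> C = mat (dim_cyc \<alpha>) (dim_cyc \<alpha>) (\<lambda>(r, s). C $$ (r, s))"

definition Xmat :: "('m::nontriv mod_ring \<Rightarrow> nat) \<Rightarrow> 'm rep \<Rightarrow> complex mat" where
  "Xmat \<alpha> \<rho> = cyc_block \<alpha> (\<rho> x_elem)"

definition Ymat :: "('m::nontriv mod_ring \<Rightarrow> nat) \<Rightarrow> 'm rep \<Rightarrow> complex mat" where
  "Ymat \<alpha> \<rho> = cyc_block \<alpha> (\<rho> y_elem)"

definition Rep0 :: "('m::nontriv mod_ring \<Rightarrow> nat) \<Rightarrow> 'm rep set" where
  "Rep0 \<alpha> = {\<rho> \<in> Rep \<alpha>. invertible_mat (Xmat \<alpha> \<rho>)}"

text \<open>\<open>Rep(A, \<alpha>)\<close> is a principal open subscheme of an affine space, namely the locus where the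
  determinants of all \<open>1 + a a\<^sup>*\<close> are nonzero. It is therefore reduced, and its coordinate ring is
  the algebra of functions on its set of complex points generated by the matrix entry functions
  \<open>a\<^sub>r\<^sub>s\<close>, \<open>a \<in> A\<close>.\<close>

inductive_set reg_funs :: "('m::nontriv mod_ring \<Rightarrow> nat) \<Rightarrow> ('m rep \<Rightarrow> complex) set"
  for \<alpha> where
  const: "(\<lambda>\<rho>\<in>Rep \<alpha>. z) \<in> reg_funs \<alpha>"
| entry: "r < dim_tot \<alpha> \<Longrightarrow> s < dim_tot \<alpha> \<Longrightarrow> (\<lambda>\<rho>\<in>Rep \<alpha>. \<rho> a $$ (r, s)) \<in> reg_funs \<alpha>"
| add: "F \<in> reg_funs \<alpha> \<Longrightarrow> G \<in> reg_funs \<alpha> \<Longrightarrow> (\<lambda>\<rho>\<in>Rep \<alpha>. F \<rho> + G \<rho>) \<in> reg_funs \<alpha>"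
| mult: "F \<in> reg_funs \<alpha> \<Longrightarrow> G \<in> reg_funs \<alpha> \<Longrightarrow> (\<lambda>\<rho>\<in>Rep \<alpha>. F \<rho> * G \<rho>) \<in> reg_funs \<alpha>"

text \<open>Regular functions on the principal open subset where \<open>X\<close> is invertible.\<close>

definition reg_funs0 :: "('m::nontriv mod_ring \<Rightarrow> nat) \<Rightarrow> ('m rep \<Rightarrow> complex) set" where
  "reg_funs0 \<alpha> = {(\<lambda>\<rho>\<in>Rep0 \<alpha>. F \<rho> / det (Xmat \<alpha> \<rho>) ^ k) | F k. F \<in> reg_funs \<alpha>}"

definition fun_ring :: "'p set \<Rightarrow> ('p \<Rightarrow> complex) set \<Rightarrow> ('p \<Rightarrow> complex) ring" where
  "fun_ring U \<O> = \<lparr>carrier = \<O>, mult = (\<lambda>F G. \<lambda>\<rho>\<in>U. F \<rho> * G \<rho>), one = (\<lambda>\<rho>\<in>U. 1),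
     zero = (\<lambda>\<rho>\<in>U. 0), add = (\<lambda>F G. \<lambda>\<rho>\<in>U. F \<rho> + G \<rho>)\<rparr>"


section \<open>The multiplicative quiver variety\<close>

definition q_infty :: "('m::nontriv mod_ring \<Rightarrow> nat) \<Rightarrow> ('m mod_ring \<Rightarrow> complex) \<Rightarrow> complex" where
  "q_infty \<alpha> q = (\<Prod>i\<in>UNIV. inverse (q i) ^ \<alpha> i)"

text \<open>The two-sided ideal of \<open>A\<close> with quotient the multiplicative preprojective algebra. The
  inverse of \<open>e\<^sub>i + a a\<^sup>*\<close> in \<open>e\<^sub>i A e\<^sub>i\<close>, where \<open>i = t(a)\<close>, is \<open>e\<^sub>i (1 + a a\<^sup>*)\<^sup>-\<^sup>1\<close>.\<close>

inductive_set preproj_ideal ::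
    "('m::nontriv mod_ring \<Rightarrow> nat) \<Rightarrow> ('m mod_ring \<Rightarrow> complex) \<Rightarrow> 'm dpa set"
  for \<alpha> q where
  rel_cyc: "i \<noteq> 0 \<Longrightarrow>
     idem (Cyc i) * inv1 (Ay (i - 1)) * (idem (Cyc i) + arr (Ax i) * arr (Ay i))
       - scal (q i) * idem (Cyc i) \<in> preproj_ideal \<alpha> q"
| rel_zero:
    "idem (Cyc 0) * inv1 (Ay (- 1)) * (idem (Cyc 0) + arr (Ax 0) * arr (Ay 0))
         * (idem (Cyc 0) + arr Av * arr Aw)
       - scal (q 0) * idem (Cyc 0) \<in> preproj_ideal \<alpha> q"
| rel_infty: "idem Infty * inv1 Aw - scal (q_infty \<alpha> q) * idem Infty \<in> preproj_ideal \<alpha> q"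
| add: "a \<in> preproj_ideal \<alpha> q \<Longrightarrow> b \<in> preproj_ideal \<alpha> q \<Longrightarrow> a + b \<in> preproj_ideal \<alpha> q"
| mult: "a \<in> preproj_ideal \<alpha> q \<Longrightarrow> b * a * c \<in> preproj_ideal \<alpha> q"

text \<open>In the following definitions \<open>U\<close> is \<open>Rep \<alpha>\<close> or its open subset \<open>Rep0 \<alpha>\<close>, and \<open>R\<close> is the ring
  of regular functions on \<open>U\<close>. The ideal below is that of the closed subscheme of \<open>U\<close> formed by
  the representations of the multiplicative preprojective algebra; it need not be radical.\<close>

definition rep_ideal :: "('m::nontriv mod_ring \<Rightarrow> nat) \<Rightarrow> ('m mod_ring \<Rightarrow> complex) \<Rightarrow>
    'm rep set \<Rightarrow> ('m rep \<Rightarrow> complex) ring \<Rightarrow> ('m rep \<Rightarrow> complex) set" where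
  "rep_ideal \<alpha> q U R = genideal R
     {(\<lambda>\<rho>\<in>U. \<rho> a $$ (r, s)) | a r s. a \<in> preproj_ideal \<alpha> q \<and> r < dim_tot \<alpha> \<and> s < dim_tot \<alpha>}"

text \<open>\<open>GL_\<alpha>\<close> as block diagonal matrices, acting trivially at \<open>\<infinity>\<close>.\<close>

definition GL :: "('m::nontriv mod_ring \<Rightarrow> nat) \<Rightarrow> complex mat set" where
  "GL \<alpha> = {diag_block_mat (map (case_vertex g (1\<^sub>m 1)) vertices) | g. \<forall>i. g i \<in> Units (M (\<alpha> i))}"

definition gl_act :: "('m::nontriv mod_ring \<Rightarrow> nat) \<Rightarrow> 'm rep set \<Rightarrow> complex mat \<Rightarrow>
    ('m rep \<Rightarrow> complex) \<Rightarrow> ('m rep \<Rightarrow> complex)" where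
  "gl_act \<alpha> U g F = (\<lambda>\<rho>\<in>U. F (\<lambda>a. inv\<^bsub>M (dim_tot \<alpha>)\<^esub> g * \<rho> a * g))"

definition inv_funs :: "('m::nontriv mod_ring \<Rightarrow> nat) \<Rightarrow> 'm rep set \<Rightarrow>
    ('m rep \<Rightarrow> complex) ring \<Rightarrow> ('m rep \<Rightarrow> complex) set" where
  "inv_funs \<alpha> U R = {F \<in> carrier R. \<forall>g\<in>GL \<alpha>. gl_act \<alpha> U g F = F}"

text \<open>The invariants of the coordinate ring of representations of the preprojective algebra, i.e.
  the functions on the quotient by \<open>GL_\<alpha>\<close>; the elements are cosets of \<open>rep_ideal\<close>.\<close>

definition quot_funs :: "('m::nontriv mod_ring \<Rightarrow> nat) \<Rightarrow> ('m mod_ring \<Rightarrow> complex) \<Rightarrow>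
    'm rep set \<Rightarrow> ('m rep \<Rightarrow> complex) ring \<Rightarrow> ('m rep \<Rightarrow> complex) set set" where
  "quot_funs \<alpha> q U R =
     {f \<in> carrier (R Quot rep_ideal \<alpha> q U R). \<forall>g\<in>GL \<alpha>. gl_act \<alpha> U g ` f = f}"


section \<open>Poisson brackets\<close>

text \<open>The value at \<open>\<rho>\<close> of \<open>u'\<^sub>r\<^sub>s u''\<^sub>k\<^sub>l\<close>, for \<open>u = u' \<otimes> u''\<close> with the sum suppressed. For \<open>\<rho> \<in> Rep \<alpha>\<close>
  it does not depend on the chosen decomposition into pure tensors.\<close>

definition tens_entry :: "'m::nontriv rep \<Rightarrow> 'm dpa2 \<Rightarrow> nat \<times> nat \<Rightarrow> nat \<times> nat \<Rightarrow> complex" where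
  "tens_entry \<rho> u rs kl = (let us = (SOME us. u = (\<Sum>(a, b)\<leftarrow>us. a \<otimes>\<^sub>A b))
     in (\<Sum>(a, b)\<leftarrow>us. \<rho> a $$ rs * \<rho> b $$ kl))"

definition is_rep_bracket :: "('m::nontriv mod_ring \<Rightarrow> nat) \<Rightarrow> 'm rep set \<Rightarrow>
    ('m rep \<Rightarrow> complex) ring \<Rightarrow>
    (('m rep \<Rightarrow> complex) \<Rightarrow> ('m rep \<Rightarrow> complex) \<Rightarrow> ('m rep \<Rightarrow> complex)) \<Rightarrow> bool" where
  "is_rep_bracket \<alpha> U R br \<longleftrightarrow>
     (\<forall>F\<in>carrier R. \<forall>G\<in>carrier R. br F G \<in> carrier R \<and> br F G = (\<lambda>\<rho>\<in>U. - br G F \<rho>)) \<and>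
     (\<forall>F\<in>carrier R. \<forall>G\<in>carrier R. \<forall>H\<in>carrier R.
        br F (G \<oplus>\<^bsub>R\<^esub> H) = br F G \<oplus>\<^bsub>R\<^esub> br F H \<and>
        br F (G \<otimes>\<^bsub>R\<^esub> H) = (G \<otimes>\<^bsub>R\<^esub> br F H) \<oplus>\<^bsub>R\<^esub> (br F G \<otimes>\<^bsub>R\<^esub> H)) \<and>
     (\<forall>F\<in>carrier R. \<forall>z. br F (\<lambda>\<rho>\<in>U. z) = \<zero>\<^bsub>R\<^esub>) \<and>
     (\<forall>a b. \<forall>i<dim_tot \<alpha>. \<forall>j<dim_tot \<alpha>. \<forall>u<dim_tot \<alpha>. \<forall>v<dim_tot \<alpha>.
        br (\<lambda>\<rho>\<in>U. \<rho> a $$ (i, j)) (\<lambda>\<rho>\<in>U. \<rho> b $$ (u, v))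
          = (\<lambda>\<rho>\<in>U. tens_entry \<rho> \<lbrace>a, b\<rbrace> (u, j) (i, v)))"

text \<open>The bracket \<open>P\<close> on the quotient induced by quasi-Hamiltonian reduction, computed on invariant
  lifts. As \<open>GL_\<alpha>\<close> is reductive, every element of \<open>quot_funs\<close> has such a lift, so the condition
  determines \<open>P\<close> on \<open>quot_funs\<close>. It also determines \<open>br\<close>, since the entry functions (and, on
  \<open>Rep0\<close>, the inverse of \<open>det X\<close>) generate the ring.\<close>

definition is_reduced_bracket :: "('m::nontriv mod_ring \<Rightarrow> nat) \<Rightarrow> ('m mod_ring \<Rightarrow> complex) \<Rightarrow>
    'm rep set \<Rightarrow> ('m rep \<Rightarrow> complex) ring \<Rightarrow>
    (('m rep \<Rightarrow> complex) set \<Rightarrow> ('m rep \<Rightarrow> complex) set \<Rightarrow> ('m rep \<Rightarrow> complex) set) \<Rightarrow> bool" where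
  "is_reduced_bracket \<alpha> q U R P \<longleftrightarrow> (\<exists>br. is_rep_bracket \<alpha> U R br \<and>
     (\<forall>F\<in>inv_funs \<alpha> U R. \<forall>G\<in>inv_funs \<alpha> U R.
        P (rep_ideal \<alpha> q U R +>\<^bsub>R\<^esub> F) (rep_ideal \<alpha> q U R +>\<^bsub>R\<^esub> G) = rep_ideal \<alpha> q U R +>\<^bsub>R\<^esub> br F G))"

abbreviation ORep :: "('m::nontriv mod_ring \<Rightarrow> nat) \<Rightarrow> ('m rep \<Rightarrow> complex) ring" where
  "ORep \<alpha> \<equiv> fun_ring (Rep \<alpha>) (reg_funs \<alpha>)"

abbreviation ORep0 :: "('m::nontriv mod_ring \<Rightarrow> nat) \<Rightarrow> ('m rep \<Rightarrow> complex) ring" where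
  "ORep0 \<alpha> \<equiv> fun_ring (Rep0 \<alpha>) (reg_funs0 \<alpha>)"

text \<open>A family of functions on the quotient that pairwise Poisson commute.\<close>

definition poisson_commuting :: "('m::nontriv mod_ring \<Rightarrow> nat) \<Rightarrow> ('m mod_ring \<Rightarrow> complex) \<Rightarrow>
    'm rep set \<Rightarrow> ('m rep \<Rightarrow> complex) ring \<Rightarrow>
    (('m rep \<Rightarrow> complex) set \<Rightarrow> ('m rep \<Rightarrow> complex) set \<Rightarrow> ('m rep \<Rightarrow> complex) set) \<Rightarrow>
    ('m rep \<Rightarrow> complex) set set \<Rightarrow> bool" where
  "poisson_commuting \<alpha> q U R P \<F> \<longleftrightarrow> \<F> \<subseteq> quot_funs \<alpha> q U R \<and>
     (\<forall>f\<in>\<F>. \<forall>g\<in>\<F>. P f g = \<zero>\<^bsub>R Quot rep_ideal \<alpha> q U R\<^esub>)"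

definition mtrace :: "complex mat \<Rightarrow> complex" where
  "mtrace C = (\<Sum>r<dim_row C. C $$ (r, r))"

text \<open>The class in the coordinate ring of the quotient of the function \<open>\<rho> \<mapsto> tr (T \<rho>)\<close> on \<open>U\<close>.\<close>

definition tr_class :: "('m::nontriv mod_ring \<Rightarrow> nat) \<Rightarrow> ('m mod_ring \<Rightarrow> complex) \<Rightarrow>
    'm rep set \<Rightarrow> ('m rep \<Rightarrow> complex) ring \<Rightarrow> ('m rep \<Rightarrow> complex mat) \<Rightarrow>
    ('m rep \<Rightarrow> complex) set" where
  "tr_class \<alpha> q U R T = rep_ideal \<alpha> q U R +>\<^bsub>R\<^esub> (\<lambda>\<rho>\<in>U. mtrace (T \<rho>))"

end

theory Submission
  imports Defs
begin

text \<open>All brackets vanish already on the representation space of \<open>A\<close>, before the moment map relation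
  is imposed. At a point \<open>\<rho>\<close>, write \<open>dF = tr (P dX) + tr (Q dY)\<close> and \<open>dG = tr (P' dX) + tr (Q' dY)\<close>.
  The trace of a bracket \<open>\<lbrace>-, -\<rbrace>\<close> attached to \<open>\<delta>\<^sub>1 \<delta>\<^sub>2\<close> only involves the cyclic derivatives, in which
  \<open>u' \<otimes> u''\<close> becomes \<open>u'' P u'\<close>. Since \<open>P\<close> and \<open>Q\<close> have degrees \<open>-1\<close> and \<open>1\<close> for the cyclic
  grading, the sums over the vertices collapse, and \<open>2 {F, G}\<close> is
  \<open>tr Q'(1 + YX)P - tr (1 + YX)P'Q - tr P'(1 + XY)Q + tr (1 + XY)Q'P
    - tr (Q'Y - XP')(PX - YQ) + tr (P'X - YQ')(QY - XP)\<close>.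
  For the four families \<open>(P, Q)\<close> is \<open>(kX\<^sup>k\<^sup>-\<^sup>1, 0)\<close>, \<open>(0, kY\<^sup>k\<^sup>-\<^sup>1)\<close>, \<open>(YS, SX)\<close> with
  \<open>S = k(1 + XY)\<^sup>k\<^sup>-\<^sup>1\<close>, and \<open>(-X\<^sup>-\<^sup>1SX\<^sup>-\<^sup>1, S)\<close> with \<open>S = kZ\<^sup>k\<^sup>-\<^sup>1\<close>, \<open>Z = Y + X\<^sup>-\<^sup>1\<close>; the expression
  vanishes because \<open>S\<close> and \<open>S'\<close> commute. The matrix \<open>Z\<close> is invertible since \<open>ZX = 1 + YX\<close> and \<open>1 + XY\<close>
  is invertible in \<open>A\<close>.\<close>

section \<open>Square matrices\<close>

text \<open>The bracket is given only abstractly, as some biderivation \<open>br\<close> with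
  prescribed values on matrix entries, so there is no formula to differentiate. Gradients become
  available because \<open>br H\<close>, followed by evaluation at \<rho>, is a derivation at the
  point \<rho>; every chain rule, including the one for inverse matrices, then follows from the
  Leibniz rule. Only double brackets among x and y are evaluated, never those of powers or inverses.
  The framing arrows drop out because the derivatives of x and y along them vanish; of the ordered
  pairs at each vertex just y before x remains. The exponents j m make the gradients of the power
  traces homogeneous of degrees -1 and 1 modulo m; for 1 + XY the degrees are right for every
  exponent. On the quotient, members of a commuting family must be cosets mapped onto themselves by
  the group, whence the stability of the (possibly nonradical) ideal and the equivariance of the
  matrix functions.\<close>

lemma sq_mult_carrier [simp]:
  "A \<in> carrier_mat n n \<Longrightarrow> B \<in> carrier_mat n n \<Longrightarrow> A * B \<in> carrier_mat n n"
  by simp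

text \<open>The library versions of these rules have free inner dimensions, which the simplifier cannot
  instantiate.\<close>

lemma sq_algebra:
  fixes A B C :: "'a::comm_ring_1 mat"
  shows "A \<in> carrier_mat n n \<Longrightarrow> 1\<^sub>m n * A = A"
    and "A \<in> carrier_mat n n \<Longrightarrow> A * 1\<^sub>m n = A"
    and "A \<in> carrier_mat n n \<Longrightarrow> B \<in> carrier_mat n n \<Longrightarrow> C \<in> carrier_mat n n \<Longrightarrow>
      (A * B) * C = A * (B * C)"
    and "A \<in> carrier_mat n n \<Longrightarrow> B \<in> carrier_mat n n \<Longrightarrow> C \<in> carrier_mat n n \<Longrightarrow>
      (A + B) * C = A * C + B * C"
    and "A \<in> carrier_mat n n \<Longrightarrow> B \<in> carrier_mat n n \<Longrightarrow> C \<in> carrier_mat n n \<Longrightarrow>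
      A * (B + C) = A * B + A * C"
    and "A \<in> carrier_mat n n \<Longrightarrow> B \<in> carrier_mat n n \<Longrightarrow> C \<in> carrier_mat n n \<Longrightarrow>
      (A - B) * C = A * C - B * C"
    and "A \<in> carrier_mat n n \<Longrightarrow> B \<in> carrier_mat n n \<Longrightarrow> C \<in> carrier_mat n n \<Longrightarrow>
      A * (B - C) = A * B - A * C"
    and "A \<in> carrier_mat n n \<Longrightarrow> B \<in> carrier_mat n n \<Longrightarrow> (- A) * B = - (A * B)"
    and "A \<in> carrier_mat n n \<Longrightarrow> B \<in> carrier_mat n n \<Longrightarrow> A * (- B) = - (A * B)"
    and "A \<in> carrier_mat n n \<Longrightarrow> B \<in> carrier_mat n n \<Longrightarrow> (k \<cdot>\<^sub>m A) * B = k \<cdot>\<^sub>m (A * B)"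
    and "A \<in> carrier_mat n n \<Longrightarrow> B \<in> carrier_mat n n \<Longrightarrow> A * (k \<cdot>\<^sub>m B) = k \<cdot>\<^sub>m (A * B)"
  by (simp_all add: assoc_mult_mat[of _ n n _ n _ n] add_mult_distrib_mat[of _ n n _ _ n]
      mult_add_distrib_mat[of _ n n _ n] minus_mult_distrib_mat[of _ n n _ _ n]
      mult_minus_distrib_mat[of _ n n _ n] mult_smult_distrib[of _ n n _ n]
      mult_smult_assoc_mat[of _ n n _ n])

lemma mtrace_mult:
  assumes "A \<in> carrier_mat n n" "B \<in> carrier_mat n n"
  shows "mtrace (A * B) = (\<Sum>i<n. \<Sum>j<n. A $$ (i, j) * B $$ (j, i))"
  using assms by (auto simp: mtrace_def scalar_prod_def atLeast0LessThan intro!: sum.cong)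

lemma mtrace_comm:
  assumes "A \<in> carrier_mat n n" "B \<in> carrier_mat n n"
  shows "mtrace (A * B) = mtrace (B * A)"
  unfolding mtrace_mult[OF assms] mtrace_mult[OF assms(2,1)]
  by (subst sum.swap) (simp add: mult.commute)

lemma mtrace_add:
  assumes "A \<in> carrier_mat n n" "B \<in> carrier_mat n n"
  shows "mtrace (A + B) = mtrace A + mtrace B"
  using assms by (auto simp: mtrace_def sum.distrib)

lemma mtrace_uminus: "mtrace (- A) = - mtrace A" if "A \<in> carrier_mat n n"
  using that by (auto simp: mtrace_def sum_negf)

lemma mtrace_smult: "mtrace (k \<cdot>\<^sub>m A) = k * mtrace A" if "A \<in> carrier_mat n n"
  using that by (auto simp: mtrace_def sum_distrib_left)

lemma mtrace_zero [simp]: "mtrace (0\<^sub>m n n) = 0"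
  by (simp add: mtrace_def)

lemma mtrace_conj:
  assumes "A \<in> carrier_mat n n" "g \<in> carrier_mat n n" "h \<in> carrier_mat n n" "g * h = 1\<^sub>m n"
  shows "mtrace (h * A * g) = mtrace A"
proof -
  have "mtrace (h * A * g) = mtrace (h * (A * g))"
    using assms by (simp add: sq_algebra[where n = n])
  also have "\<dots> = mtrace (A * g * h)"
    using assms by (intro mtrace_comm) auto
  also have "\<dots> = mtrace A"
    using assms by (simp add: sq_algebra[where n = n])
  finally show ?thesis .
qed

lemma conj_mult_mat:
  assumes "(A :: complex mat) \<in> carrier_mat n n" "B \<in> carrier_mat n n" "g \<in> carrier_mat n n" "h \<in> carrier_mat n n"
    and "g * h = 1\<^sub>m n"
  shows "(h * A * g) * (h * B * g) = h * (A * B) * g"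
proof -
  have "(h * A * g) * (h * B * g) = h * A * ((g * h) * (B * g))"
    using assms(1-4) by (simp add: sq_algebra[where n = n])
  also have "\<dots> = h * (A * B) * g"
    unfolding assms(5) using assms(1-4)
    by (simp add: sq_algebra[where n = n])
  finally show ?thesis .
qed

lemma conj_pow_mat:
  assumes "(A :: complex mat) \<in> carrier_mat n n" "g \<in> carrier_mat n n" "h \<in> carrier_mat n n"
    and "g * h = 1\<^sub>m n" "h * g = 1\<^sub>m n"
  shows "(h * A * g) ^\<^sub>m k = h * (A ^\<^sub>m k) * g"
proof (induction k)
  case 0
  show ?case using assms by simp
next
  case (Suc k)
  have "(h * A * g) ^\<^sub>m Suc k = (h * (A ^\<^sub>m k) * g) * (h * A * g)"
    by (simp only: pow_mat.simps Suc)
  also have "\<dots> = h * (A ^\<^sub>m k * A) * g"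
    using assms(1) by (intro conj_mult_mat[OF _ _ assms(2-4)]) auto
  finally show ?case by simp
qed

lemma pow_mat_comm:
  assumes "(A :: complex mat) \<in> carrier_mat n n" "B \<in> carrier_mat n n" "A * B = B * A"
  shows "A ^\<^sub>m k * B = B * A ^\<^sub>m k"
proof (induction k)
  case 0
  show ?case using assms by simp
next
  case (Suc k)
  have c: "A ^\<^sub>m k \<in> carrier_mat n n" using assms by simp
  have "A ^\<^sub>m Suc k * B = A ^\<^sub>m k * (B * A)"
    using assms c by (simp add: sq_algebra[where n = n])
  also have "\<dots> = B * A ^\<^sub>m k * A"
    using assms c by (simp add: sq_algebra[where n = n] flip: Suc)
  finally show ?case using assms c by (simp add: sq_algebra[where n = n])
qed

lemma pow_mat_pow_comm:
  assumes "(A :: complex mat) \<in> carrier_mat n n"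
  shows "A ^\<^sub>m k * A ^\<^sub>m l = A ^\<^sub>m l * A ^\<^sub>m k"
  using assms by (intro pow_mat_comm[of _ n] pow_mat_comm[symmetric, of _ n]) auto

lemma pow_mat_inverse:
  assumes "(A :: complex mat) \<in> carrier_mat n n" "B \<in> carrier_mat n n" "A * B = 1\<^sub>m n"
  shows "A ^\<^sub>m k * B ^\<^sub>m k = 1\<^sub>m n"
proof (induction k)
  case 0
  show ?case using assms by simp
next
  case (Suc k)
  have c: "A ^\<^sub>m k \<in> carrier_mat n n" "B ^\<^sub>m k \<in> carrier_mat n n" using assms by auto
  have "A ^\<^sub>m Suc k * B ^\<^sub>m Suc k = A ^\<^sub>m k * A * (B * B ^\<^sub>m k)"
    using pow_mat_comm[OF assms(2,2) HOL.refl, of k] by simp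
  also have "\<dots> = A ^\<^sub>m k * ((A * B) * B ^\<^sub>m k)"
    using assms(1,2) c by (simp add: sq_algebra[where n = n] del: pow_mat.simps)
  finally show ?case using Suc c assms(3) by (simp add: sq_algebra[where n = n])
qed

text \<open>Supplies the commutation hypotheses for gradients of the form k X^(k-1) and k
  Y^(k-1).\<close>

lemma smult_pow_commute:
  fixes A :: "complex mat"
  assumes "A \<in> carrier_mat n n"
  shows "(a \<cdot>\<^sub>m A ^\<^sub>m k) * A = A * (a \<cdot>\<^sub>m A ^\<^sub>m k)"
    and "(a \<cdot>\<^sub>m A ^\<^sub>m k) * (b \<cdot>\<^sub>m A ^\<^sub>m l) = (b \<cdot>\<^sub>m A ^\<^sub>m l) * (a \<cdot>\<^sub>m A ^\<^sub>m k)"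
proof -
  have "a \<cdot>\<^sub>m (b \<cdot>\<^sub>m C) = b \<cdot>\<^sub>m (a \<cdot>\<^sub>m C)" for C :: "complex mat"
    by (auto intro!: eq_matI)
  then show "(a \<cdot>\<^sub>m A ^\<^sub>m k) * A = A * (a \<cdot>\<^sub>m A ^\<^sub>m k)"
    and "(a \<cdot>\<^sub>m A ^\<^sub>m k) * (b \<cdot>\<^sub>m A ^\<^sub>m l) = (b \<cdot>\<^sub>m A ^\<^sub>m l) * (a \<cdot>\<^sub>m A ^\<^sub>m k)"
    using assms pow_mat_comm[OF assms assms HOL.refl, of k] pow_mat_pow_comm[OF assms, of k l]
    by (simp_all add: sq_algebra(10,11)[where n = n])
qed

lemma index_mult_sq:
  assumes "A \<in> carrier_mat n n" "B \<in> carrier_mat n n" "r < n" "s < n"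
  shows "(A * B) $$ (r, s) = (\<Sum>k<n. A $$ (r, k) * B $$ (k, s))"
  using assms by (auto simp: scalar_prod_def atLeast0LessThan intro!: sum.cong)

lemma index_mult_mat3:
  assumes "(A :: complex mat) \<in> carrier_mat n n" "B \<in> carrier_mat n n" "C \<in> carrier_mat n n" "r < n" "s < n"
  shows "(A * B * C) $$ (r, s) = (\<Sum>v<n. \<Sum>u<n. (A $$ (r, u) * C $$ (v, s)) * B $$ (u, v))"
  unfolding index_mult_sq[OF sq_mult_carrier[OF assms(1,2)] assms(3-5)]
  using assms by (intro sum.cong) (auto simp: index_mult_sq[of A n B] sum_distrib_right sum_distrib_left ac_simps simp del: index_mult_mat)

lemma sq_left_commute:
  fixes A B C :: "complex mat"
  assumes "A * B = B * A" "A \<in> carrier_mat n n" "B \<in> carrier_mat n n" "C \<in> carrier_mat n n"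
  shows "A * (B * C) = B * (A * C)"
proof -
  have "A * (B * C) = (A * B) * C" using assms(2-4) by (simp add: sq_algebra[where n = n])
  also have "\<dots> = B * (A * C)" unfolding assms(1) using assms(2-4) by (simp add: sq_algebra[where n = n])
  finally show ?thesis .
qed

lemma ring_mat_inv_eq:
  assumes "A \<in> carrier_mat n n" "B \<in> carrier_mat n n" "A * B = 1\<^sub>m n"
  shows "inv\<^bsub>M n\<^esub> A = B"
proof -
  interpret ring "M n" by (rule ring_mat)
  show ?thesis
    using mat_mult_left_right_inverse[OF assms] assms
    by (intro inv_char) (auto simp: ring_mat_simps)
qed

text \<open>The theorem takes integer powers in the matrix ring, where a negative exponent means the
  ring inverse of a power. An explicit inverse \<open>B\<close> turns this into an ordinary matrix
  power, whose entries can be shown regular and differentiated.\<close>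

lemma ring_mat_int_pow:
  assumes "A \<in> carrier_mat n n" "B \<in> carrier_mat n n" "A * B = 1\<^sub>m n"
  shows "A [^]\<^bsub>M n\<^esub> (k :: int) = (if k < 0 then B ^\<^sub>m nat (- k) else A ^\<^sub>m nat k)"
proof -
  have "inv\<^bsub>M n\<^esub> (A ^\<^sub>m nat (- k)) = B ^\<^sub>m nat (- k)"
    using assms by (intro ring_mat_inv_eq pow_mat_inverse) auto
  then show ?thesis
    by (simp add: int_pow_def2 pow_mat_ring_pow[OF assms(1), symmetric])
qed

text \<open>Extension by zero at \<infinity>, whose block has size 1 and comes last: matrices on the
  cyclic part become matrices of the size in which representations take their values.\<close>

definition pad_mat :: "complex mat \<Rightarrow> complex mat" where
  "pad_mat A = four_block_mat A (0\<^sub>m (dim_row A) 1) (0\<^sub>m 1 (dim_col A)) (0\<^sub>m 1 1)"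

lemma pad_mat_carrier [simp]: "A \<in> carrier_mat n n \<Longrightarrow> pad_mat A \<in> carrier_mat (Suc n) (Suc n)"
  by (auto simp: pad_mat_def)

lemma pad_mat_index:
  assumes "A \<in> carrier_mat n n" "r < Suc n" "s < Suc n"
  shows "pad_mat A $$ (r, s) = (if r < n \<and> s < n then A $$ (r, s) else 0)"
  using assms by (auto simp: pad_mat_def)

lemma pad_mat_mult:
  assumes "A \<in> carrier_mat n n" "B \<in> carrier_mat n n"
  shows "pad_mat A * pad_mat B = pad_mat (A * B)"
  unfolding pad_mat_def using assms
  by (subst mult_four_block_mat[of _ n n _ 1 _ 1 _ _ n _ 1]) auto

lemma pad_mat_add:
  assumes "A \<in> carrier_mat n n" "B \<in> carrier_mat n n"
  shows "pad_mat A + pad_mat B = pad_mat (A + B)"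
  using assms by (intro eq_matI) (auto simp: pad_mat_def)

lemma pad_mat_minus:
  assumes "A \<in> carrier_mat n n" "B \<in> carrier_mat n n"
  shows "pad_mat A - pad_mat B = pad_mat (A - B)"
  using assms by (intro eq_matI) (auto simp: pad_mat_def)

lemma mtrace_pad_mat: "mtrace (pad_mat A) = mtrace A" if "A \<in> carrier_mat n n"
  using that by (auto simp: pad_mat_def mtrace_def)

lemma pad_mat_conj:
  assumes "A \<in> carrier_mat n n" "g \<in> carrier_mat n n" "h \<in> carrier_mat n n"
  shows "four_block_mat h (0\<^sub>m n 1) (0\<^sub>m 1 n) (1\<^sub>m 1) * pad_mat A
    * four_block_mat g (0\<^sub>m n 1) (0\<^sub>m 1 n) (1\<^sub>m 1) = pad_mat (h * A * g)"
  unfolding pad_mat_def using assms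
  by (auto simp: mult_four_block_mat[of _ n n _ 1 _ 1 _ _ n _ 1])

lemma cyc_block_pad_mat: "cyc_block \<alpha> (pad_mat A) = A" if "A \<in> carrier_mat (dim_cyc \<alpha>) (dim_cyc \<alpha>)"
  using that by (intro eq_matI) (auto simp: cyc_block_def pad_mat_def)

lemma cyc_block_carrier [simp]: "cyc_block \<alpha> A \<in> carrier_mat (dim_cyc \<alpha>) (dim_cyc \<alpha>)"
  by (simp add: cyc_block_def)

section \<open>Block diagonal matrices\<close>

lemma diag_block_mat_carrier:
  assumes "\<And>v. v \<in> set vs \<Longrightarrow> f v \<in> carrier_mat (d v) (d v)"
  shows "diag_block_mat (map f vs) \<in> carrier_mat (sum_list (map d vs)) (sum_list (map d vs))"
  using assms by (induction vs) (simp_all add: Let_def)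

lemma diag_block_mat_mult:
  assumes "\<And>v. v \<in> set vs \<Longrightarrow> f v \<in> carrier_mat (d v) (d v)"
    and "\<And>v. v \<in> set vs \<Longrightarrow> g v \<in> carrier_mat (d v) (d v)"
  shows "diag_block_mat (map f vs) * diag_block_mat (map g vs)
    = diag_block_mat (map (\<lambda>v. f v * g v) vs)"
  using assms
proof (induction vs)
  case (Cons v vs)
  let ?d = "sum_list (map d vs)"
  have F: "diag_block_mat (map f vs) \<in> carrier_mat ?d ?d"
    and G: "diag_block_mat (map g vs) \<in> carrier_mat ?d ?d"
    using Cons.prems by (auto intro!: diag_block_mat_carrier)
  have fg: "f v \<in> carrier_mat (d v) (d v)" "g v \<in> carrier_mat (d v) (d v)"
    using Cons.prems by auto
  have IH: "diag_block_mat (map f vs) * diag_block_mat (map g vs)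
    = diag_block_mat (map (\<lambda>v. f v * g v) vs)"
    using Cons by auto
  have dims: "dim_row (f v) = d v" "dim_col (f v) = d v" "dim_row (g v) = d v" "dim_col (g v) = d v"
    "dim_row (diag_block_mat (map f vs)) = ?d" "dim_col (diag_block_mat (map f vs)) = ?d"
    "dim_row (diag_block_mat (map g vs)) = ?d" "dim_col (diag_block_mat (map g vs)) = ?d"
    using F G fg by auto
  show ?case
    using F G fg
    by (simp add: Let_def dims mult_four_block_mat[of _ "d v" "d v" _ ?d _ ?d _ _ "d v" _ ?d]
        flip: IH)
qed simp

lemma diag_block_mat_one:
  "diag_block_mat (map (\<lambda>v. 1\<^sub>m (d v)) vs) = 1\<^sub>m (sum_list (map d vs))"
  by (induction vs) (auto simp: Let_def)

lemma diag_block_mat_zero: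
  "diag_block_mat (map (\<lambda>v. 0\<^sub>m (d v) (d v)) vs) = 0\<^sub>m (sum_list (map d vs)) (sum_list (map d vs))"
  by (induction vs) (auto simp: Let_def)

section \<open>Representations\<close>

lemma finite_mod_ring [simp]: "finite (A :: 'm::nontriv mod_ring set)"
proof -
  have "finite (UNIV :: 'm mod_ring set)"
    by (rule card_ge_0_finite) (use nontriv[where ?'a='m] in simp)
  then show ?thesis by (rule finite_subset[rotated]) simp
qed

lemma of_nat_mod_ring_surj: "\<exists>k < CARD('m). (i :: 'm::nontriv mod_ring) = of_nat k"
proof (intro exI conjI)
  let ?z = "to_int_mod_ring i"
  have "?z \<in> {0..<int CARD('m)}"
    unfolding range_to_int_mod_ring[symmetric] by simp
  then have z: "0 \<le> ?z" "?z < int CARD('m)" by auto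
  then show "nat ?z < CARD('m)" by linarith
  show "i = of_nat (nat ?z)"
    using z(1) by (simp add: of_nat_of_int_mod_ring)
qed

text \<open>\<open>vertices\<close> enumerates the cyclic part by natural numbers, whereas sums in
  the algebra run over the type. The map \<open>of_nat\<close> on 0, ..., m - 1 is onto, and a
  surjection between finite sets of equal cardinality is injective.\<close>

lemma sum_list_vertices:
  fixes f :: "'m::nontriv mod_ring vertex \<Rightarrow> 'a::comm_monoid_add"
  shows "sum_list (map f vertices) = (\<Sum>i\<in>UNIV. f (Cyc i)) + f Infty"
proof -
  have surj: "of_nat ` {0..<CARD('m)} = (UNIV :: 'm mod_ring set)"
    using of_nat_mod_ring_surj by (fastforce simp: image_iff)
  moreover have "inj_on (of_nat :: nat \<Rightarrow> 'm mod_ring) {0..<CARD('m)}"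
    by (rule eq_card_imp_inj_on) (simp_all add: surj)
  ultimately have "(\<Sum>k = 0..<CARD('m). f (Cyc (of_nat k))) = (\<Sum>i\<in>UNIV. f (Cyc i))"
    by (intro sum.reindex_bij_betw[of of_nat _ _ "\<lambda>i. f (Cyc i)"]) (simp add: bij_betw_def)
  then show ?thesis
    by (simp add: vertices_def o_def interv_sum_list_conv_sum_set_nat)
qed

lemma sum_list_dim_vec: "sum_list (map (dim_vec \<alpha>) vertices) = dim_tot \<alpha>"
  by (simp add: sum_list_vertices dim_cyc_def)

lemma idem_sum_cyc: "(\<Sum>i\<in>UNIV. idem (Cyc i)) = 1 - idem Infty"
  using idem_sum unfolding eq_diff_eq sum_list_vertices[symmetric]
  by (simp add: sum_list.eq_foldr foldr_map o_def)

text \<open>The shape of an element of \<open>GL \<alpha>\<close>: unlike in \<open>pad_mat\<close>,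
  the entry at \<infinity> is 1, since the group acts trivially there.\<close>

definition framed :: "nat \<Rightarrow> complex mat \<Rightarrow> complex mat" where
  "framed n A = four_block_mat A (0\<^sub>m n 1) (0\<^sub>m 1 n) (1\<^sub>m 1)"

lemma framed_carrier [simp]: "A \<in> carrier_mat n n \<Longrightarrow> framed n A \<in> carrier_mat (Suc n) (Suc n)"
  by (auto simp: framed_def)

text \<open>\<infinity> is the last vertex, so its block splits off. The conditional last conclusion
  serves the idempotent at \<infinity>, whose cyclic part vanishes.\<close>

lemma diag_block_mat_vertices:
  assumes "\<And>v. f v \<in> carrier_mat (dim_vec \<alpha> v) (dim_vec \<alpha> v)"
  obtains A where "A \<in> carrier_mat (dim_cyc \<alpha>) (dim_cyc \<alpha>)"
    "diag_block_mat (map f vertices) = four_block_mat A (0\<^sub>m (dim_cyc \<alpha>) 1) (0\<^sub>m 1 (dim_cyc \<alpha>)) (f Infty)"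
    "(\<And>i. f (Cyc i) = 0\<^sub>m (\<alpha> i) (\<alpha> i)) \<Longrightarrow> A = 0\<^sub>m (dim_cyc \<alpha>) (dim_cyc \<alpha>)"
proof -
  let ?vs = "map (\<lambda>k. Cyc (of_nat k)) [0..<CARD('a)] :: 'a mod_ring vertex list"
  let ?A = "diag_block_mat (map f ?vs)"
  have v: "vertices = ?vs @ [Infty]" by (simp add: vertices_def)
  have dims: "sum_list (map (dim_vec \<alpha>) ?vs) = dim_cyc \<alpha>"
    using sum_list_dim_vec[of \<alpha>] unfolding v by simp
  have c: "?A \<in> carrier_mat (dim_cyc \<alpha>) (dim_cyc \<alpha>)"
    using diag_block_mat_carrier[of ?vs f "dim_vec \<alpha>"] assms unfolding dims by blast
  moreover have "diag_block_mat (map f vertices)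
      = four_block_mat ?A (0\<^sub>m (dim_cyc \<alpha>) 1) (0\<^sub>m 1 (dim_cyc \<alpha>)) (f Infty)"
    unfolding v map_append list.map(1,2) diag_block_mat_last using c assms[of Infty] by auto
  moreover have "?A = 0\<^sub>m (dim_cyc \<alpha>) (dim_cyc \<alpha>)" if "\<And>i. f (Cyc i) = 0\<^sub>m (\<alpha> i) (\<alpha> i)"
  proof -
    have "map f ?vs = map (\<lambda>v. 0\<^sub>m (dim_vec \<alpha> v) (dim_vec \<alpha> v)) ?vs"
      using that by auto
    then show ?thesis by (simp only: diag_block_mat_zero dims)
  qed
  ultimately show ?thesis by (rule that)
qed

lemma block_id_Infty:
  "block_id \<alpha> Infty = four_block_mat (0\<^sub>m (dim_cyc \<alpha>) (dim_cyc \<alpha>)) (0\<^sub>m (dim_cyc \<alpha>) 1) (0\<^sub>m 1 (dim_cyc \<alpha>)) (1\<^sub>m 1)"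
proof -
  let ?f = "\<lambda>j. if j = Infty then 1\<^sub>m (dim_vec \<alpha> j) :: complex mat else 0\<^sub>m (dim_vec \<alpha> j) (dim_vec \<alpha> j)"
  obtain A where A: "diag_block_mat (map ?f vertices)
      = four_block_mat A (0\<^sub>m (dim_cyc \<alpha>) 1) (0\<^sub>m 1 (dim_cyc \<alpha>)) (?f Infty)"
    "(\<And>i. ?f (Cyc i) = 0\<^sub>m (\<alpha> i) (\<alpha> i)) \<Longrightarrow> A = 0\<^sub>m (dim_cyc \<alpha>) (dim_cyc \<alpha>)"
    by (rule diag_block_mat_vertices[of ?f \<alpha>]) auto
  from A(2) have "A = 0\<^sub>m (dim_cyc \<alpha>) (dim_cyc \<alpha>)" by simp
  then show ?thesis
    unfolding block_id_def A(1) by simp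
qed

text \<open>\<open>gl_act\<close> conjugates with an inverse taken in the full matrix ring.
  Inverting block by block gives a block diagonal \<open>h\<close>, which is therefore again in
  \<open>GL \<alpha>\<close>, and uniqueness of inverses identifies it with that ring
  inverse.\<close>

lemma GL_cases:
  assumes "g \<in> GL \<alpha>"
  obtains h g' h' where "h \<in> GL \<alpha>" "inv\<^bsub>M (dim_tot \<alpha>)\<^esub> g = h" "inv\<^bsub>M (dim_tot \<alpha>)\<^esub> h = g"
    "g' \<in> carrier_mat (dim_cyc \<alpha>) (dim_cyc \<alpha>)" "h' \<in> carrier_mat (dim_cyc \<alpha>) (dim_cyc \<alpha>)"
    "g' * h' = 1\<^sub>m (dim_cyc \<alpha>)" "h' * g' = 1\<^sub>m (dim_cyc \<alpha>)"
    "g = framed (dim_cyc \<alpha>) g'" "h = framed (dim_cyc \<alpha>) h'"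
    "g * h = 1\<^sub>m (dim_tot \<alpha>)" "h * g = 1\<^sub>m (dim_tot \<alpha>)"
    "\<And>v. h * block_id \<alpha> v * g = block_id \<alpha> v"
proof -
  let ?n = "dim_cyc \<alpha>"
  obtain G where G: "g = diag_block_mat (map (case_vertex G (1\<^sub>m 1)) vertices)"
    "\<And>i. G i \<in> Units (M (\<alpha> i))"
    using assms by (auto simp: GL_def)
  define H where "H i = inv\<^bsub>M (\<alpha> i)\<^esub> (G i)" for i
  have GH: "G i \<in> carrier_mat (\<alpha> i) (\<alpha> i)" "H i \<in> Units (M (\<alpha> i))" "H i \<in> carrier_mat (\<alpha> i) (\<alpha> i)"
    "G i * H i = 1\<^sub>m (\<alpha> i)" "H i * G i = 1\<^sub>m (\<alpha> i)" for i
  proof -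
    interpret ring "M (\<alpha> i)" by (rule ring_mat)
    show "G i \<in> carrier_mat (\<alpha> i) (\<alpha> i)" "H i \<in> Units (M (\<alpha> i))" "H i \<in> carrier_mat (\<alpha> i) (\<alpha> i)"
      "G i * H i = 1\<^sub>m (\<alpha> i)" "H i * G i = 1\<^sub>m (\<alpha> i)"
      using Units_closed[OF G(2)] Units_inv_Units[OF G(2)] Units_inv_closed[OF G(2)]
        Units_r_inv[OF G(2)] Units_l_inv[OF G(2)]
      by (auto simp: H_def ring_mat_simps)
  qed
  let ?G = "case_vertex G (1\<^sub>m 1)" and ?H = "case_vertex H (1\<^sub>m 1)"
  have c: "?G v \<in> carrier_mat (dim_vec \<alpha> v) (dim_vec \<alpha> v)" "?H v \<in> carrier_mat (dim_vec \<alpha> v) (dim_vec \<alpha> v)"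
    "?G v * ?H v = 1\<^sub>m (dim_vec \<alpha> v)" "?H v * ?G v = 1\<^sub>m (dim_vec \<alpha> v)" for v
    by (cases v; simp add: GH)+
  define h where "h = diag_block_mat (map ?H vertices)"
  have h: "h \<in> GL \<alpha>" unfolding GL_def h_def using GH(2) by blast
  obtain g' where g': "g' \<in> carrier_mat ?n ?n" "g = framed ?n g'"
    by (rule diag_block_mat_vertices[of ?G \<alpha>]) (auto simp: c G(1) framed_def)
  obtain h' where h': "h' \<in> carrier_mat ?n ?n" "h = framed ?n h'"
    by (rule diag_block_mat_vertices[of ?H \<alpha>]) (auto simp: c h_def framed_def)
  have one: "diag_block_mat (map (\<lambda>v. 1\<^sub>m (dim_vec \<alpha> v)) vertices) = 1\<^sub>m (dim_tot \<alpha>)"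
    by (simp only: diag_block_mat_one sum_list_dim_vec)
  have gh: "g * h = 1\<^sub>m (dim_tot \<alpha>)"
    unfolding G(1) h_def by (subst diag_block_mat_mult[where d = "dim_vec \<alpha>"]) (auto simp: c one)
  have hg: "h * g = 1\<^sub>m (dim_tot \<alpha>)"
    unfolding G(1) h_def by (subst diag_block_mat_mult[where d = "dim_vec \<alpha>"]) (auto simp: c one)
  have cgh: "g \<in> carrier_mat (dim_tot \<alpha>) (dim_tot \<alpha>)" "h \<in> carrier_mat (dim_tot \<alpha>) (dim_tot \<alpha>)"
    using g' h' by simp_all
  have block: "A * B = 1\<^sub>m ?n"
    if "framed ?n A * framed ?n B = 1\<^sub>m (dim_tot \<alpha>)" "A \<in> carrier_mat ?n ?n" "B \<in> carrier_mat ?n ?n" for A B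
  proof (rule eq_matI)
    fix i j assume ij: "i < dim_row (1\<^sub>m ?n :: complex mat)" "j < dim_col (1\<^sub>m ?n :: complex mat)"
    have "framed ?n A * framed ?n B = framed ?n (A * B)"
      unfolding framed_def using that(2,3)
      by (subst mult_four_block_mat[of _ ?n ?n _ 1 _ 1 _ _ ?n _ 1]) auto
    with that(1) have "framed ?n (A * B) $$ (i, j) = 1\<^sub>m (dim_tot \<alpha>) $$ (i, j)" by simp
    then show "(A * B) $$ (i, j) = 1\<^sub>m ?n $$ (i, j)"
      using ij that(2,3) by (simp add: framed_def)
  qed (use that in auto)
  \<comment> \<open>The block at \<open>v\<close> becomes a product of mutually inverse blocks, and
    all others stay zero. This lets conjugation preserve the exact values that \<open>Rep\<close>
    prescribes on idempotents.\<close>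
  have conj: "h * block_id \<alpha> v * g = block_id \<alpha> v" for v
  proof -
    let ?B = "\<lambda>j. if j = v then 1\<^sub>m (dim_vec \<alpha> j) :: complex mat else 0\<^sub>m (dim_vec \<alpha> j) (dim_vec \<alpha> j)"
    have B: "?B j \<in> carrier_mat (dim_vec \<alpha> j) (dim_vec \<alpha> j)" for j by simp
    have "h * block_id \<alpha> v = diag_block_mat (map (\<lambda>j. ?H j * ?B j) vertices)"
      unfolding h_def block_id_def using c(2) B by (rule diag_block_mat_mult)
    then have "h * block_id \<alpha> v * g = diag_block_mat (map (\<lambda>j. ?H j * ?B j) vertices)
        * diag_block_mat (map ?G vertices)"
      by (simp only: G(1))
    also have "\<dots> = diag_block_mat (map (\<lambda>j. ?H j * ?B j * ?G j) vertices)"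
      using sq_mult_carrier[OF c(2) B] c(1) by (rule diag_block_mat_mult)
    also have "(\<lambda>j. ?H j * ?B j * ?G j) = ?B"
    proof
      fix j
      have "?H j * ?B j * ?G j = (if j = v then ?H j * ?G j else 0\<^sub>m (dim_vec \<alpha> j) (dim_vec \<alpha> j))"
        using c(1,2)[of j] by auto
      then show "?H j * ?B j * ?G j = ?B j" using c(4) by simp
    qed
    finally show ?thesis by (simp add: block_id_def)
  qed
  have "inv\<^bsub>M (dim_tot \<alpha>)\<^esub> g = h" "inv\<^bsub>M (dim_tot \<alpha>)\<^esub> h = g"
    using ring_mat_inv_eq cgh gh hg by blast+
  then show ?thesis
    using that[OF h _ _ g'(1) h'(1) block block g'(2) h'(2) gh hg conj] gh hg g' h' by simp
qed

section \<open>Vertex idempotents and the part of the algebra away from infinity\<close>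

lemma idem_arr: "idem v * arr a = (if v = tail a then arr a else 0)"
proof -
  have "idem v * arr a = idem v * idem (tail a) * arr a"
    by (simp add: mult.assoc tail_arr)
  then show ?thesis by (simp add: idem_orth idem_idem tail_arr)
qed

lemma arr_idem: "arr a * idem v = (if v = head a then arr a else 0)"
proof -
  have "arr a * idem v = arr a * (idem (head a) * idem v)"
    by (simp add: arr_head flip: mult.assoc)
  then show ?thesis by (simp add: idem_orth idem_idem arr_head)
qed

lemma head_arrow [simp]: "head (Ax i) = Cyc (i + 1)" "head (Ay i) = Cyc i"
  "head Av = Infty" "head Aw = Cyc 0"
  by (simp_all add: head_def)

text \<open>The arrow \<open>Ax i\<close> is both the part of x leaving \<open>i\<close> and the
  part entering \<open>i + 1\<close>; similarly for y. Comparing the two descriptions yields the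
  rules for moving an idempotent past x or y, with the index shifted by 1 or -1.\<close>

lemma idem_x_elem: "idem (Cyc i) * x_elem = arr (Ax i)"
  by (simp add: x_elem_def sum_distrib_left idem_arr if_distrib[of arr] sum.delta cong: if_cong)

lemma x_elem_idem: "x_elem * idem (Cyc (i + 1)) = arr (Ax i)"
  by (simp add: x_elem_def sum_distrib_right arr_idem)

lemma y_elem_idem: "y_elem * idem (Cyc i) = arr (Ay i)"
  by (simp add: y_elem_def sum_distrib_right arr_idem)

lemma idem_y_elem: "idem (Cyc (i + 1)) * y_elem = arr (Ay i)"
  by (simp add: y_elem_def sum_distrib_left idem_arr)

text \<open>The corner algebra of elements with no component starting or ending at
  \<infinity>.\<close>

definition cyc_elem :: "'m::nontriv dpa \<Rightarrow> bool" where
  "cyc_elem a \<longleftrightarrow> idem Infty * a = 0 \<and> a * idem Infty = 0"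

lemma cyc_elem_mult [simp]: "cyc_elem a \<Longrightarrow> cyc_elem b \<Longrightarrow> cyc_elem (a * b)"
  by (simp add: cyc_elem_def mult.assoc) (simp flip: mult.assoc)

lemma cyc_elem_add [simp]: "cyc_elem a \<Longrightarrow> cyc_elem b \<Longrightarrow> cyc_elem (a + b)"
  by (simp add: cyc_elem_def algebra_simps)

lemma cyc_elem_sum [simp]: "(\<And>i. i \<in> A \<Longrightarrow> cyc_elem (f i)) \<Longrightarrow> cyc_elem (sum f A)"
  by (simp add: cyc_elem_def sum_distrib_left sum_distrib_right)

lemma cyc_elem_idem [simp]: "cyc_elem (idem (Cyc i))"
  by (simp add: cyc_elem_def idem_orth)

lemma cyc_elem_arr [simp]: "cyc_elem (arr (Ax i))" "cyc_elem (arr (Ay i))"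
  by (simp_all add: cyc_elem_def idem_arr arr_idem)

lemma cyc_elem_xy [simp]: "cyc_elem x_elem" "cyc_elem y_elem"
  by (simp_all add: x_elem_def y_elem_def)

locale representation =
  fixes \<alpha> :: "'m::nontriv mod_ring \<Rightarrow> nat" and \<rho> :: "'m rep"
  assumes in_Rep: "\<rho> \<in> Rep \<alpha>"
begin

abbreviation n :: nat where "n \<equiv> dim_cyc \<alpha>"

lemma carrier [simp]: "\<rho> a \<in> carrier_mat (Suc n) (Suc n)"
  using in_Rep by (simp add: Rep_def)

lemma dim [simp]: "dim_row (\<rho> a) = Suc n" "dim_col (\<rho> a) = Suc n"
  using carrier[of a] by (auto simp del: carrier)

lemma add: "\<rho> (a + b) = \<rho> a + \<rho> b"
  using in_Rep by (simp add: Rep_def)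

lemma mult: "\<rho> (a * b) = \<rho> a * \<rho> b"
  using in_Rep by (simp add: Rep_def)

lemma scal: "\<rho> (scal z) = z \<cdot>\<^sub>m 1\<^sub>m (Suc n)"
  using in_Rep by (simp add: Rep_def)

lemma idem: "\<rho> (idem v) = block_id \<alpha> v"
  using in_Rep by (simp add: Rep_def)

lemma one: "\<rho> 1 = 1\<^sub>m (Suc n)"
  using scal[of 1] by (auto intro: eq_matI)

lemma zero: "\<rho> 0 = 0\<^sub>m (Suc n) (Suc n)"
  using scal[of 0] by (auto intro: eq_matI)

lemma scal_times: "\<rho> (scal z * a) = z \<cdot>\<^sub>m \<rho> a"
  by (simp add: mult scal sq_algebra[where n = "Suc n"])

definition cb :: "'m dpa \<Rightarrow> complex mat" where
  "cb a = cyc_block \<alpha> (\<rho> a)"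

lemma cb_carrier [simp]: "cb a \<in> carrier_mat n n"
  by (simp add: cb_def)

lemma cb_add: "cb (a + b) = cb a + cb b"
  by (intro eq_matI) (auto simp: cb_def cyc_block_def add)

lemma cb_zero: "cb 0 = 0\<^sub>m n n"
  by (intro eq_matI) (auto simp: cb_def cyc_block_def zero)

lemma cb_one: "cb 1 = 1\<^sub>m n"
  by (intro eq_matI) (auto simp: cb_def cyc_block_def one)

lemma cb_idem_Infty: "cb (Defs.idem Infty) = 0\<^sub>m n n"
  by (intro eq_matI) (auto simp: cb_def cyc_block_def idem block_id_Infty)

text \<open>The idempotent at \<infinity> is represented by the last diagonal matrix unit, so
  multiplying by it isolates the last row or column of \<open>\<rho> a\<close>; both products
  vanish.\<close>

lemma rho_cyc_elem:
  assumes "cyc_elem a"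
  shows "\<rho> a = pad_mat (cb a)"
proof (rule eq_matI)
  let ?e = "block_id \<alpha> Infty"
  have e: "?e = mat (Suc n) (Suc n) (\<lambda>(r, s). if r = n \<and> s = n then 1 else 0)"
    unfolding block_id_Infty by (intro eq_matI) auto
  have "?e * \<rho> a = 0\<^sub>m (Suc n) (Suc n)" "\<rho> a * ?e = 0\<^sub>m (Suc n) (Suc n)"
    using assms by (auto simp: cyc_elem_def zero simp flip: mult idem)
  moreover have "(?e * \<rho> a) $$ (n, s) = \<rho> a $$ (n, s)" "(\<rho> a * ?e) $$ (s, n) = \<rho> a $$ (s, n)"
    if "s < Suc n" for s
    using that carrier[of a] unfolding e
    by (auto simp: scalar_prod_def if_distrib[of "\<lambda>x. x * _"] if_distrib[of "(*) _"] cong: if_cong)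
  ultimately have last: "\<rho> a $$ (n, s) = 0" "\<rho> a $$ (s, n) = 0" if "s < Suc n" for s
    using that by (metis index_zero_mat(1) lessI)+
  fix r s assume "r < dim_row (pad_mat (cb a))" "s < dim_col (pad_mat (cb a))"
  then have rs: "r < Suc n" "s < Suc n"
    using pad_mat_carrier[OF cb_carrier, of a] by auto
  show "\<rho> a $$ (r, s) = pad_mat (cb a) $$ (r, s)"
  proof (cases "r < n \<and> s < n")
    case True
    then show ?thesis
      using rs by (simp add: pad_mat_index[OF cb_carrier]) (simp add: cb_def cyc_block_def)
  next
    case False
    then have "r = n \<or> s = n" using rs by auto
    then show ?thesis
      using rs last[of r] last[of s] by (auto simp: pad_mat_index[OF cb_carrier])
  qed
qed (simp_all add: carrier_matD[OF pad_mat_carrier[OF cb_carrier]])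

text \<open>A general product also has contributions passing through \<infinity>. The padded form
  excludes them, so taking the cyclic block is multiplicative on the corner algebra.\<close>

lemma cb_mult:
  assumes "cyc_elem a" "cyc_elem b"
  shows "cb (a * b) = cb a * cb b"
  using cyc_block_pad_mat[of "cb a * cb b" \<alpha>] assms
  by (simp add: cb_def[of "a * b"] mult rho_cyc_elem pad_mat_mult[of _ n])

text \<open>The cyclic idempotents sum to the complement of the idempotent at \<infinity>, whose
  cyclic block is the identity. Sums over vertices collapse to a single trace in this way.\<close>

lemma mtrace_decomp:
  assumes "A \<in> carrier_mat n n"
  shows "(\<Sum>i\<in>UNIV. mtrace (A * cb (Defs.idem (Cyc i)))) = mtrace A"
proof -
  have add: "mtrace (A * cb (a + b)) = mtrace (A * cb a) + mtrace (A * cb b)" for a b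
    using assms by (simp add: cb_add sq_algebra[where n = n] mtrace_add[of _ n])
  have "(\<Sum>i\<in>S. mtrace (A * cb (f i))) = mtrace (A * cb (sum f S))" for f and S :: "'m mod_ring set"
    using assms by (induction S rule: infinite_finite_induct) (simp_all add: add cb_zero)
  then have "(\<Sum>i\<in>UNIV. mtrace (A * cb (Defs.idem (Cyc i)))) = mtrace (A * cb (1 - Defs.idem Infty))"
    by (simp add: idem_sum_cyc)
  \<comment> \<open>The added trace is zero; it completes the argument of \<open>cb\<close> to
    1.\<close>
  also have "\<dots> = mtrace (A * cb (1 - Defs.idem Infty)) + mtrace (A * cb (Defs.idem Infty))"
    using assms by (simp add: cb_idem_Infty)
  also have "\<dots> = mtrace A"
    using assms by (simp add: cb_one flip: add)
  finally show ?thesis .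
qed

end

section \<open>Conjugation of representations by the group\<close>

definition gl_conj :: "('m::nontriv mod_ring \<Rightarrow> nat) \<Rightarrow> complex mat \<Rightarrow> 'm rep \<Rightarrow> 'm rep" where
  "gl_conj \<alpha> g \<rho> = (\<lambda>a. inv\<^bsub>M (dim_tot \<alpha>)\<^esub> g * \<rho> a * g)"

lemma gl_conj_Rep:
  assumes "g \<in> GL \<alpha>" "\<rho> \<in> Rep \<alpha>"
  shows "gl_conj \<alpha> g \<rho> \<in> Rep \<alpha>"
proof -
  interpret representation \<alpha> \<rho> by unfold_locales fact
  obtain h g' h' where h: "inv\<^bsub>M (dim_tot \<alpha>)\<^esub> g = h" "g' \<in> carrier_mat n n" "h' \<in> carrier_mat n n"
    "g = framed n g'" "h = framed n h'" "g * h = 1\<^sub>m (Suc n)" "h * g = 1\<^sub>m (Suc n)"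
    "\<And>v. h * block_id \<alpha> v * g = block_id \<alpha> v"
    using GL_cases[OF assms(1)] by metis
  have c: "g \<in> carrier_mat (Suc n) (Suc n)" "h \<in> carrier_mat (Suc n) (Suc n)"
    using h by simp_all
  have "h * \<rho> (a + b) * g = h * \<rho> a * g + h * \<rho> b * g" for a b
    using c by (simp add: add sq_algebra[where n = "Suc n"])
  moreover have "h * \<rho> (a * b) * g = (h * \<rho> a * g) * (h * \<rho> b * g)" for a b
    unfolding mult using c h(6) by (intro conj_mult_mat[symmetric]) simp_all
  moreover have "h * \<rho> (scal z) * g = z \<cdot>\<^sub>m 1\<^sub>m (Suc n)" for z
    using c h(7) by (simp add: scal sq_algebra[where n = "Suc n"])
  ultimately show ?thesis
    using c h(8) by (simp add: Rep_def gl_conj_def h(1) idem)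
qed

text \<open>The pair \<open>g'\<close>, \<open>h'\<close> is found from \<open>g\<close> alone and
  serves all points and all elements of the corner algebra at once; equivariance of matrix functions
  is later stated through such pairs.\<close>

lemma cyc_block_gl_conj:
  assumes "g \<in> GL \<alpha>"
  obtains g' h' where "g' \<in> carrier_mat (dim_cyc \<alpha>) (dim_cyc \<alpha>)" "h' \<in> carrier_mat (dim_cyc \<alpha>) (dim_cyc \<alpha>)"
    "g' * h' = 1\<^sub>m (dim_cyc \<alpha>)" "h' * g' = 1\<^sub>m (dim_cyc \<alpha>)"
    "\<And>\<rho> a. \<rho> \<in> Rep \<alpha> \<Longrightarrow> cyc_elem a \<Longrightarrow>
      cyc_block \<alpha> (gl_conj \<alpha> g \<rho> a) = h' * cyc_block \<alpha> (\<rho> a) * g'"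
proof -
  let ?n = "dim_cyc \<alpha>"
  obtain h g' h' where h: "inv\<^bsub>M (dim_tot \<alpha>)\<^esub> g = h" "g' \<in> carrier_mat ?n ?n" "h' \<in> carrier_mat ?n ?n"
    "g = framed ?n g'" "h = framed ?n h'" "g' * h' = 1\<^sub>m ?n" "h' * g' = 1\<^sub>m ?n"
    using GL_cases[OF assms(1)] by metis
  have "cyc_block \<alpha> (gl_conj \<alpha> g \<rho> a) = h' * cyc_block \<alpha> (\<rho> a) * g'"
    if "\<rho> \<in> Rep \<alpha>" "cyc_elem a" for \<rho> a
  proof -
    interpret representation \<alpha> \<rho> by unfold_locales fact
    have "gl_conj \<alpha> g \<rho> a = pad_mat (h' * cb a * g')"
      unfolding gl_conj_def h(1) unfolding h(4,5) rho_cyc_elem[OF that(2)] framed_def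
      using h(2,3) by (intro pad_mat_conj) simp_all
    then show ?thesis
      using h(2,3) by (simp add: cyc_block_pad_mat flip: cb_def)
  qed
  then show ?thesis using that h by blast
qed

section \<open>Algebras of functions\<close>

text \<open>Functions are extensional, with value \<open>undefined\<close> outside \<open>U\<close>.
  An arbitrary \<open>U\<close> covers both the whole representation space and the open subset where
  X is invertible.\<close>

locale fun_algebra =
  fixes U :: "'p set" and \<O> :: "('p \<Rightarrow> complex) set"
  assumes restrict: "F \<in> \<O> \<Longrightarrow> restrict F U = F"
    and const: "(\<lambda>\<rho>\<in>U. z) \<in> \<O>"
    and add: "F \<in> \<O> \<Longrightarrow> G \<in> \<O> \<Longrightarrow> (\<lambda>\<rho>\<in>U. F \<rho> + G \<rho>) \<in> \<O>"
    and mult: "F \<in> \<O> \<Longrightarrow> G \<in> \<O> \<Longrightarrow> (\<lambda>\<rho>\<in>U. F \<rho> * G \<rho>) \<in> \<O>"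
begin

abbreviation R :: "('p \<Rightarrow> complex) ring" where "R \<equiv> fun_ring U \<O>"

lemma outside: "F \<in> \<O> \<Longrightarrow> \<rho> \<notin> U \<Longrightarrow> F \<rho> = undefined"
  by (metis restrict restrict_apply)

text \<open>Restriction to \<open>U\<close> is built in, so that the closure rules apply to plain
  lambda terms.\<close>

definition regular :: "('p \<Rightarrow> complex) \<Rightarrow> bool" where
  "regular f \<longleftrightarrow> restrict f U \<in> \<O>"

lemma regular_const [simp]: "regular (\<lambda>_. z)"
  by (simp add: regular_def const)

lemma regular_cong: "(\<And>\<rho>. \<rho> \<in> U \<Longrightarrow> f \<rho> = g \<rho>) \<Longrightarrow> regular g \<Longrightarrow> regular f"
  unfolding regular_def by (metis (mono_tags, lifting) restrict_ext)

lemma regular_add: "regular f \<Longrightarrow> regular g \<Longrightarrow> regular (\<lambda>\<rho>. f \<rho> + g \<rho>)"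
  unfolding regular_def by (drule (1) add) (simp cong: restrict_cong)

lemma regular_mult: "regular f \<Longrightarrow> regular g \<Longrightarrow> regular (\<lambda>\<rho>. f \<rho> * g \<rho>)"
  unfolding regular_def by (drule (1) mult) (simp cong: restrict_cong)

lemma regular_sum: "(\<And>i. i \<in> A \<Longrightarrow> regular (f i)) \<Longrightarrow> regular (\<lambda>\<rho>. \<Sum>i\<in>A. f i \<rho>)"
  by (induction A rule: infinite_finite_induct) (simp_all add: regular_add)

lemma regular_prod: "(\<And>i. i \<in> A \<Longrightarrow> regular (f i)) \<Longrightarrow> regular (\<lambda>\<rho>. \<Prod>i\<in>A. f i \<rho>)"
  by (induction A rule: infinite_finite_induct) (simp_all add: regular_mult)

lemma cring: "cring R"
proof (rule cringI)
  show "abelian_group R"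
  proof (rule abelian_groupI)
    fix F assume "F \<in> carrier R"
    then have F: "F \<in> \<O>" by (simp add: fun_ring_def)
    \<comment> \<open>The additive inverse is the product with the constant function -1.\<close>
    have "(\<lambda>\<rho>\<in>U. (\<lambda>\<rho>\<in>U. - 1) \<rho> * F \<rho>) \<in> \<O>" by (rule mult[OF const F])
    then show "\<exists>G\<in>carrier R. G \<oplus>\<^bsub>R\<^esub> F = \<zero>\<^bsub>R\<^esub>"
      by (intro bexI) (auto simp: fun_ring_def)
    show "\<zero>\<^bsub>R\<^esub> \<oplus>\<^bsub>R\<^esub> F = F"
      using outside[OF F] by (auto simp: fun_ring_def restrict_def fun_eq_iff)
  qed (auto simp: fun_ring_def add const ac_simps intro!: restrict_ext)
  show "comm_monoid R"
  proof (rule comm_monoidI)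
    fix F assume "F \<in> carrier R"
    then show "\<one>\<^bsub>R\<^esub> \<otimes>\<^bsub>R\<^esub> F = F"
      using outside[of F] by (auto simp: fun_ring_def restrict_def fun_eq_iff)
  qed (auto simp: fun_ring_def mult const ac_simps intro!: restrict_ext)
qed (auto simp: fun_ring_def algebra_simps intro!: restrict_ext)

section \<open>Matrix functions with regular entries\<close>

definition regular_mat :: "nat \<Rightarrow> ('p \<Rightarrow> complex mat) \<Rightarrow> bool" where
  "regular_mat n T \<longleftrightarrow> (\<forall>\<rho>\<in>U. T \<rho> \<in> carrier_mat n n) \<and> (\<forall>i<n. \<forall>j<n. regular (\<lambda>\<rho>. T \<rho> $$ (i, j)))"

lemma regular_matD:
  assumes "regular_mat n T"
  shows "\<rho> \<in> U \<Longrightarrow> T \<rho> \<in> carrier_mat n n" "i < n \<Longrightarrow> j < n \<Longrightarrow> regular (\<lambda>\<rho>. T \<rho> $$ (i, j))"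
  using assms by (auto simp: regular_mat_def)

lemma regular_mat_cong: "(\<And>\<rho>. \<rho> \<in> U \<Longrightarrow> S \<rho> = T \<rho>) \<Longrightarrow> regular_mat n T \<Longrightarrow> regular_mat n S"
  unfolding regular_mat_def by (auto intro: regular_cong)

lemma regular_mat_const: "A \<in> carrier_mat n n \<Longrightarrow> regular_mat n (\<lambda>_. A)"
  by (simp add: regular_mat_def)

lemma regular_mat_mult:
  assumes "regular_mat n S" "regular_mat n T"
  shows "regular_mat n (\<lambda>\<rho>. S \<rho> * T \<rho>)"
  unfolding regular_mat_def
proof (intro conjI allI impI ballI)
  fix i j assume ij: "i < n" "j < n"
  have "regular (\<lambda>\<rho>. \<Sum>k<n. S \<rho> $$ (i, k) * T \<rho> $$ (k, j))"
    using ij assms by (intro regular_sum regular_mult) (auto simp: regular_mat_def)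
  then show "regular (\<lambda>\<rho>. (S \<rho> * T \<rho>) $$ (i, j))"
    using ij assms[THEN regular_matD(1)]
    by (elim regular_cong[rotated])
       (auto simp: scalar_prod_def atLeast0LessThan carrier_matD[of _ n n] intro!: sum.cong)
qed (use assms in \<open>auto simp: regular_mat_def\<close>)

lemma regular_mat_add:
  assumes "regular_mat n S" "regular_mat n T"
  shows "regular_mat n (\<lambda>\<rho>. S \<rho> + T \<rho>)"
  unfolding regular_mat_def
proof (intro conjI allI impI ballI)
  fix i j assume ij: "i < n" "j < n"
  have "regular (\<lambda>\<rho>. S \<rho> $$ (i, j) + T \<rho> $$ (i, j))"
    using ij assms by (intro regular_add) (auto simp: regular_mat_def)
  then show "regular (\<lambda>\<rho>. (S \<rho> + T \<rho>) $$ (i, j))"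
    using ij assms[THEN regular_matD(1)]
    by (elim regular_cong[rotated]) (auto simp: carrier_matD[of _ n n])
qed (use assms in \<open>auto simp: regular_mat_def\<close>)

lemma regular_mat_smult:
  assumes "regular f" "regular_mat n T"
  shows "regular_mat n (\<lambda>\<rho>. f \<rho> \<cdot>\<^sub>m T \<rho>)"
  unfolding regular_mat_def
proof (intro conjI allI impI ballI)
  fix i j assume ij: "i < n" "j < n"
  have "regular (\<lambda>\<rho>. f \<rho> * T \<rho> $$ (i, j))"
    using ij assms by (intro regular_mult) (auto simp: regular_mat_def)
  then show "regular (\<lambda>\<rho>. (f \<rho> \<cdot>\<^sub>m T \<rho>) $$ (i, j))"
    using ij assms(2)[THEN regular_matD(1)]
    by (elim regular_cong[rotated]) (auto simp: carrier_matD[of _ n n])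
qed (use assms in \<open>auto simp: regular_mat_def\<close>)

lemma regular_mat_pow: "regular_mat n T \<Longrightarrow> regular_mat n (\<lambda>\<rho>. T \<rho> ^\<^sub>m k)"
proof (induction k)
  case 0
  have "regular_mat n (\<lambda>_. 1\<^sub>m n)" by (simp add: regular_mat_const)
  with 0 show ?case
    by (elim regular_mat_cong[rotated]) (auto simp: regular_mat_def)
qed (simp add: regular_mat_mult)

lemma regular_mtrace:
  assumes "regular_mat n T"
  shows "regular (\<lambda>\<rho>. mtrace (T \<rho>))"
proof -
  have "regular (\<lambda>\<rho>. \<Sum>k<n. T \<rho> $$ (k, k))"
    using assms by (intro regular_sum) (auto simp: regular_mat_def)
  then show ?thesis
    using assms[THEN regular_matD(1)]
    by (elim regular_cong[rotated]) (auto simp: mtrace_def carrier_matD[of _ n n])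
qed

lemma regular_det:
  assumes "regular_mat n T"
  shows "regular (\<lambda>\<rho>. det (T \<rho>))"
proof -
  have "regular (\<lambda>\<rho>. \<Sum>p\<in>{p. p permutes {0..<n}}. signof p * (\<Prod>i = 0..<n. T \<rho> $$ (i, p i)))"
    using assms
    by (intro regular_sum regular_mult regular_prod) (auto simp: regular_mat_def permutes_in_image)
  then show ?thesis
    using assms[THEN regular_matD(1)]
    by (elim regular_cong[rotated]) (auto simp: det_def carrier_matD[of _ n n])
qed

text \<open>Each entry is, up to sign, the determinant of a minor, and determinants are regular by
  the Leibniz formula.\<close>

lemma regular_mat_adj:
  assumes "regular_mat n T"
  shows "regular_mat n (\<lambda>\<rho>. adj_mat (T \<rho>))"
  unfolding regular_mat_def
proof (intro conjI allI impI ballI)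
  fix i j assume ij: "i < n" "j < n"
  have d: "regular_mat (n - 1) (\<lambda>\<rho>. mat_delete (T \<rho>) j i)"
    unfolding regular_mat_def
  proof (intro conjI allI impI ballI)
    fix r s assume rs: "r < n - 1" "s < n - 1"
    have "regular (\<lambda>\<rho>. T \<rho> $$ (if r < j then r else Suc r, if s < i then s else Suc s))"
      using rs assms by (auto simp: regular_mat_def)
    then show "regular (\<lambda>\<rho>. mat_delete (T \<rho>) j i $$ (r, s))"
      using rs assms[THEN regular_matD(1)]
      by (elim regular_cong[rotated]) (auto simp: mat_delete_def carrier_matD[of _ n n])
  qed (use assms ij in \<open>auto simp: regular_mat_def mat_delete_def\<close>)
  have "regular (\<lambda>\<rho>. (- 1) ^ (j + i) * det (mat_delete (T \<rho>) j i))"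
    by (intro regular_mult regular_det[OF d]) simp
  then show "regular (\<lambda>\<rho>. adj_mat (T \<rho>) $$ (i, j))"
    using ij assms[THEN regular_matD(1)]
    by (elim regular_cong[rotated]) (auto simp: adj_mat_def cofactor_def carrier_matD[of _ n n])
qed (use assms adj_mat(1) in \<open>auto simp: regular_mat_def\<close>)

end

section \<open>Functions on representation spaces and on their quotients\<close>

text \<open>The group acts on \<open>U\<close> and, by pullback, on its ring of functions.
  \<open>Rep \<alpha>\<close> and \<open>Rep0 \<alpha>\<close> are both instances, so the passage to
  the quotient is treated once for the two brackets.\<close>

locale rep_space = fun_algebra U \<O>
  for U :: "'m::nontriv rep set" and \<O> +
  fixes \<alpha> :: "'m mod_ring \<Rightarrow> nat"
  assumes U_Rep: "U \<subseteq> Rep \<alpha>"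
    and entry: "r < dim_tot \<alpha> \<Longrightarrow> s < dim_tot \<alpha> \<Longrightarrow> (\<lambda>\<rho>\<in>U. \<rho> a $$ (r, s)) \<in> \<O>"
    and gl_conj_U: "g \<in> GL \<alpha> \<Longrightarrow> \<rho> \<in> U \<Longrightarrow> gl_conj \<alpha> g \<rho> \<in> U"
    and gl_act_closed: "g \<in> GL \<alpha> \<Longrightarrow> F \<in> \<O> \<Longrightarrow> gl_act \<alpha> U g F \<in> \<O>"
begin

abbreviation I :: "('m mod_ring \<Rightarrow> complex) \<Rightarrow> ('m rep \<Rightarrow> complex) set" where
  "I q \<equiv> rep_ideal \<alpha> q U R"

lemma regular_cyc_block: "regular_mat (dim_cyc \<alpha>) (\<lambda>\<rho>. cyc_block \<alpha> (\<rho> a))"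
  unfolding regular_mat_def by (auto simp: cyc_block_def regular_def entry)

lemma gl_act_app: "\<rho> \<in> U \<Longrightarrow> gl_act \<alpha> U g F \<rho> = F (gl_conj \<alpha> g \<rho>)"
  by (simp add: gl_act_def gl_conj_def)

lemma gl_act_hom:
  assumes "g \<in> GL \<alpha>"
  shows "gl_act \<alpha> U g (F \<oplus>\<^bsub>R\<^esub> G) = gl_act \<alpha> U g F \<oplus>\<^bsub>R\<^esub> gl_act \<alpha> U g G"
    and "gl_act \<alpha> U g (F \<otimes>\<^bsub>R\<^esub> G) = gl_act \<alpha> U g F \<otimes>\<^bsub>R\<^esub> gl_act \<alpha> U g G"
    and "gl_act \<alpha> U g \<zero>\<^bsub>R\<^esub> = \<zero>\<^bsub>R\<^esub>"
  using gl_conj_U[OF assms] by (auto simp: fun_ring_def gl_act_def gl_conj_def intro!: restrict_ext)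

lemma rep_ideal_is_ideal: "ideal (I q) R"
proof -
  interpret cring R by (rule cring)
  show ?thesis
    unfolding rep_ideal_def by (rule genideal_ideal) (auto simp: fun_ring_def entry)
qed

text \<open>The functions that \<open>g\<close> carries into the ideal form an ideal themselves. It
  contains the generators, because an entry of the conjugate of \<open>\<rho> a\<close> is a
  combination, with constant coefficients, of entries of \<open>\<rho> a\<close> for the same
  \<open>a\<close>.\<close>

lemma gl_act_ideal:
  assumes g: "g \<in> GL \<alpha>" and F: "F \<in> I q"
  shows "gl_act \<alpha> U g F \<in> I q"
proof -
  interpret cring R by (rule cring)
  interpret J: ideal "I q" R by (rule rep_ideal_is_ideal)
  let ?\<phi> = "gl_act \<alpha> U g"
  let ?J = "{F \<in> carrier R. ?\<phi> F \<in> I q}"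
  let ?S = "{(\<lambda>\<rho>\<in>U. \<rho> a $$ (r, s)) | a r s. a \<in> preproj_ideal \<alpha> q \<and> r < dim_tot \<alpha> \<and> s < dim_tot \<alpha>}"
  have closed: "?\<phi> F \<in> carrier R" if "F \<in> carrier R" for F
    using that gl_act_closed[OF g] by (simp add: fun_ring_def)
  have minus: "\<ominus>\<^bsub>R\<^esub> F \<in> ?J" if "F \<in> ?J" for F
  proof -
    have "?\<phi> (\<ominus>\<^bsub>R\<^esub> F) \<oplus>\<^bsub>R\<^esub> ?\<phi> F = \<zero>\<^bsub>R\<^esub>"
      using that by (simp add: l_neg gl_act_hom(3)[OF g] flip: gl_act_hom(1)[OF g])
    then have "?\<phi> (\<ominus>\<^bsub>R\<^esub> F) = \<ominus>\<^bsub>R\<^esub> ?\<phi> F"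
      using that closed by (intro minus_equality[symmetric]) auto
    then show ?thesis using that by auto
  qed
  have J: "ideal ?J R"
  proof (rule idealI)
    show "subgroup ?J (add_monoid R)"
      using minus by (intro add.subgroupI) (auto simp: gl_act_hom[OF g] J.a_closed a_inv_def[symmetric] intro!: exI[of _ "\<zero>\<^bsub>R\<^esub>"])
  qed (auto simp: gl_act_hom[OF g] closed J.I_l_closed J.I_r_closed intro: ring_axioms)
  have "?\<phi> (\<lambda>\<rho>\<in>U. \<rho> a $$ (r, s)) \<in> I q"
    if a: "a \<in> preproj_ideal \<alpha> q" and r: "r < dim_tot \<alpha>" and s: "s < dim_tot \<alpha>" for a r s
  proof -
    define h where "h = inv\<^bsub>M (dim_tot \<alpha>)\<^esub> g"
    have c: "g \<in> carrier_mat (dim_tot \<alpha>) (dim_tot \<alpha>)" "h \<in> carrier_mat (dim_tot \<alpha>) (dim_tot \<alpha>)"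
      using GL_cases[OF g] unfolding h_def by (metis framed_carrier)+
    let ?N = "dim_tot \<alpha>"
    have gen: "(\<lambda>\<rho>\<in>U. \<rho> a $$ (u, v)) \<in> I q" if "u < ?N" "v < ?N" for u v
    proof -
      have "(\<lambda>\<rho>\<in>U. \<rho> a $$ (u, v)) \<in> ?S" using a that by blast
      moreover have "?S \<subseteq> carrier R" by (auto simp: fun_ring_def entry)
      ultimately show ?thesis
        unfolding rep_ideal_def using genideal_self by blast
    qed
    have scaled: "(\<lambda>\<rho>\<in>U. k * \<rho> a $$ (u, v)) \<in> I q" if "u < ?N" "v < ?N" for k u v
    proof -
      have "(\<lambda>\<rho>\<in>U. k) \<otimes>\<^bsub>R\<^esub> (\<lambda>\<rho>\<in>U. \<rho> a $$ (u, v)) \<in> I q"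
        using gen[OF that] by (intro J.I_l_closed) (auto simp: fun_ring_def const)
      then show ?thesis by (simp add: fun_ring_def cong: restrict_cong)
    qed
    have sum: "(\<lambda>\<rho>\<in>U. \<Sum>i\<in>A. f i \<rho>) \<in> I q" if "\<And>i. i \<in> A \<Longrightarrow> (\<lambda>\<rho>\<in>U. f i \<rho>) \<in> I q"
      for A :: "nat set" and f
      using that
    proof (induction A rule: infinite_finite_induct)
      case (insert i A)
      have "(\<lambda>\<rho>\<in>U. f i \<rho>) \<oplus>\<^bsub>R\<^esub> (\<lambda>\<rho>\<in>U. \<Sum>i\<in>A. f i \<rho>) \<in> I q"
        by (rule J.a_closed[OF insert.prems insert.IH[OF insert.prems]]) auto
      also have "(\<lambda>\<rho>\<in>U. f i \<rho>) \<oplus>\<^bsub>R\<^esub> (\<lambda>\<rho>\<in>U. \<Sum>i\<in>A. f i \<rho>) = (\<lambda>\<rho>\<in>U. f i \<rho> + (\<Sum>i\<in>A. f i \<rho>))"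
        by (auto simp: fun_ring_def intro!: restrict_ext)
      finally show ?case by (simp only: sum.insert[OF insert.hyps])
    qed (use J.zero_closed in \<open>simp_all add: fun_ring_def\<close>)
    have "?\<phi> (\<lambda>\<rho>\<in>U. \<rho> a $$ (r, s)) = (\<lambda>\<rho>\<in>U. \<Sum>v<?N. \<Sum>u<?N. (h $$ (r, u) * g $$ (v, s)) * \<rho> a $$ (u, v))"
    proof
      fix \<rho>
      show "?\<phi> (\<lambda>\<rho>\<in>U. \<rho> a $$ (r, s)) \<rho> = (\<lambda>\<rho>\<in>U. \<Sum>v<?N. \<Sum>u<?N. (h $$ (r, u) * g $$ (v, s)) * \<rho> a $$ (u, v)) \<rho>"
      proof (cases "\<rho> \<in> U")
        case True
        interpret representation \<alpha> \<rho> using True U_Rep by unfold_locales auto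
        show ?thesis
          using True gl_conj_U[OF g True] index_mult_mat3[OF c(2) carrier c(1) r s]
          by (simp add: gl_act_app del: sum.lessThan_Suc) (simp add: gl_conj_def del: sum.lessThan_Suc flip: h_def)
      qed (simp add: gl_act_def)
    qed
    then show ?thesis
      using scaled by (simp only:) (intro sum, simp)
  qed
  then have "?S \<subseteq> ?J" by (auto simp: fun_ring_def entry)
  then have "Idl\<^bsub>R\<^esub> ?S \<subseteq> ?J" by (rule genideal_minimal[OF J])
  moreover have "I q = Idl\<^bsub>R\<^esub> ?S" by (simp only: rep_ideal_def)
  ultimately show ?thesis using F by blast
qed

text \<open>Since the ideal is stable, \<open>g\<close> maps the coset of an invariant function into
  itself. \<open>quot_funs\<close> asks for equality, which follows by applying the same inclusion
  to the inverse of \<open>g\<close>.\<close>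

lemma inv_funs_coset:
  assumes F: "F \<in> inv_funs \<alpha> U R"
  shows "I q +>\<^bsub>R\<^esub> F \<in> quot_funs \<alpha> q U R"
proof -
  interpret cring R by (rule cring)
  interpret J: ideal "I q" R by (rule rep_ideal_is_ideal)
  have Fc: "F \<in> carrier R" and inv: "\<And>g. g \<in> GL \<alpha> \<Longrightarrow> gl_act \<alpha> U g F = F"
    using F by (auto simp: inv_funs_def)
  have coset: "I q +>\<^bsub>R\<^esub> F = (\<lambda>H. H \<oplus>\<^bsub>R\<^esub> F) ` I q"
    by (auto simp: a_r_coset_def' )
  have sub: "gl_act \<alpha> U g ` (I q +>\<^bsub>R\<^esub> F) \<subseteq> I q +>\<^bsub>R\<^esub> F" if "g \<in> GL \<alpha>" for g
    using that by (auto simp: coset gl_act_hom(1) inv intro!: imageI gl_act_ideal)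
  have "gl_act \<alpha> U g ` (I q +>\<^bsub>R\<^esub> F) = I q +>\<^bsub>R\<^esub> F" if g: "g \<in> GL \<alpha>" for g
  proof
    obtain h where h: "h \<in> GL \<alpha>" "inv\<^bsub>M (dim_tot \<alpha>)\<^esub> g = h" "inv\<^bsub>M (dim_tot \<alpha>)\<^esub> h = g"
      "g * h = 1\<^sub>m (dim_tot \<alpha>)" and hc: "g \<in> carrier_mat (dim_tot \<alpha>) (dim_tot \<alpha>)"
        "h \<in> carrier_mat (dim_tot \<alpha>) (dim_tot \<alpha>)"
      using GL_cases[OF g] by (metis framed_carrier)
    \<comment> \<open>Pullback is contravariant: the point is conjugated by \<open>g\<close> first
      and by \<open>h\<close> afterwards.\<close>
    have gh: "gl_act \<alpha> U g (gl_act \<alpha> U h G) = G" if "G \<in> carrier R" for G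
    proof -
      have "gl_conj \<alpha> h (gl_conj \<alpha> g \<rho>) = \<rho>" if "\<rho> \<in> U" for \<rho>
      proof
        fix a
        interpret representation \<alpha> \<rho> using that U_Rep by unfold_locales auto
        have "g * (h * \<rho> a * g) * h = (g * h) * \<rho> a * (g * h)"
          using hc by (simp add: sq_algebra[where n = "Suc n"])
        then show "gl_conj \<alpha> h (gl_conj \<alpha> g \<rho>) a = \<rho> a"
          by (simp add: gl_conj_def h(2,3)) (simp add: h(4) sq_algebra[where n = "Suc n"])
      qed
      then have "gl_act \<alpha> U g (gl_act \<alpha> U h G) \<rho> = G \<rho>" if "\<rho> \<in> U" for \<rho>
        using gl_conj_U[OF g that] that by (simp add: gl_act_app)
      moreover have "gl_act \<alpha> U g (gl_act \<alpha> U h G) \<rho> = G \<rho>" if "\<rho> \<notin> U" for \<rho>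
        using outside[OF _ that, of G] that \<open>G \<in> carrier R\<close> by (simp add: gl_act_def fun_ring_def)
      ultimately show ?thesis by blast
    qed
    show "I q +>\<^bsub>R\<^esub> F \<subseteq> gl_act \<alpha> U g ` (I q +>\<^bsub>R\<^esub> F)"
    proof
      fix G assume G: "G \<in> I q +>\<^bsub>R\<^esub> F"
      then have "G \<in> carrier R" using Fc J.a_subset by (auto simp: coset)
      then have "G = gl_act \<alpha> U g (gl_act \<alpha> U h G)" by (simp add: gh)
      then show "G \<in> gl_act \<alpha> U g ` (I q +>\<^bsub>R\<^esub> F)" using sub[OF h(1)] G by blast
    qed
  qed (rule sub[OF g])
  moreover have "I q +>\<^bsub>R\<^esub> F \<in> carrier (R Quot I q)"
    using Fc by (simp add: FactRing_def a_rcosetsI J.a_subset)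
  ultimately show ?thesis by (simp add: quot_funs_def)
qed

text \<open>\<open>P\<close> is known only on cosets of invariant functions, where it is computed by
  some \<open>br\<close> on lifts. If \<open>br\<close> vanishes on the traces themselves, the
  reduced bracket is the coset of 0.\<close>

lemma poisson_commutingI:
  assumes P: "is_reduced_bracket \<alpha> q U R P"
    and inv: "\<And>T. T \<in> \<T> \<Longrightarrow> (\<lambda>\<rho>\<in>U. mtrace (T \<rho>)) \<in> inv_funs \<alpha> U R"
    and commute: "\<And>br S T. is_rep_bracket \<alpha> U R br \<Longrightarrow> S \<in> \<T> \<Longrightarrow> T \<in> \<T> \<Longrightarrow>
      br (\<lambda>\<rho>\<in>U. mtrace (S \<rho>)) (\<lambda>\<rho>\<in>U. mtrace (T \<rho>)) = (\<lambda>\<rho>\<in>U. 0)"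
  shows "poisson_commuting \<alpha> q U R P (tr_class \<alpha> q U R ` \<T>)"
proof -
  interpret cring R by (rule cring)
  interpret J: ideal "I q" R by (rule rep_ideal_is_ideal)
  obtain br where br: "is_rep_bracket \<alpha> U R br"
    "\<And>F G. F \<in> inv_funs \<alpha> U R \<Longrightarrow> G \<in> inv_funs \<alpha> U R \<Longrightarrow>
      P (I q +>\<^bsub>R\<^esub> F) (I q +>\<^bsub>R\<^esub> G) = I q +>\<^bsub>R\<^esub> br F G"
    using P by (auto simp: is_reduced_bracket_def)
  have z: "(\<lambda>\<rho>\<in>U. 0) = \<zero>\<^bsub>R\<^esub>" by (simp add: fun_ring_def)
  have "P (tr_class \<alpha> q U R S) (tr_class \<alpha> q U R T) = \<zero>\<^bsub>R Quot I q\<^esub>"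
    if "S \<in> \<T>" "T \<in> \<T>" for S T
    unfolding tr_class_def br(2)[OF inv[OF that(1)] inv[OF that(2)]] commute[OF br(1) that] z
    by (simp add: FactRing_def a_coset_join2[OF zero_closed J.a_subgroup J.zero_closed])
  moreover have "tr_class \<alpha> q U R T \<in> quot_funs \<alpha> q U R" if "T \<in> \<T>" for T
    unfolding tr_class_def by (rule inv_funs_coset[OF inv[OF that]])
  ultimately show ?thesis by (auto simp: poisson_commuting_def)
qed

lemma inv_funs_mtrace:
  assumes "regular_mat n T"
    and "\<And>g \<rho>. g \<in> GL \<alpha> \<Longrightarrow> \<rho> \<in> U \<Longrightarrow> mtrace (T (gl_conj \<alpha> g \<rho>)) = mtrace (T \<rho>)"
  shows "(\<lambda>\<rho>\<in>U. mtrace (T \<rho>)) \<in> inv_funs \<alpha> U R"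
proof -
  have "gl_act \<alpha> U g (\<lambda>\<rho>\<in>U. mtrace (T \<rho>)) = (\<lambda>\<rho>\<in>U. mtrace (T \<rho>))" if "g \<in> GL \<alpha>" for g
    using assms(2)[OF that] gl_conj_U[OF that]
    by (auto simp: gl_act_def fun_eq_iff restrict_def simp flip: gl_conj_def)
  then show ?thesis
    using regular_mtrace[OF assms(1)] by (simp add: inv_funs_def fun_ring_def regular_def)
qed

end

section \<open>The two instances: all representations, and those with X invertible\<close>

lemma reg_funs_fun_algebra: "fun_algebra (Rep \<alpha>) (reg_funs \<alpha>)"
proof
  fix F assume "F \<in> reg_funs \<alpha>"
  then show "restrict F (Rep \<alpha>) = F" by cases auto
qed (auto intro: reg_funs.intros)

text \<open>The substantial point is closure under the group, by induction on the generation of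
  regular functions: conjugation replaces an entry by a combination of entries with constant
  coefficients.\<close>

interpretation Rep: rep_space "Rep \<alpha>" "reg_funs \<alpha>" \<alpha> for \<alpha> :: "'m::nontriv mod_ring \<Rightarrow> nat"
proof -
  interpret fun_algebra "Rep \<alpha>" "reg_funs \<alpha>" by (rule reg_funs_fun_algebra)
  show "rep_space (Rep \<alpha>) (reg_funs \<alpha>) \<alpha>"
  proof unfold_locales
    fix g F assume g: "g \<in> GL \<alpha>" and "F \<in> reg_funs \<alpha>"
    from this(2) show "gl_act \<alpha> (Rep \<alpha>) g F \<in> reg_funs \<alpha>"
    proof induction
      case (const z)
      have "gl_act \<alpha> (Rep \<alpha>) g (\<lambda>\<rho>\<in>Rep \<alpha>. z) = (\<lambda>\<rho>\<in>Rep \<alpha>. z)"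
        using gl_conj_Rep[OF g] by (auto simp: gl_act_def gl_conj_def intro!: restrict_ext)
      then show ?case by (simp only: reg_funs.const)
    next
      case (entry r s a)
      define h where "h = inv\<^bsub>M (dim_tot \<alpha>)\<^esub> g"
      let ?N = "dim_tot \<alpha>"
      have c: "g \<in> carrier_mat ?N ?N" "h \<in> carrier_mat ?N ?N"
        using GL_cases[OF g] unfolding h_def by (metis framed_carrier)+
      have "gl_act \<alpha> (Rep \<alpha>) g (\<lambda>\<rho>\<in>Rep \<alpha>. \<rho> a $$ (r, s))
        = (\<lambda>\<rho>\<in>Rep \<alpha>. \<Sum>v<?N. \<Sum>u<?N. (h $$ (r, u) * g $$ (v, s)) * \<rho> a $$ (u, v))"
        unfolding gl_act_def
      proof (rule restrict_ext)
        fix \<rho> assume \<rho>: "\<rho> \<in> Rep \<alpha>"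
        interpret representation \<alpha> \<rho> using \<rho> by unfold_locales
        show "(\<lambda>\<rho>\<in>Rep \<alpha>. \<rho> a $$ (r, s)) (\<lambda>a. inv\<^bsub>M ?N\<^esub> g * \<rho> a * g)
            = (\<Sum>v<?N. \<Sum>u<?N. (h $$ (r, u) * g $$ (v, s)) * \<rho> a $$ (u, v))"
          using gl_conj_Rep[OF g \<rho>] index_mult_mat3[OF c(2) carrier c(1) entry(1,2)]
          by (simp add: gl_conj_def del: sum.lessThan_Suc flip: h_def)
      qed
      moreover have "regular (\<lambda>\<rho>. \<Sum>v<?N. \<Sum>u<?N. (h $$ (r, u) * g $$ (v, s)) * \<rho> a $$ (u, v))"
        by (intro regular_sum regular_mult regular_const) (simp_all add: regular_def reg_funs.entry)
      ultimately show ?case by (simp only: regular_def)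
    next
      case (add F G)
      have "gl_act \<alpha> (Rep \<alpha>) g (\<lambda>\<rho>\<in>Rep \<alpha>. F \<rho> + G \<rho>)
        = (\<lambda>\<rho>\<in>Rep \<alpha>. gl_act \<alpha> (Rep \<alpha>) g F \<rho> + gl_act \<alpha> (Rep \<alpha>) g G \<rho>)"
        using gl_conj_Rep[OF g] by (auto simp: gl_act_def gl_conj_def intro!: restrict_ext)
      then show ?case by (simp only: reg_funs.add[OF add.IH])
    next
      case (mult F G)
      have "gl_act \<alpha> (Rep \<alpha>) g (\<lambda>\<rho>\<in>Rep \<alpha>. F \<rho> * G \<rho>)
        = (\<lambda>\<rho>\<in>Rep \<alpha>. gl_act \<alpha> (Rep \<alpha>) g F \<rho> * gl_act \<alpha> (Rep \<alpha>) g G \<rho>)"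
        using gl_conj_Rep[OF g] by (auto simp: gl_act_def gl_conj_def intro!: restrict_ext)
      then show ?case by (simp only: reg_funs.mult[OF mult.IH])
    qed
  qed (auto intro: reg_funs.entry gl_conj_Rep)
qed

text \<open>\<open>invertible_mat\<close> does not fix the shape of the inverse \<open>B\<close>;
  its dimensions are read off from the two products, which are identity matrices.\<close>

lemma Rep0_inverse:
  assumes "\<rho> \<in> Rep0 \<alpha>"
  obtains B where "B \<in> carrier_mat (dim_cyc \<alpha>) (dim_cyc \<alpha>)" "Xmat \<alpha> \<rho> * B = 1\<^sub>m (dim_cyc \<alpha>)"
    "B * Xmat \<alpha> \<rho> = 1\<^sub>m (dim_cyc \<alpha>)" "det (Xmat \<alpha> \<rho>) \<noteq> 0"
proof -
  let ?n = "dim_cyc \<alpha>"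
  have X: "Xmat \<alpha> \<rho> \<in> carrier_mat ?n ?n" by (simp add: Xmat_def)
  obtain B where B: "Xmat \<alpha> \<rho> * B = 1\<^sub>m (dim_row (Xmat \<alpha> \<rho>))" "B * Xmat \<alpha> \<rho> = 1\<^sub>m (dim_row B)"
    using assms by (auto simp: Rep0_def invertible_mat_def inverts_mat_def)
  have "dim_col (Xmat \<alpha> \<rho> * B) = ?n" "dim_col (B * Xmat \<alpha> \<rho>) = dim_row B"
    using B X by auto
  then have c: "B \<in> carrier_mat ?n ?n" using X by auto
  then have "det (Xmat \<alpha> \<rho>) * det B = 1"
    using B X by (simp flip: det_mult[OF X])
  then have "det (Xmat \<alpha> \<rho>) \<noteq> 0" by auto
  with c B X show ?thesis by (intro that) auto
qed

lemma regular_det_Xmat: "Rep.regular \<alpha> (\<lambda>\<rho>. det (Xmat \<alpha> \<rho>))"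
  unfolding Xmat_def by (rule Rep.regular_det[OF Rep.regular_cyc_block])

lemma Rep_regular_pow: "Rep.regular \<alpha> f \<Longrightarrow> Rep.regular \<alpha> (\<lambda>\<rho>. f \<rho> ^ k)"
  by (induction k) (auto intro: Rep.regular_mult)

lemma reg_funs0I:
  assumes "Rep.regular \<alpha> f" "\<And>\<rho>. \<rho> \<in> Rep0 \<alpha> \<Longrightarrow> F \<rho> = f \<rho> / det (Xmat \<alpha> \<rho>) ^ k"
  shows "restrict F (Rep0 \<alpha>) \<in> reg_funs0 \<alpha>"
proof -
  have "restrict F (Rep0 \<alpha>) = (\<lambda>\<rho>\<in>Rep0 \<alpha>. restrict f (Rep \<alpha>) \<rho> / det (Xmat \<alpha> \<rho>) ^ k)"
    using assms(2) by (intro restrict_ext) (auto simp: Rep0_def)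
  then show ?thesis
    using assms(1) unfolding reg_funs0_def Rep.regular_def by blast
qed

lemma reg_funs0E:
  assumes "F \<in> reg_funs0 \<alpha>"
  obtains f k where "f \<in> reg_funs \<alpha>" "Rep.regular \<alpha> f" "F = (\<lambda>\<rho>\<in>Rep0 \<alpha>. f \<rho> / det (Xmat \<alpha> \<rho>) ^ k)"
  using assms Rep.restrict unfolding reg_funs0_def Rep.regular_def by fastforce

text \<open>The cyclic block of x is conjugated by \<open>g'\<close>, which preserves invertibility
  and the determinant. The latter keeps the denominators in \<open>reg_funs0\<close> fixed under the
  group.\<close>

lemma gl_conj_Rep0:
  assumes g: "g \<in> GL \<alpha>" and \<rho>: "\<rho> \<in> Rep0 \<alpha>"
  shows "gl_conj \<alpha> g \<rho> \<in> Rep0 \<alpha>" "det (Xmat \<alpha> (gl_conj \<alpha> g \<rho>)) = det (Xmat \<alpha> \<rho>)"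
proof -
  let ?n = "dim_cyc \<alpha>"
  have rep: "\<rho> \<in> Rep \<alpha>" using \<rho> by (simp add: Rep0_def)
  obtain g' h' where gh: "g' \<in> carrier_mat ?n ?n" "h' \<in> carrier_mat ?n ?n"
    "g' * h' = 1\<^sub>m ?n" "h' * g' = 1\<^sub>m ?n" "Xmat \<alpha> (gl_conj \<alpha> g \<rho>) = h' * Xmat \<alpha> \<rho> * g'"
    using cyc_block_gl_conj[OF g] rep unfolding Xmat_def by (metis cyc_elem_xy(1))
  have X: "Xmat \<alpha> \<rho> \<in> carrier_mat ?n ?n" by (simp add: Xmat_def)
  have "det h' * det g' = 1"
    using gh(4) by (simp flip: det_mult[OF gh(2,1)])
  then show "det (Xmat \<alpha> (gl_conj \<alpha> g \<rho>)) = det (Xmat \<alpha> \<rho>)"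
    unfolding gh(5) using gh(1,2) X by (simp add: det_mult[of _ ?n])
  obtain B where B: "B \<in> carrier_mat ?n ?n" "Xmat \<alpha> \<rho> * B = 1\<^sub>m ?n" "B * Xmat \<alpha> \<rho> = 1\<^sub>m ?n"
    using Rep0_inverse[OF \<rho>] by metis
  have "h' * 1\<^sub>m ?n * g' = 1\<^sub>m ?n"
    using gh(1,2,4) by (simp add: sq_algebra[where n = ?n])
  then have "(h' * Xmat \<alpha> \<rho> * g') * (h' * B * g') = 1\<^sub>m ?n" "(h' * B * g') * (h' * Xmat \<alpha> \<rho> * g') = 1\<^sub>m ?n"
    by (simp_all only: conj_mult_mat[OF X B(1) gh(1-3)] conj_mult_mat[OF B(1) X gh(1-3)] B(2,3))
  moreover have "h' * Xmat \<alpha> \<rho> * g' \<in> carrier_mat ?n ?n" "h' * B * g' \<in> carrier_mat ?n ?n"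
    using gh(1,2) B(1) X by simp_all
  ultimately have "invertible_mat (Xmat \<alpha> (gl_conj \<alpha> g \<rho>))"
    unfolding gh(5) invertible_mat_def inverts_mat_def by (metis carrier_matD square_mat.simps)
  then show "gl_conj \<alpha> g \<rho> \<in> Rep0 \<alpha>"
    using gl_conj_Rep[OF g rep] by (simp add: Rep0_def)
qed

lemma reg_funs0_fun_algebra: "fun_algebra (Rep0 \<alpha>) (reg_funs0 \<alpha>)"
proof
  fix F assume "F \<in> reg_funs0 \<alpha>"
  then show "restrict F (Rep0 \<alpha>) = F" by (auto simp: reg_funs0_def)
next
  fix z show "(\<lambda>\<rho>\<in>Rep0 \<alpha>. z) \<in> reg_funs0 \<alpha>"
    by (rule reg_funs0I[of _ "\<lambda>_. z" _ 0]) simp_all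
next
  fix F G assume F: "F \<in> reg_funs0 \<alpha>" and G: "G \<in> reg_funs0 \<alpha>"
  obtain f k where f: "Rep.regular \<alpha> f" "F = (\<lambda>\<rho>\<in>Rep0 \<alpha>. f \<rho> / det (Xmat \<alpha> \<rho>) ^ k)"
    by (rule reg_funs0E[OF F])
  obtain h l where h: "Rep.regular \<alpha> h" "G = (\<lambda>\<rho>\<in>Rep0 \<alpha>. h \<rho> / det (Xmat \<alpha> \<rho>) ^ l)"
    by (rule reg_funs0E[OF G])
  have nz: "det (Xmat \<alpha> \<rho>) \<noteq> 0" if "\<rho> \<in> Rep0 \<alpha>" for \<rho>
    using Rep0_inverse[OF that] by metis
  have "Rep.regular \<alpha> (\<lambda>\<rho>. f \<rho> * det (Xmat \<alpha> \<rho>) ^ l + h \<rho> * det (Xmat \<alpha> \<rho>) ^ k)"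
    by (intro Rep.regular_add Rep.regular_mult Rep_regular_pow regular_det_Xmat f h)
  then show "(\<lambda>\<rho>\<in>Rep0 \<alpha>. F \<rho> + G \<rho>) \<in> reg_funs0 \<alpha>"
    by (rule reg_funs0I[where k = "k + l"])
       (use f h nz in \<open>auto simp: field_simps power_add\<close>)
  have "Rep.regular \<alpha> (\<lambda>\<rho>. f \<rho> * h \<rho>)"
    by (intro Rep.regular_mult f h)
  then show "(\<lambda>\<rho>\<in>Rep0 \<alpha>. F \<rho> * G \<rho>) \<in> reg_funs0 \<alpha>"
    by (rule reg_funs0I[where k = "k + l"]) (use f h nz in \<open>auto simp: field_simps power_add\<close>)
qed

interpretation Rep0: rep_space "Rep0 \<alpha>" "reg_funs0 \<alpha>" \<alpha> for \<alpha> :: "'m::nontriv mod_ring \<Rightarrow> nat"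
proof -
  interpret fun_algebra "Rep0 \<alpha>" "reg_funs0 \<alpha>" by (rule reg_funs0_fun_algebra)
  show "rep_space (Rep0 \<alpha>) (reg_funs0 \<alpha>) \<alpha>"
  proof unfold_locales
    show "Rep0 \<alpha> \<subseteq> Rep \<alpha>" by (auto simp: Rep0_def)
  next
    fix r s a assume "r < dim_tot \<alpha>" "s < dim_tot \<alpha>"
    then show "(\<lambda>\<rho>\<in>Rep0 \<alpha>. \<rho> a $$ (r, s)) \<in> reg_funs0 \<alpha>"
      by (intro reg_funs0I[of _ "\<lambda>\<rho>. \<rho> a $$ (r, s)" _ 0]) (simp_all add: Rep.regular_def reg_funs.entry)
  next
    fix g F assume g: "g \<in> GL \<alpha>" and F: "F \<in> reg_funs0 \<alpha>"
    obtain f k where f: "f \<in> reg_funs \<alpha>" "F = (\<lambda>\<rho>\<in>Rep0 \<alpha>. f \<rho> / det (Xmat \<alpha> \<rho>) ^ k)"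
      by (rule reg_funs0E[OF F])
    have "gl_act \<alpha> (Rep \<alpha>) g f \<in> reg_funs \<alpha>" by (rule Rep.gl_act_closed[OF g f(1)])
    then have "Rep.regular \<alpha> (gl_act \<alpha> (Rep \<alpha>) g f)"
      by (simp add: Rep.regular_def Rep.restrict)
    moreover have "F (gl_conj \<alpha> g \<rho>) = gl_act \<alpha> (Rep \<alpha>) g f \<rho> / det (Xmat \<alpha> \<rho>) ^ k"
      if "\<rho> \<in> Rep0 \<alpha>" for \<rho>
      using gl_conj_Rep0[OF g that] that by (auto simp: f(2) Rep.gl_act_app Rep0_def)
    ultimately have "(\<lambda>\<rho>\<in>Rep0 \<alpha>. F (gl_conj \<alpha> g \<rho>)) \<in> reg_funs0 \<alpha>"
      by (intro reg_funs0I)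
    then show "gl_act \<alpha> (Rep0 \<alpha>) g F \<in> reg_funs0 \<alpha>"
      by (simp add: gl_act_def gl_conj_def)
  qed (rule gl_conj_Rep0)
qed

lemma inv_Xmat:
  assumes "\<rho> \<in> Rep0 \<alpha>"
  defines "B \<equiv> inv\<^bsub>M (dim_cyc \<alpha>)\<^esub> (Xmat \<alpha> \<rho>)"
  shows "B \<in> carrier_mat (dim_cyc \<alpha>) (dim_cyc \<alpha>)" "Xmat \<alpha> \<rho> * B = 1\<^sub>m (dim_cyc \<alpha>)"
    "B * Xmat \<alpha> \<rho> = 1\<^sub>m (dim_cyc \<alpha>)"
proof -
  have X: "Xmat \<alpha> \<rho> \<in> carrier_mat (dim_cyc \<alpha>) (dim_cyc \<alpha>)" by (simp add: Xmat_def)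
  show "B \<in> carrier_mat (dim_cyc \<alpha>) (dim_cyc \<alpha>)" "Xmat \<alpha> \<rho> * B = 1\<^sub>m (dim_cyc \<alpha>)"
    "B * Xmat \<alpha> \<rho> = 1\<^sub>m (dim_cyc \<alpha>)"
    using Rep0_inverse[OF assms(1)] ring_mat_inv_eq[OF X] unfolding B_def by metis+
qed

text \<open>Cramer's rule: the adjugate is regular, and dividing by det X is allowed in
  \<open>reg_funs0\<close>.\<close>

lemma regular_mat_inv_Xmat:
  "Rep0.regular_mat \<alpha> (dim_cyc \<alpha>) (\<lambda>\<rho>. inv\<^bsub>M (dim_cyc \<alpha>)\<^esub> (Xmat \<alpha> \<rho>))"
proof -
  let ?n = "dim_cyc \<alpha>"
  have "Rep0.regular_mat \<alpha> ?n (Xmat \<alpha>)"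
    using Rep0.regular_cyc_block[of \<alpha> x_elem] by (simp add: Xmat_def[abs_def])
  then have "Rep0.regular_mat \<alpha> ?n (\<lambda>\<rho>. adj_mat (Xmat \<alpha> \<rho>))"
    by (rule Rep0.regular_mat_adj)
  moreover have "Rep0.regular \<alpha> (\<lambda>\<rho>. 1 / det (Xmat \<alpha> \<rho>))"
    unfolding Rep0.regular_def by (rule reg_funs0I[of _ "\<lambda>_. 1" _ 1]) simp_all
  ultimately have "Rep0.regular_mat \<alpha> ?n (\<lambda>\<rho>. (1 / det (Xmat \<alpha> \<rho>)) \<cdot>\<^sub>m adj_mat (Xmat \<alpha> \<rho>))"
    by (intro Rep0.regular_mat_smult)
  moreover have "inv\<^bsub>M ?n\<^esub> (Xmat \<alpha> \<rho>) = (1 / det (Xmat \<alpha> \<rho>)) \<cdot>\<^sub>m adj_mat (Xmat \<alpha> \<rho>)"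
    if "\<rho> \<in> Rep0 \<alpha>" for \<rho>
  proof -
    have X: "Xmat \<alpha> \<rho> \<in> carrier_mat ?n ?n" by (simp add: Xmat_def)
    have "det (Xmat \<alpha> \<rho>) \<noteq> 0" using Rep0_inverse[OF that] by metis
    then show ?thesis
      using X adj_mat[OF X]
      by (intro ring_mat_inv_eq) (auto simp: sq_algebra[where n = ?n] intro!: eq_matI)
  qed
  ultimately show ?thesis by (rule Rep0.regular_mat_cong[rotated])
qed

section \<open>Contractions of the double bracket\<close>

lemma abs_dpa2_conv: "abs_dpa2 us = (\<Sum>(a, b)\<leftarrow>us. a \<otimes>\<^sub>A b)"
proof (induction us)
  case (Cons ab us)
  have "abs_dpa2 (ab # us) = fst ab \<otimes>\<^sub>A snd ab + abs_dpa2 us"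
    by (simp add: tens.abs_eq plus_dpa2.abs_eq)
  then show ?case using Cons by (simp add: case_prod_beta)
qed (simp add: zero_dpa2_def)

lemma ex_abs_dpa2: "\<exists>us. u = abs_dpa2 us"
  by (metis Quotient3_abs_rep Quotient3_dpa2)

lemma tcross_zero_left [simp]: "tcross 0 v = 0"
  by transfer (simp add: tens_eq.refl)

lemma tcross_add_left: "tcross (u + u') v = tcross u v + tcross u' v"
  by transfer (simp add: tens_eq.refl)

lemma tcross_tens_left: "tcross (a \<otimes>\<^sub>A b) v = tmap 1 b a 1 v"
  by transfer (simp add: tens_eq.refl)

context representation
begin

abbreviation N :: nat where "N \<equiv> Suc n"

text \<open>\<open>tens_entry\<close> evaluates an arbitrarily chosen decomposition. Two lists for
  the same tensor are related by \<open>tens_eq\<close>, and evaluation at matrix entries respects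
  each of its generating relations, so the choice does not matter.\<close>

lemma tens_entry_abs:
  assumes "r < N" "s < N" "k < N" "l < N"
  shows "tens_entry \<rho> (abs_dpa2 us) (r, s) (k, l) = (\<Sum>(a, b)\<leftarrow>us. \<rho> a $$ (r, s) * \<rho> b $$ (k, l))"
proof -
  let ?val = "\<lambda>us. \<Sum>(a, b)\<leftarrow>us. \<rho> a $$ (r, s) * \<rho> b $$ (k, l)"
  have cong: "?val u = ?val v" if "tens_eq u v" for u v
    using that assms
    by (induction rule: tens_eq.induct) (simp_all add: add scal_times zero algebra_simps)
  have "abs_dpa2 us = (\<Sum>(a, b)\<leftarrow>(SOME vs. abs_dpa2 us = (\<Sum>(a, b)\<leftarrow>vs. a \<otimes>\<^sub>A b)). a \<otimes>\<^sub>A b)"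
    by (rule someI[of _ us]) (rule abs_dpa2_conv)
  then have "tens_eq us (SOME vs. abs_dpa2 us = (\<Sum>(a, b)\<leftarrow>vs. a \<otimes>\<^sub>A b))"
    by (simp add: dpa2.abs_eq_iff flip: abs_dpa2_conv)
  then show ?thesis
    unfolding tens_entry_def Let_def by (metis (no_types, lifting) cong)
qed

lemma tens_entry_add:
  assumes "r < N" "s < N" "k < N" "l < N"
  shows "tens_entry \<rho> (u + v) (r, s) (k, l) = tens_entry \<rho> u (r, s) (k, l) + tens_entry \<rho> v (r, s) (k, l)"
proof -
  obtain us vs where "u = abs_dpa2 us" "v = abs_dpa2 vs" using ex_abs_dpa2 by metis
  moreover from this have "u + v = abs_dpa2 (us @ vs)" by (simp add: plus_dpa2.abs_eq)
  ultimately show ?thesis using assms by (simp add: tens_entry_abs)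
qed

lemma tens_entry_tens:
  assumes "r < N" "s < N" "k < N" "l < N"
  shows "tens_entry \<rho> (a \<otimes>\<^sub>A b) (r, s) (k, l) = \<rho> a $$ (r, s) * \<rho> b $$ (k, l)"
  using assms by (simp add: tens.abs_eq tens_entry_abs)

text \<open>For \<open>u\<close> the double bracket of \<open>a\<close> and \<open>b\<close> this is the sum of the \<open>P\<^sub>j\<^sub>i P'\<^sub>l\<^sub>k {a\<^sub>i\<^sub>j, b\<^sub>k\<^sub>l}\<close>.\<close>

definition contr :: "complex mat \<Rightarrow> complex mat \<Rightarrow> 'm dpa2 \<Rightarrow> complex" where
  "contr P P' u = (\<Sum>k<N. \<Sum>l<N. \<Sum>i<N. \<Sum>j<N. P $$ (j, i) * P' $$ (l, k) * tens_entry \<rho> u (k, j) (i, l))"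

lemma contr_add: "contr P P' (u + v) = contr P P' u + contr P P' v"
  unfolding contr_def
  by (simp add: tens_entry_add Rings.distrib_left sum.distrib del: sum.lessThan_Suc)

text \<open>The index pattern in the bracket of two entries is the one for which the four contracted
  indices close up to a single trace.\<close>

lemma contr_tens:
  assumes "P \<in> carrier_mat N N" "P' \<in> carrier_mat N N"
  shows "contr P P' (a \<otimes>\<^sub>A b) = mtrace (\<rho> a * P * \<rho> b * P')"
  unfolding contr_def mtrace_mult[OF sq_mult_carrier[OF sq_mult_carrier[OF carrier assms(1)] carrier] assms(2)]
  using assms
  by (intro sum.cong)
     (simp_all add: index_mult_mat3[of _ N] tens_entry_tens sum_distrib_left sum_distrib_right mult_ac
       del: index_mult_mat sum.lessThan_Suc)

lemma contr_zero [simp]: "contr P P' 0 = 0"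
  using contr_add[of P P' 0 0] by simp

lemma contr_uminus: "contr P P' (- u) = - contr P P' u"
  using contr_add[of P P' u "- u"] by (simp add: add_eq_0_iff)

lemma contr_minus: "contr P P' (u - v) = contr P P' u - contr P P' v"
  using contr_add[of P P' u "- v"] by (simp add: contr_uminus)

lemma contr_sum: "contr P P' (sum f S) = (\<Sum>i\<in>S. contr P P' (f i))"
  by (induction S rule: infinite_finite_induct) (simp_all add: contr_add)

lemma contr_tscale:
  assumes "P \<in> carrier_mat N N" "P' \<in> carrier_mat N N"
  shows "contr P P' (tscale z u) = z * contr P P' u"
proof (induction u rule: dpa2_induct)
  case (add a b u)
  have "contr P P' (tscale z (a \<otimes>\<^sub>A b)) = z * contr P P' (a \<otimes>\<^sub>A b)"
    using assms
    by (simp add: tmap_tens contr_tens scal_times sq_algebra[where n = N] mtrace_smult[of _ N])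
  with add show ?case by (simp add: tmap_add contr_add Rings.distrib_left)
qed simp

text \<open>The sum of the \<open>u'' P u'\<close>.\<close>

definition swap_contr :: "complex mat \<Rightarrow> 'm dpa2 \<Rightarrow> complex mat" where
  "swap_contr P u = mat N N (\<lambda>(r, s). \<Sum>l<N. \<Sum>k<N. P $$ (k, l) * tens_entry \<rho> u (l, s) (r, k))"

lemma swap_contr_carrier [simp]: "swap_contr P u \<in> carrier_mat N N"
  by (simp add: swap_contr_def)

lemma swap_contr_add: "swap_contr P (u + v) = swap_contr P u + swap_contr P v"
  unfolding swap_contr_def
  by (rule eq_matI) (simp_all add: tens_entry_add Rings.distrib_left sum.distrib del: sum.lessThan_Suc)

lemma swap_contr_zero [simp]: "swap_contr P 0 = 0\<^sub>m N N"
proof (rule eq_matI)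
  fix i j assume ij: "i < dim_row (0\<^sub>m N N :: complex mat)" "j < dim_col (0\<^sub>m N N :: complex mat)"
  have "tens_entry \<rho> 0 (r, s) (k, l) = 0" if "r < N" "s < N" "k < N" "l < N" for r s k l
    using tens_entry_add[OF that, of 0 0] by simp
  then show "swap_contr P 0 $$ (i, j) = 0\<^sub>m N N $$ (i, j)"
    using ij by (simp add: swap_contr_def del: sum.lessThan_Suc)
qed (simp_all add: swap_contr_def)

lemma swap_contr_uminus: "swap_contr P (- u) = - swap_contr P u"
proof -
  have z: "swap_contr P u + swap_contr P (- u) = 0\<^sub>m N N"
    using swap_contr_add[of P u "- u"] by simp
  show ?thesis
  proof (rule eq_matI)
    fix i j assume "i < dim_row (- swap_contr P u)" "j < dim_col (- swap_contr P u)"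
    then have ij: "i < N" "j < N" by (simp_all add: swap_contr_def)
    then have "swap_contr P u $$ (i, j) + swap_contr P (- u) $$ (i, j) = 0"
      using arg_cong[OF z, of "\<lambda>A. A $$ (i, j)"]
      by (subst (asm) index_add_mat) (auto simp: swap_contr_def simp del: sum.lessThan_Suc)
    then show "swap_contr P (- u) $$ (i, j) = (- swap_contr P u) $$ (i, j)"
      using ij by (simp add: add_eq_0_iff carrier_matD[OF swap_contr_carrier])
  qed (simp_all add: swap_contr_def)
qed

lemma swap_contr_minus: "swap_contr P (u - v) = swap_contr P u - swap_contr P v"
  using swap_contr_add[of P u "- v"] by (simp add: swap_contr_uminus minus_add_uminus_mat[of _ N N])

lemma swap_contr_tens:
  assumes "P \<in> carrier_mat N N"
  shows "swap_contr P (a \<otimes>\<^sub>A b) = \<rho> b * P * \<rho> a"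
proof (rule eq_matI)
  fix i j assume "i < dim_row (\<rho> b * P * \<rho> a)" "j < dim_col (\<rho> b * P * \<rho> a)"
  then have ij: "i < N" "j < N" by simp_all
  show "swap_contr P (a \<otimes>\<^sub>A b) $$ (i, j) = (\<rho> b * P * \<rho> a) $$ (i, j)"
    unfolding index_mult_mat3[OF carrier assms carrier ij]
    using ij by (simp add: swap_contr_def tens_entry_tens mult_ac del: sum.lessThan_Suc)
qed (simp_all add: swap_contr_def)

text \<open>The inner bimodule structure carried by double derivations becomes ordinary left and
  right multiplication once the tensor factors are swapped.\<close>

lemma swap_contr_tmap:
  assumes "P \<in> carrier_mat N N"
  shows "swap_contr P (tmap 1 c b 1 u) = \<rho> b * swap_contr P u * \<rho> c"
proof (induction u rule: dpa2_induct)
  case zero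
  show ?case by (simp add: right_mult_zero_mat[of _ N N] left_mult_zero_mat[of _ N N])
next
  case (add p p' u)
  then show ?case
    using assms
    by (simp add: tmap_add tmap_tens swap_contr_add swap_contr_tens mult sq_algebra[where n = N])
qed

text \<open>For pure tensors a \<otimes> b and c \<otimes> d the left side is tr(c b P a d P').
  Rotating d P' to the front separates it into the factors d P' c and b P a, one for each
  tensor.\<close>

lemma contr_tcross:
  assumes P: "P \<in> carrier_mat N N" "P' \<in> carrier_mat N N"
  shows "contr P P' (tcross u v) = mtrace (swap_contr P' v * swap_contr P u)"
proof (induction u rule: dpa2_induct)
  case zero
  show ?case by (simp add: right_mult_zero_mat[of _ N N])
next
  case (add a b u)
  have "contr P P' (tcross (a \<otimes>\<^sub>A b) v) = mtrace (swap_contr P' v * (\<rho> b * P * \<rho> a))"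
  proof (induction v rule: dpa2_induct)
    case zero
    show ?case by (simp add: tcross_tens_left left_mult_zero_mat[of _ N N])
  next
    case (add c d v)
    have "mtrace (\<rho> (c * b) * P * \<rho> (a * d) * P') = mtrace ((\<rho> d * P' * \<rho> c) * (\<rho> b * P * \<rho> a))"
    proof -
      have "mtrace (\<rho> (c * b) * P * \<rho> (a * d) * P') = mtrace ((\<rho> c * (\<rho> b * P * \<rho> a)) * (\<rho> d * P'))"
        using P by (simp add: mult sq_algebra[where n = N])
      also have "\<dots> = mtrace ((\<rho> d * P') * (\<rho> c * (\<rho> b * P * \<rho> a)))"
        using P by (intro mtrace_comm[of _ N]) simp_all
      finally show ?thesis using P by (simp add: sq_algebra[where n = N])
    qed
    with add show ?case
      using P
      by (simp add: tcross_tens_left tmap_add tmap_tens contr_add contr_tens swap_contr_add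
          swap_contr_tens add_mult_distrib_mat[of _ N N _ _ N] mtrace_add[of _ N])
  qed
  with add show ?case
    using P
    by (simp add: tcross_add_left contr_add swap_contr_add swap_contr_tens
        mult_add_distrib_mat[of _ N N _ N] mtrace_add[of _ N])
qed

end

section \<open>Partial double derivations on x and y, and the pairing with gradients\<close>

lemma partial_props:
  "double_derivation (partial c)"
  "partial c (arr b) = (if b = c then idem (tail c) \<otimes>\<^sub>A idem (head c) else 0)"
  using theI'[OF partial_ex1[of c]] unfolding partial_def by blast+

lemma partial_zero: "partial c 0 = 0"
  using partial_props(1)[of c] unfolding double_derivation_def by (metis add_cancel_right_left)

lemma partial_sum: "partial c (sum f S) = (\<Sum>i\<in>S. partial c (f i))"
proof -
  have "partial c (a + b) = partial c a + partial c b" for a b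
    using partial_props(1)[of c] by (simp add: double_derivation_def)
  then show ?thesis
    by (induction S rule: infinite_finite_induct) (simp_all add: partial_zero)
qed

lemma partial_xy [simp]:
  "partial (Ax i) x_elem = idem (Cyc i) \<otimes>\<^sub>A idem (Cyc (i + 1))"
  "partial (Ay i) y_elem = idem (Cyc (i + 1)) \<otimes>\<^sub>A idem (Cyc i)"
  "partial (Ax i) y_elem = 0" "partial (Ay i) x_elem = 0"
  "partial Av x_elem = 0" "partial Av y_elem = 0" "partial Aw x_elem = 0" "partial Aw y_elem = 0"
  by (simp_all add: x_elem_def y_elem_def partial_sum partial_props(2))

lemma sum_arrows:
  fixes f :: "'m::nontriv mod_ring arrow \<Rightarrow> 'a::comm_monoid_add"
  shows "(\<Sum>c\<in>UNIV. f c) = (\<Sum>i\<in>UNIV. f (Ax i)) + (\<Sum>i\<in>UNIV. f (Ay i)) + (f Av + f Aw)"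
proof -
  have inj: "inj (Ax :: 'm mod_ring \<Rightarrow> _)" "inj (Ay :: 'm mod_ring \<Rightarrow> _)"
    by (simp_all add: inj_def)
  have "(\<Sum>c\<in>UNIV. f c) = (\<Sum>c\<in>range Ax \<union> range Ay \<union> {Av, Aw}. f c)"
    by (simp only: UNIV_arrow)
  also have "\<dots> = (\<Sum>c\<in>range Ax. f c) + (\<Sum>c\<in>range Ay. f c) + (\<Sum>c\<in>{Av, Aw}. f c)"
    by (subst sum.union_disjoint, simp, simp, blast)+ simp
  finally show ?thesis
    using inj by (simp add: sum.reindex)
qed

context representation
begin

text \<open>The four terms of the chain rule for the bracket of two functions whose differentials
  involve only x and y, with coefficients \<open>P\<close>, \<open>Q\<close> for the first and
  \<open>P'\<close>, \<open>Q'\<close> for the second.\<close>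

definition pairing ::
  "complex mat \<Rightarrow> complex mat \<Rightarrow> complex mat \<Rightarrow> complex mat \<Rightarrow> ('m dpa \<Rightarrow> 'm dpa \<Rightarrow> 'm dpa2) \<Rightarrow> complex"
  where "pairing P Q P' Q' f = contr P P' (f x_elem x_elem) + contr P Q' (f x_elem y_elem)
    + contr Q P' (f y_elem x_elem) + contr Q Q' (f y_elem y_elem)"

definition cyclic_der :: "complex mat \<Rightarrow> complex mat \<Rightarrow> ('m dpa \<Rightarrow> 'm dpa2) \<Rightarrow> complex mat" where
  "cyclic_der P Q \<delta> = swap_contr P (\<delta> x_elem) + swap_contr Q (\<delta> y_elem)"

lemma cyclic_der_carrier [simp]: "cyclic_der P Q \<delta> \<in> carrier_mat N N"
  by (simp add: cyclic_der_def)

lemma pairing_dbr_prod: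
  assumes "P \<in> carrier_mat N N" "Q \<in> carrier_mat N N" "P' \<in> carrier_mat N N" "Q' \<in> carrier_mat N N"
  shows "pairing P Q P' Q' (dbr_prod \<delta>\<^sub>1 \<delta>\<^sub>2)
    = mtrace (cyclic_der P' Q' \<delta>\<^sub>2 * cyclic_der P Q \<delta>\<^sub>1) - mtrace (cyclic_der P' Q' \<delta>\<^sub>1 * cyclic_der P Q \<delta>\<^sub>2)"
  using assms
  by (simp add: pairing_def dbr_prod_def contr_minus contr_tcross cyclic_der_def
      sq_algebra[where n = N] mtrace_add[of _ N])

lemma pairing_double_bracket:
  assumes "P \<in> carrier_mat N N" "Q \<in> carrier_mat N N" "P' \<in> carrier_mat N N" "Q' \<in> carrier_mat N N"
  shows "2 * pairing P Q P' Q' double_bracket =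
    (\<Sum>c\<in>UNIV. eps c * pairing P Q P' Q'
       (dbr_prod (dd_bimod (1 + arr (opp c) * arr c) (partial c) 1) (partial (opp c))))
    - (\<Sum>(c, d)\<in>{(c, d). arrow_less c d}. pairing P Q P' Q' (dbr_prod (F_der c) (F_der d)))"
  using assms
  by (simp add: pairing_def double_bracket_def contr_minus contr_tscale contr_sum case_prod_beta
      sum.distrib Rings.distrib_left sum_distrib_left right_diff_distrib)

lemma cyclic_der_dd_bimod:
  assumes "P \<in> carrier_mat N N" "Q \<in> carrier_mat N N"
  shows "cyclic_der P Q (dd_bimod b \<delta> c) = \<rho> b * cyclic_der P Q \<delta> * \<rho> c"
  using assms
  by (simp add: cyclic_der_def dd_bimod_def swap_contr_tmap sq_algebra[where n = N])

lemma cyclic_der_F_der: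
  assumes "P \<in> carrier_mat N N" "Q \<in> carrier_mat N N"
  shows "cyclic_der P Q (F_der c) = cyclic_der P Q (partial (opp c)) * \<rho> (arr (opp c))
    - \<rho> (arr c) * cyclic_der P Q (partial c)"
proof -
  have "cyclic_der P Q (F_der c) = cyclic_der P Q (dd_bimod 1 (partial (opp c)) (arr (opp c)))
    - cyclic_der P Q (dd_bimod (arr c) (partial c) 1)"
    by (rule eq_matI) (simp_all add: cyclic_der_def F_der_def swap_contr_minus carrier_matD[OF swap_contr_carrier])
  then show ?thesis
    using assms by (simp add: cyclic_der_dd_bimod one sq_algebra[where n = N])
qed

abbreviation E :: "'m mod_ring \<Rightarrow> complex mat" where "E i \<equiv> cb (Defs.idem (Cyc i))"
abbreviation X :: "complex mat" where "X \<equiv> cb x_elem"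
abbreviation Y :: "complex mat" where "Y \<equiv> cb y_elem"

lemma E_idem: "E i * E i = E i"
  by (simp add: idem_idem flip: cb_mult)

lemma cb_arr: "cb (arr (Ax i)) = X * E (i + 1)" "cb (arr (Ay i)) = Y * E i"
  by (simp_all add: x_elem_idem y_elem_idem flip: cb_mult)

lemma E_X: "E i * X = X * E (i + 1)"
  by (simp add: idem_x_elem x_elem_idem flip: cb_mult)

lemma E_Y: "E i * Y = Y * E (i - 1)"
  using idem_y_elem[of "i - 1"] by (simp add: y_elem_idem flip: cb_mult)

lemma mtrace_decomp_shift:
  assumes "A \<in> carrier_mat n n"
  shows "(\<Sum>i\<in>UNIV. mtrace (A * E (i + 1))) = mtrace A"
proof -
  have "(\<Sum>i\<in>UNIV. mtrace (A * E (i + 1))) = (\<Sum>i\<in>UNIV. mtrace (A * E i))"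
    by (rule sum.reindex_bij_witness[of _ "\<lambda>i. i - 1" "\<lambda>i. i + 1"]) auto
  then show ?thesis using mtrace_decomp[OF assms] by simp
qed

text \<open>The gradient of an invariant function has this homogeneity, which allows all vertex idempotents
  to be moved to the right and then summed up to the identity.\<close>

definition graded_pair :: "complex mat \<Rightarrow> complex mat \<Rightarrow> bool" where
  "graded_pair P Q \<longleftrightarrow> P \<in> carrier_mat n n \<and> Q \<in> carrier_mat n n \<and>
     (\<forall>i. E i * P = P * E (i - 1)) \<and> (\<forall>i. E i * Q = Q * E (i + 1))"

text \<open>Swapping the value of the derivative on x or y places \<open>P\<close> or
  \<open>Q\<close> between the idempotents at the ends of the arrow; by homogeneity the left one is
  absorbed by the right one. Derivatives along the framing arrows are zero because x and y do not
  contain them.\<close>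

lemma cyclic_der_partial:
  assumes "graded_pair P Q"
  shows "cyclic_der (pad_mat P) (pad_mat Q) (partial (Ax i)) = pad_mat (P * E i)"
    and "cyclic_der (pad_mat P) (pad_mat Q) (partial (Ay i)) = pad_mat (Q * E (i + 1))"
    and "cyclic_der (pad_mat P) (pad_mat Q) (partial Av) = 0\<^sub>m N N"
    and "cyclic_der (pad_mat P) (pad_mat Q) (partial Aw) = 0\<^sub>m N N"
proof -
  have c: "P \<in> carrier_mat n n" "Q \<in> carrier_mat n n"
    and g: "E (i + 1) * P = P * E i" "E i * Q = Q * E (i + 1)" for i
    using assms by (auto simp: graded_pair_def)
  have "E (i + 1) * P * E i = P * E i" "E i * Q * E (i + 1) = Q * E (i + 1)"
    unfolding g using c by (simp_all add: sq_algebra[where n = n] E_idem)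
  then show "cyclic_der (pad_mat P) (pad_mat Q) (partial (Ax i)) = pad_mat (P * E i)"
    and "cyclic_der (pad_mat P) (pad_mat Q) (partial (Ay i)) = pad_mat (Q * E (i + 1))"
    using c by (simp_all add: cyclic_der_def swap_contr_tens rho_cyc_elem pad_mat_mult[of _ n])
qed (simp_all add: cyclic_der_def)

lemma cyclic_der_F:
  assumes "graded_pair P Q"
  shows "cyclic_der (pad_mat P) (pad_mat Q) (F_der (Ax i)) = pad_mat ((Q * Y - X * P) * E i)"
    and "cyclic_der (pad_mat P) (pad_mat Q) (F_der (Ay i)) = pad_mat ((P * X - Y * Q) * E (i + 1))"
    and "cyclic_der (pad_mat P) (pad_mat Q) (F_der Av) = 0\<^sub>m N N"
    and "cyclic_der (pad_mat P) (pad_mat Q) (F_der Aw) = 0\<^sub>m N N"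
proof -
  have c: "P \<in> carrier_mat n n" "Q \<in> carrier_mat n n"
    and g: "E i * P = P * E (i - 1)" "E i * Q = Q * E (i + 1)" for i
    using assms by (auto simp: graded_pair_def)
  \<comment> \<open>The commutation rules with a trailing factor, so that idempotents can be pushed
    to the end of any right-nested product.\<close>
  have EA: "E i * (X * A) = X * (E (i + 1) * A)" "E i * (Y * A) = Y * (E (i - 1) * A)"
    "E i * (P * A) = P * (E (i - 1) * A)" "E i * (Q * A) = Q * (E (i + 1) * A)" "E i * (E i * A) = E i * A"
    if "A \<in> carrier_mat n n" for i A
    using that c by (simp_all add: E_X E_Y g E_idem sq_algebra[where n = n] flip: sq_algebra(3)[where n = n])
  note simps = E_X E_Y g E_idem EA sq_algebra[where n = n] cyclic_der_F_der cyclic_der_partial[OF assms]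
    rho_cyc_elem pad_mat_mult[of _ n] pad_mat_minus[of _ n] cb_arr
  show "cyclic_der (pad_mat P) (pad_mat Q) (F_der (Ax i)) = pad_mat ((Q * Y - X * P) * E i)"
    and "cyclic_der (pad_mat P) (pad_mat Q) (F_der (Ay i)) = pad_mat ((P * X - Y * Q) * E (i + 1))"
    using c by (simp_all add: simps)
  show "cyclic_der (pad_mat P) (pad_mat Q) (F_der Av) = 0\<^sub>m N N"
    and "cyclic_der (pad_mat P) (pad_mat Q) (F_der Aw) = 0\<^sub>m N N"
    using c by (simp_all add: cyclic_der_F_der cyclic_der_partial[OF assms] left_mult_zero_mat[of _ N N]
        right_mult_zero_mat[of _ N N])
qed

lemma cyclic_der_one_plus:
  assumes "graded_pair P Q"
  shows "cyclic_der (pad_mat P) (pad_mat Q) (dd_bimod (1 + arr (Ay i) * arr (Ax i)) (partial (Ax i)) 1)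
      = pad_mat ((1\<^sub>m n + Y * X) * P * E i)"
    and "cyclic_der (pad_mat P) (pad_mat Q) (dd_bimod (1 + arr (Ax i) * arr (Ay i)) (partial (Ay i)) 1)
      = pad_mat ((1\<^sub>m n + X * Y) * Q * E (i + 1))"
proof -
  have c: "P \<in> carrier_mat n n" "Q \<in> carrier_mat n n"
    and g: "E i * P = P * E (i - 1)" "E i * Q = Q * E (i + 1)" for i
    using assms by (auto simp: graded_pair_def)
  have EA: "E i * (X * A) = X * (E (i + 1) * A)" "E i * (Y * A) = Y * (E (i - 1) * A)"
    "E i * (P * A) = P * (E (i - 1) * A)" "E i * (Q * A) = Q * (E (i + 1) * A)" "E i * (E i * A) = E i * A"
    if "A \<in> carrier_mat n n" for i A
    using that c by (simp_all add: E_X E_Y g E_idem sq_algebra[where n = n] flip: sq_algebra(3)[where n = n])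
  note simps = E_X E_Y g E_idem EA sq_algebra[where n = n] cyclic_der_dd_bimod cyclic_der_partial[OF assms]
    add one sq_algebra[where n = N] mult
    rho_cyc_elem pad_mat_mult[of _ n] pad_mat_add[of _ n] cb_arr
  show "cyclic_der (pad_mat P) (pad_mat Q) (dd_bimod (1 + arr (Ay i) * arr (Ax i)) (partial (Ax i)) 1)
      = pad_mat ((1\<^sub>m n + Y * X) * P * E i)"
    and "cyclic_der (pad_mat P) (pad_mat Q) (dd_bimod (1 + arr (Ax i) * arr (Ay i)) (partial (Ay i)) 1)
      = pad_mat ((1\<^sub>m n + X * Y) * Q * E (i + 1))"
    using c by (simp_all add: simps)
qed

text \<open>Among the cyclic arrows with tail \<open>i + 1\<close>, the only comparable ones are
  \<open>Ay i\<close> and \<open>Ax (i + 1)\<close>. All other comparable pairs involve v, where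
  \<open>f\<close> vanishes by assumption.\<close>

lemma sum_arrow_less:
  fixes f :: "'m mod_ring arrow \<Rightarrow> 'm mod_ring arrow \<Rightarrow> complex"
  assumes "\<And>c. f c Av = 0" "\<And>c. f c Aw = 0" "\<And>c. f Av c = 0" "\<And>c. f Aw c = 0"
  shows "(\<Sum>(c, d)\<in>{(c, d). arrow_less c d}. f c d) = (\<Sum>i\<in>UNIV. f (Ay i) (Ax (i + 1)))"
proof -
  let ?T = "range (\<lambda>i :: 'm mod_ring. (Ay i, Ax (i + 1)))"
  have "(\<Sum>(c, d)\<in>{(c, d). arrow_less c d}. f c d) = (\<Sum>(c, d)\<in>?T. f c d)"
  proof (rule sum.mono_neutral_right)
    show "finite {(c, d :: 'm mod_ring arrow). arrow_less c d}"
      by (rule finite_subset[OF _ finite_cartesian_product[OF finite_UNIV_arrow finite_UNIV_arrow]]) auto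
    show "\<forall>p\<in>{(c, d). arrow_less c d} - ?T. (case p of (c, d) \<Rightarrow> f c d) = 0"
    proof clarify
      fix c d :: "'m mod_ring arrow"
      assume cd: "arrow_less c d" "(c, d) \<notin> ?T"
      show "f c d = 0"
        using cd by (cases c; cases d) (auto simp: arrow_less_def assms)
    qed
  qed (auto simp: arrow_less_def)
  also have "\<dots> = (\<Sum>i\<in>UNIV. f (Ay i) (Ax (i + 1)))"
    by (subst sum.reindex) (auto simp: inj_def)
  finally show ?thesis .
qed

text \<open>The first four traces come from the terms with a factor 1 + a^* a, the last two from the
  ordered pairs of arrows at the vertices. The common factor 1/2 is cleared.\<close>

definition bracket_form :: "complex mat \<Rightarrow> complex mat \<Rightarrow> complex mat \<Rightarrow> complex mat \<Rightarrow> complex" where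
  "bracket_form P Q P' Q' =
     mtrace (Q' * ((1\<^sub>m n + Y * X) * P)) - mtrace (((1\<^sub>m n + Y * X) * P') * Q)
   - mtrace (P' * ((1\<^sub>m n + X * Y) * Q)) + mtrace (((1\<^sub>m n + X * Y) * Q') * P)
   - mtrace ((Q' * Y - X * P') * (P * X - Y * Q)) + mtrace ((P' * X - Y * Q') * (Q * Y - X * P))"

lemma pairing_double_bracket_graded:
  assumes "graded_pair P Q" "graded_pair P' Q'"
  shows "2 * pairing (pad_mat P) (pad_mat Q) (pad_mat P') (pad_mat Q') double_bracket
    = bracket_form P Q P' Q'"
proof -
  have c: "P \<in> carrier_mat n n" "Q \<in> carrier_mat n n" "P' \<in> carrier_mat n n" "Q' \<in> carrier_mat n n"
    and g: "E i * P = P * E (i - 1)" "E i * Q = Q * E (i + 1)"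
      "E i * P' = P' * E (i - 1)" "E i * Q' = Q' * E (i + 1)" for i
    using assms by (auto simp: graded_pair_def)
  let ?p = "pairing (pad_mat P) (pad_mat Q) (pad_mat P') (pad_mat Q')"
  let ?D = "cyclic_der (pad_mat P) (pad_mat Q)" and ?D' = "cyclic_der (pad_mat P') (pad_mat Q')"
  have pc: "pad_mat P \<in> carrier_mat N N" "pad_mat Q \<in> carrier_mat N N"
    "pad_mat P' \<in> carrier_mat N N" "pad_mat Q' \<in> carrier_mat N N"
    using c by simp_all
  note dbr = pairing_dbr_prod[OF pc]
  have zero: "mtrace (0\<^sub>m N N * A) = 0" "mtrace (A * 0\<^sub>m N N) = 0" if "A \<in> carrier_mat N N" for A
    using that by (simp_all add: left_mult_zero_mat[of _ N N] right_mult_zero_mat[of _ N N])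
  have tr: "mtrace (pad_mat A * pad_mat B) = mtrace (A * B)"
    if "A \<in> carrier_mat n n" "B \<in> carrier_mat n n" for A B
    using that by (simp add: pad_mat_mult[of _ n] mtrace_pad_mat[of _ n])
  have EA: "E i * (X * A) = X * (E (i + 1) * A)" "E i * (Y * A) = Y * (E (i - 1) * A)"
    "E i * (P * A) = P * (E (i - 1) * A)" "E i * (Q * A) = Q * (E (i + 1) * A)"
    "E i * (P' * A) = P' * (E (i - 1) * A)" "E i * (Q' * A) = Q' * (E (i + 1) * A)" "E i * (E i * A) = E i * A"
    if "A \<in> carrier_mat n n" for i A
    using that c by (simp_all add: E_X E_Y g E_idem sq_algebra[where n = n] flip: sq_algebra(3)[where n = n])
  note push = E_X E_Y g E_idem EA sq_algebra[where n = n]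
  let ?f = "\<lambda>c. dbr_prod (dd_bimod (1 + arr (opp c) * arr c) (partial c) 1) (partial (opp c))"
  have fx: "?p (?f (Ax i)) = mtrace ((Q' * ((1\<^sub>m n + Y * X) * P)) * E i)
      - mtrace ((((1\<^sub>m n + Y * X) * P') * Q) * E (i + 1))" for i
    using c
    by (simp add: dbr cyclic_der_one_plus[OF assms(1)] cyclic_der_one_plus[OF assms(2)]
        cyclic_der_partial[OF assms(1)] cyclic_der_partial[OF assms(2)] tr) (simp add: push)
  have fy: "?p (?f (Ay i)) = mtrace ((P' * ((1\<^sub>m n + X * Y) * Q)) * E (i + 1))
      - mtrace ((((1\<^sub>m n + X * Y) * Q') * P) * E i)" for i
    using c
    by (simp add: dbr cyclic_der_one_plus[OF assms(1)] cyclic_der_one_plus[OF assms(2)]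
        cyclic_der_partial[OF assms(1)] cyclic_der_partial[OF assms(2)] tr) (simp add: push)
  have fvw: "?p (?f Av) = 0" "?p (?f Aw) = 0"
    by (simp_all add: dbr cyclic_der_partial[OF assms(1)] cyclic_der_partial[OF assms(2)]
        cyclic_der_dd_bimod[OF pc(1,2)] cyclic_der_dd_bimod[OF pc(3,4)] zero)
  have F: "?p (dbr_prod (F_der (Ay i)) (F_der (Ax (i + 1))))
      = mtrace (((Q' * Y - X * P') * (P * X - Y * Q)) * E (i + 1))
      - mtrace (((P' * X - Y * Q') * (Q * Y - X * P)) * E (i + 1))" for i
  proof -
    \<comment> \<open>The two arrows share the vertex \<open>i + 1\<close>; naming it presents the
      idempotents through shifts of a single index.\<close>
    define k where "k = i + 1"
    show ?thesis
      using c
      by (simp add: dbr cyclic_der_F[OF assms(1)] cyclic_der_F[OF assms(2)] tr minus_carrier_mat[of _ n n])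
         (simp add: push minus_carrier_mat[of _ n n] flip: k_def)
  qed
  \<comment> \<open>The arrows of x enter with sign 1 and those of y with sign -1. Some traces carry
    the idempotent at \<open>i\<close>, others the one at \<open>i + 1\<close>; either kind sums to
    the full trace.\<close>
  have "(\<Sum>c\<in>UNIV. eps c * ?p (?f c))
      = mtrace (Q' * ((1\<^sub>m n + Y * X) * P)) - mtrace (((1\<^sub>m n + Y * X) * P') * Q)
      - mtrace (P' * ((1\<^sub>m n + X * Y) * Q)) + mtrace (((1\<^sub>m n + X * Y) * Q') * P)"
    unfolding sum_arrows fx fy fvw eps.simps
    using c by (simp add: sum_subtractf mtrace_decomp mtrace_decomp_shift sum_negf)
  moreover have "(\<Sum>(c, d)\<in>{(c, d). arrow_less c d}. ?p (dbr_prod (F_der c) (F_der d)))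
      = (\<Sum>i\<in>UNIV. ?p (dbr_prod (F_der (Ay i)) (F_der (Ax (i + 1)))))"
    by (rule sum_arrow_less)
       (simp_all add: dbr cyclic_der_F(3,4)[OF assms(1)] cyclic_der_F(3,4)[OF assms(2)] zero)
  moreover have "(\<Sum>i\<in>UNIV. ?p (dbr_prod (F_der (Ay i)) (F_der (Ax (i + 1)))))
      = mtrace ((Q' * Y - X * P') * (P * X - Y * Q)) - mtrace ((P' * X - Y * Q') * (Q * Y - X * P))"
    unfolding F using c by (simp add: sum_subtractf mtrace_decomp_shift minus_carrier_mat[of _ n n])
  ultimately show ?thesis
    unfolding pairing_double_bracket[OF pc] bracket_form_def by simp
qed

end

section \<open>Point derivations\<close>

context fun_algebra
begin

text \<open>A tangent vector at \<rho> in algebraic form. The bracket with a fixed function,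
  evaluated at \<rho>, is the instance that matters.\<close>

definition point_der :: "'p \<Rightarrow> (('p \<Rightarrow> complex) \<Rightarrow> complex) \<Rightarrow> bool" where
  "point_der \<rho> d \<longleftrightarrow> (\<forall>F\<in>\<O>. \<forall>G\<in>\<O>. d (\<lambda>\<rho>\<in>U. F \<rho> + G \<rho>) = d F + d G \<and>
     d (\<lambda>\<rho>\<in>U. F \<rho> * G \<rho>) = F \<rho> * d G + d F * G \<rho>) \<and> (\<forall>z. d (\<lambda>\<rho>\<in>U. z) = 0)"

definition mat_der :: "nat \<Rightarrow> (('p \<Rightarrow> complex) \<Rightarrow> complex) \<Rightarrow> ('p \<Rightarrow> complex mat) \<Rightarrow> complex mat" where
  "mat_der n d T = mat n n (\<lambda>(i, j). d (\<lambda>\<rho>\<in>U. T \<rho> $$ (i, j)))"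

lemma mat_der_carrier [simp]: "mat_der n d T \<in> carrier_mat n n"
  by (simp add: mat_der_def)

lemma point_der_add:
  assumes "point_der \<rho> d" "regular f" "regular g"
  shows "d (\<lambda>\<rho>\<in>U. f \<rho> + g \<rho>) = d (restrict f U) + d (restrict g U)"
proof -
  have "(\<lambda>\<rho>\<in>U. f \<rho> + g \<rho>) = (\<lambda>\<rho>\<in>U. restrict f U \<rho> + restrict g U \<rho>)"
    by (intro restrict_ext) simp
  then show ?thesis using assms unfolding point_der_def regular_def by metis
qed

lemma point_der_mult:
  assumes "point_der \<rho> d" "regular f" "regular g" "\<rho> \<in> U"
  shows "d (\<lambda>\<rho>\<in>U. f \<rho> * g \<rho>) = f \<rho> * d (restrict g U) + d (restrict f U) * g \<rho>"
proof -
  have "(\<lambda>\<rho>\<in>U. f \<rho> * g \<rho>) = (\<lambda>\<rho>\<in>U. restrict f U \<rho> * restrict g U \<rho>)"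
    by (intro restrict_ext) simp
  then have "d (\<lambda>\<rho>\<in>U. f \<rho> * g \<rho>)
    = restrict f U \<rho> * d (restrict g U) + d (restrict f U) * restrict g U \<rho>"
    using assms(1-3) unfolding point_der_def regular_def by metis
  then show ?thesis using assms(4) by simp
qed

lemma point_der_const: "point_der \<rho> d \<Longrightarrow> d (\<lambda>\<rho>\<in>U. z) = 0"
  by (simp add: point_der_def)

lemma point_der_sum:
  assumes "point_der \<rho> d" "\<And>i. i \<in> A \<Longrightarrow> regular (f i)"
  shows "d (\<lambda>\<rho>\<in>U. \<Sum>i\<in>A. f i \<rho>) = (\<Sum>i\<in>A. d (restrict (f i) U))"
  using assms(2)
proof (induction A rule: infinite_finite_induct)
  case (insert i A)
  have "d (\<lambda>\<rho>\<in>U. f i \<rho> + (\<Sum>i\<in>A. f i \<rho>)) = d (restrict (f i) U) + d (\<lambda>\<rho>\<in>U. \<Sum>i\<in>A. f i \<rho>)"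
    using insert.prems by (intro point_der_add[OF assms(1)] regular_sum) auto
  also have "\<dots> = d (restrict (f i) U) + (\<Sum>i\<in>A. d (restrict (f i) U))"
    by (simp only: insert.IH[OF insert.prems[OF insertI2]])
  finally show ?case by (simp only: sum.insert[OF insert.hyps])
qed (simp_all add: point_der_const[OF assms(1)])

lemma mat_der_cong: "(\<And>\<rho>. \<rho> \<in> U \<Longrightarrow> S \<rho> = T \<rho>) \<Longrightarrow> mat_der n d S = mat_der n d T"
  unfolding mat_der_def by (metis (no_types, lifting) restrict_ext)

lemma mat_der_const: "point_der \<rho> d \<Longrightarrow> mat_der n d (\<lambda>_. A) = 0\<^sub>m n n"
  by (rule eq_matI) (simp_all add: mat_der_def point_der_const)

lemma mat_der_add:
  assumes "point_der \<rho> d" "regular_mat n S" "regular_mat n T"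
  shows "mat_der n d (\<lambda>\<rho>. S \<rho> + T \<rho>) = mat_der n d S + mat_der n d T"
proof (rule eq_matI)
  fix i j assume "i < dim_row (mat_der n d S + mat_der n d T)" "j < dim_col (mat_der n d S + mat_der n d T)"
  then have ij: "i < n" "j < n" by (simp_all add: mat_der_def)
  have "(\<lambda>\<rho>\<in>U. (S \<rho> + T \<rho>) $$ (i, j)) = (\<lambda>\<rho>\<in>U. S \<rho> $$ (i, j) + T \<rho> $$ (i, j))"
    using ij assms(2,3)[THEN regular_matD(1)] by (intro restrict_ext) (simp add: carrier_matD[of _ n n])
  then show "mat_der n d (\<lambda>\<rho>. S \<rho> + T \<rho>) $$ (i, j) = (mat_der n d S + mat_der n d T) $$ (i, j)"
    using ij point_der_add[OF assms(1) regular_matD(2)[OF assms(2) ij] regular_matD(2)[OF assms(3) ij]]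
    by (simp add: mat_der_def)
qed (simp_all add: mat_der_def)

lemma mat_der_mult:
  assumes d: "point_der \<rho> d" and \<rho>: "\<rho> \<in> U" and ST: "regular_mat n S" "regular_mat n T"
  shows "mat_der n d (\<lambda>\<rho>. S \<rho> * T \<rho>) = S \<rho> * mat_der n d T + mat_der n d S * T \<rho>"
proof (rule eq_matI)
  have c: "S \<rho> \<in> carrier_mat n n" "T \<rho> \<in> carrier_mat n n"
    using ST \<rho> by (auto simp: regular_mat_def)
  let ?R = "S \<rho> * mat_der n d T + mat_der n d S * T \<rho>"
  show "dim_row (mat_der n d (\<lambda>\<rho>. S \<rho> * T \<rho>)) = dim_row ?R" "dim_col (mat_der n d (\<lambda>\<rho>. S \<rho> * T \<rho>)) = dim_col ?R"
    using c by (simp_all add: mat_der_def)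
  fix i j assume "i < dim_row ?R" "j < dim_col ?R"
  then have ij: "i < n" "j < n" using c by (simp_all add: mat_der_def)
  have "(\<lambda>\<rho>\<in>U. (S \<rho> * T \<rho>) $$ (i, j)) = (\<lambda>\<rho>\<in>U. \<Sum>k<n. S \<rho> $$ (i, k) * T \<rho> $$ (k, j))"
    using ij ST[THEN regular_matD(1)] by (intro restrict_ext index_mult_sq[of _ n])
  then have "mat_der n d (\<lambda>\<rho>. S \<rho> * T \<rho>) $$ (i, j)
      = (\<Sum>k<n. d (\<lambda>\<rho>\<in>U. S \<rho> $$ (i, k) * T \<rho> $$ (k, j)))"
    using ij ST
    by (simp add: mat_der_def)
       (intro point_der_sum[OF d] regular_mult regular_matD(2); simp)
  also have "\<dots> = (\<Sum>k<n. S \<rho> $$ (i, k) * mat_der n d T $$ (k, j) + mat_der n d S $$ (i, k) * T \<rho> $$ (k, j))"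
    using ij ST \<rho>
    by (intro sum.cong HOL.refl)
       (subst point_der_mult[OF d], simp_all add: regular_matD(2) mat_der_def)
  also have "\<dots> = ?R $$ (i, j)"
    using c ij carrier_matD[OF c(1)] carrier_matD[OF c(2)]
    by (subst index_add_mat) (simp_all add: index_mult_sq[of _ n] sum.distrib mat_der_def del: index_mult_mat(1))
  finally show "mat_der n d (\<lambda>\<rho>. S \<rho> * T \<rho>) $$ (i, j) = ?R $$ (i, j)" .
qed

lemma point_der_mtrace:
  assumes d: "point_der \<rho> d" and T: "regular_mat n T"
  shows "d (\<lambda>\<rho>\<in>U. mtrace (T \<rho>)) = mtrace (mat_der n d T)"
proof -
  have "(\<lambda>\<rho>\<in>U. mtrace (T \<rho>)) = (\<lambda>\<rho>\<in>U. \<Sum>i<n. T \<rho> $$ (i, i))"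
    using regular_matD(1)[OF T] by (intro restrict_ext) (auto simp: mtrace_def)
  then have "d (\<lambda>\<rho>\<in>U. mtrace (T \<rho>)) = (\<Sum>i<n. d (\<lambda>\<rho>\<in>U. T \<rho> $$ (i, i)))"
    using T by (simp only:) (intro point_der_sum[OF d] regular_matD(2); simp)
  then show ?thesis by (simp add: mtrace_def mat_der_def)
qed

text \<open>By the Leibniz rule the derivative of T^k is a sum of terms T^i dT T^(k-1-i), all of
  which have the same trace.\<close>

lemma point_der_mtrace_pow:
  assumes d: "point_der \<rho> d" and \<rho>: "\<rho> \<in> U" and T: "regular_mat n T"
  shows "d (\<lambda>\<rho>\<in>U. mtrace (T \<rho> ^\<^sub>m k)) = of_nat k * mtrace (T \<rho> ^\<^sub>m (k - 1) * mat_der n d T)"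
proof -
  have c: "T \<rho> \<in> carrier_mat n n" using T \<rho> by (simp add: regular_mat_def)
  let ?D = "mat_der n d T"
  \<comment> \<open>The factor \<open>A\<close> strengthens the induction: rotating the last factor
    \<open>T \<rho>\<close> to the front changes \<open>A\<close> to \<open>T \<rho> * A\<close>,
    which still commutes with \<open>T \<rho>\<close>. At \<open>k = 0\<close> the truncated
    exponent is harmless, since its coefficient is 0.\<close>
  have "mtrace (A * mat_der n d (\<lambda>\<rho>. T \<rho> ^\<^sub>m k)) = of_nat k * mtrace (A * (T \<rho> ^\<^sub>m (k - 1) * ?D))"
    if "A \<in> carrier_mat n n" "A * T \<rho> = T \<rho> * A" for A
    using that
  proof (induction k arbitrary: A)
    case 0
    have "mat_der n d (\<lambda>\<rho>. T \<rho> ^\<^sub>m 0) = mat_der n d (\<lambda>_. 1\<^sub>m n)"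
      using T by (intro mat_der_cong) (auto simp: regular_mat_def)
    then show ?case using 0 c by (simp add: mat_der_const[OF d])
  next
    case (Suc k)
    have p: "T \<rho> ^\<^sub>m k \<in> carrier_mat n n" "T \<rho> ^\<^sub>m (k - 1) \<in> carrier_mat n n" using c by simp_all
    have eq: "mat_der n d (\<lambda>\<rho>. T \<rho> ^\<^sub>m Suc k) = T \<rho> ^\<^sub>m k * ?D + mat_der n d (\<lambda>\<rho>. T \<rho> ^\<^sub>m k) * T \<rho>"
      unfolding pow_mat.simps by (intro mat_der_mult[OF d \<rho>] regular_mat_pow T)
    let ?Dk = "mat_der n d (\<lambda>\<rho>. T \<rho> ^\<^sub>m k)"
    have TA: "T \<rho> * A \<in> carrier_mat n n" "(T \<rho> * A) * T \<rho> = T \<rho> * (T \<rho> * A)"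
      using Suc.prems c by (simp_all add: sq_algebra[where n = n])
    have "mtrace (A * (?Dk * T \<rho>)) = mtrace ((T \<rho> * A) * ?Dk)"
      using mtrace_comm[of "A * ?Dk" n "T \<rho>"] Suc.prems c by (simp add: sq_algebra[where n = n])
    also have "\<dots> = of_nat k * mtrace ((T \<rho> * A) * (T \<rho> ^\<^sub>m (k - 1) * ?D))"
      by (rule Suc.IH[OF TA])
    also have "\<dots> = of_nat k * mtrace (A * (T \<rho> ^\<^sub>m k * ?D))"
    proof (cases k)
      case (Suc l)
      have "(T \<rho> * A) * (T \<rho> ^\<^sub>m l * ?D) = A * ((T \<rho> * T \<rho> ^\<^sub>m l) * ?D)"
        using Suc.prems c \<open>A * T \<rho> = T \<rho> * A\<close>[symmetric] \<open>A \<in> carrier_mat n n\<close>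
        by (simp add: sq_algebra[where n = n])
      then show ?thesis using Suc pow_mat_comm[OF c c HOL.refl, of l] by simp
    qed simp
    finally have "mtrace (A * (?Dk * T \<rho>)) = of_nat k * mtrace (A * (T \<rho> ^\<^sub>m k * ?D))" .
    then show ?case
      unfolding eq using Suc.prems p c
      by (simp add: sq_algebra[where n = n] mtrace_add[of _ n] algebra_simps)
  qed
  from this[of "1\<^sub>m n"] show ?thesis
    using c by (simp add: point_der_mtrace[OF d regular_mat_pow[OF T]] sq_algebra[where n = n])
qed

text \<open>Differentiate S T = 1 and multiply by \<open>T \<rho>\<close> on the left. The identity
  is required on all of \<open>U\<close>, because a derivation at \<rho> sees more of a function
  than its value there.\<close>

lemma mat_der_inverse:
  assumes d: "point_der \<rho> d" and \<rho>: "\<rho> \<in> U" and ST: "regular_mat n S" "regular_mat n T"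
    and inv: "\<And>\<rho>. \<rho> \<in> U \<Longrightarrow> S \<rho> * T \<rho> = 1\<^sub>m n"
  shows "mat_der n d T = - (T \<rho> * mat_der n d S * T \<rho>)"
proof -
  have c: "S \<rho> \<in> carrier_mat n n" "T \<rho> \<in> carrier_mat n n"
    using ST \<rho> by (auto simp: regular_mat_def)
  have TS: "T \<rho> * S \<rho> = 1\<^sub>m n" by (rule mat_mult_left_right_inverse[OF c inv[OF \<rho>]])
  let ?A = "T \<rho> * mat_der n d S * T \<rho>"
  have "S \<rho> * mat_der n d T + mat_der n d S * T \<rho> = mat_der n d (\<lambda>\<rho>. S \<rho> * T \<rho>)"
    by (rule mat_der_mult[OF d \<rho> ST, symmetric])
  also have "\<dots> = mat_der n d (\<lambda>_. 1\<^sub>m n)"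
    by (rule mat_der_cong) (rule inv)
  also have "\<dots> = 0\<^sub>m n n" by (rule mat_der_const[OF d])
  finally have "T \<rho> * (S \<rho> * mat_der n d T + mat_der n d S * T \<rho>) = T \<rho> * 0\<^sub>m n n" by simp
  then have "(T \<rho> * S \<rho>) * mat_der n d T + ?A = 0\<^sub>m n n"
    using c by (simp add: sq_algebra[where n = n])
  then have z: "mat_der n d T + ?A = 0\<^sub>m n n"
    by (simp add: TS sq_algebra[where n = n])
  show ?thesis
  proof (rule eq_matI)
    fix i j assume "i < dim_row (- ?A)" "j < dim_col (- ?A)"
    then have ij: "i < n" "j < n" "i < dim_row ?A" "j < dim_col ?A" using c by simp_all
    have "(mat_der n d T + ?A) $$ (i, j) = 0"
      unfolding z using ij(1,2) by simp
    then show "mat_der n d T $$ (i, j) = (- ?A) $$ (i, j)"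
      using ij by (simp add: add_eq_0_iff2 del: index_mult_mat)
  qed (use c in \<open>simp_all add: mat_der_def\<close>)
qed

end

section \<open>Homogeneous matrices and vanishing of the bracket form\<close>

context representation
begin

lemma pad_mat_index_last:
  assumes "A \<in> carrier_mat n n"
  shows "r < N \<Longrightarrow> pad_mat A $$ (r, n) = 0" "r < N \<Longrightarrow> pad_mat A $$ (n, r) = 0"
    "r < n \<Longrightarrow> s < n \<Longrightarrow> pad_mat A $$ (r, s) = A $$ (r, s)"
  using assms by (simp_all add: pad_mat_index[of A n])

text \<open>The zero row and column remove the index of \<infinity> from all four sums. Their order
  matches the later use of the chain rule, with \<open>P'\<close> outside and \<open>P\<close>
  inside.\<close>

lemma contr_pad_mat:
  assumes "P \<in> carrier_mat n n" "P' \<in> carrier_mat n n"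
  shows "contr (pad_mat P) (pad_mat P') u
    = (\<Sum>l<n. \<Sum>k<n. P' $$ (l, k) * (\<Sum>j<n. \<Sum>i<n. P $$ (j, i) * tens_entry \<rho> u (k, j) (i, l)))"
proof -
  have "contr (pad_mat P) (pad_mat P') u
    = (\<Sum>k<n. \<Sum>l<n. \<Sum>i<n. \<Sum>j<n. P $$ (j, i) * P' $$ (l, k) * tens_entry \<rho> u (k, j) (i, l))"
    unfolding contr_def
    by (simp add: pad_mat_index_last[OF assms(1)] pad_mat_index_last[OF assms(2)])
  also have "\<dots> = (\<Sum>l<n. \<Sum>k<n. \<Sum>j<n. \<Sum>i<n. P $$ (j, i) * P' $$ (l, k) * tens_entry \<rho> u (k, j) (i, l))"
    by (subst sum.swap) (intro sum.cong HOL.refl sum.swap)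
  finally show ?thesis by (simp add: sum_distrib_left mult_ac)
qed

text \<open>Degree \<delta> for the grading by Z/m: only the blocks in positions (\<open>i\<close>,
  \<open>i + \<delta>\<close>) can be nonzero.\<close>

definition homog :: "'m mod_ring \<Rightarrow> complex mat \<Rightarrow> bool" where
  "homog \<delta> A \<longleftrightarrow> A \<in> carrier_mat n n \<and> (\<forall>i. E i * A = A * E (i + \<delta>))"

lemma graded_pairI: "homog (- 1) P \<Longrightarrow> homog 1 Q \<Longrightarrow> graded_pair P Q"
  by (auto simp: graded_pair_def homog_def)

lemma homog_X: "homog 1 X"
  by (simp add: homog_def E_X)

lemma homog_Y: "homog (- 1) Y"
  by (simp add: homog_def E_Y)

lemma homog_one: "homog 0 (1\<^sub>m n)"
  by (simp add: homog_def sq_algebra[where n = n])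

lemma homog_zero: "homog \<delta> (0\<^sub>m n n)"
  by (simp add: homog_def left_mult_zero_mat[of _ n n] right_mult_zero_mat[of _ n n])

lemma homog_smult: "homog \<delta> A \<Longrightarrow> homog \<delta> (c \<cdot>\<^sub>m A)"
  by (simp add: homog_def sq_algebra[where n = n])

lemma homog_uminus: "homog \<delta> A \<Longrightarrow> homog \<delta> (- A)"
  by (simp add: homog_def sq_algebra[where n = n])

lemma homog_add: "homog \<delta> A \<Longrightarrow> homog \<delta> B \<Longrightarrow> homog \<delta> (A + B)"
  by (simp add: homog_def sq_algebra[where n = n])

lemma homog_mult:
  assumes "homog \<delta> A" "homog \<epsilon> B"
  shows "homog (\<delta> + \<epsilon>) (A * B)"
proof -
  have c: "A \<in> carrier_mat n n" "B \<in> carrier_mat n n"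
    and h: "E i * A = A * E (i + \<delta>)" "E i * B = B * E (i + \<epsilon>)" for i
    using assms by (auto simp: homog_def)
  have "E i * (A * B) = (A * B) * E (i + (\<delta> + \<epsilon>))" for i
  proof -
    have "E i * (A * B) = (E i * A) * B" using c by (simp add: sq_algebra[where n = n])
    also have "\<dots> = A * (E (i + \<delta>) * B)" unfolding h(1) using c by (simp add: sq_algebra[where n = n])
    also have "\<dots> = (A * B) * E (i + \<delta> + \<epsilon>)" unfolding h(2) using c by (simp add: sq_algebra[where n = n])
    finally show ?thesis by (simp only: add.assoc)
  qed
  then show ?thesis using c by (simp add: homog_def)
qed

lemma homog_pow: "homog \<delta> A \<Longrightarrow> homog (of_nat k * \<delta>) (A ^\<^sub>m k)"
proof (induction k)
  case 0
  then have "A ^\<^sub>m 0 = 1\<^sub>m n" by (auto simp: homog_def)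
  then show ?case using homog_one by simp
next
  case (Suc k)
  then show ?case using homog_mult[of "of_nat k * \<delta>" "A ^\<^sub>m k" \<delta> A] by (simp add: algebra_simps)
qed

lemma homog_inverse:
  assumes "homog \<delta> A" "B \<in> carrier_mat n n" "A * B = 1\<^sub>m n"
  shows "homog (- \<delta>) B"
proof -
  have A: "A \<in> carrier_mat n n" and h: "E i * A = A * E (i + \<delta>)" for i
    using assms(1) by (auto simp: homog_def)
  have BA: "B * A = 1\<^sub>m n" by (rule mat_mult_left_right_inverse[OF A assms(2,3)])
  have "E i * B = B * E (i + - \<delta>)" for i
  proof -
    have "E i * B = (B * A) * E (i + - \<delta> + \<delta>) * B"
      using assms(2) by (simp add: BA sq_algebra[where n = n])
    also have "\<dots> = B * (A * E (i + - \<delta> + \<delta>)) * B"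
      using A assms(2) by (simp add: sq_algebra[where n = n])
    also have "\<dots> = B * E (i + - \<delta>) * (A * B)"
      unfolding h[symmetric] using A assms(2) by (simp add: sq_algebra[where n = n])
    finally show ?thesis using assms(2) by (simp add: assms(3) sq_algebra[where n = n])
  qed
  then show ?thesis using assms(2) by (simp add: homog_def)
qed

text \<open>When \<open>Q\<close> and \<open>Q'\<close> are zero only the last two terms survive,
  tr(X P' P X) and -tr(P' X X P); they cancel since X, P and P' commute.\<close>

lemma bracket_form_X:
  assumes P: "P \<in> carrier_mat n n" "P' \<in> carrier_mat n n"
    and comm: "P * X = X * P" "P' * X = X * P'" "P' * P = P * P'"
  shows "bracket_form P (0\<^sub>m n n) P' (0\<^sub>m n n) = 0"
proof -
  have z: "A * 0\<^sub>m n n = 0\<^sub>m n n" "0\<^sub>m n n * A = 0\<^sub>m n n" "A - 0\<^sub>m n n = A" "0\<^sub>m n n - A = - A"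
    if "A \<in> carrier_mat n n" for A :: "complex mat"
    using that carrier_matD[OF that] by (auto intro!: eq_matI)
  have "(X * P') * (P * X) = (P' * X) * (X * P)"
    using P
    by (simp add: sq_algebra[where n = n] comm sq_left_commute[OF comm(1), where n = n] sq_left_commute[OF comm(2), where n = n]
        sq_left_commute[OF comm(3), where n = n])
  then show ?thesis
    using P by (simp add: bracket_form_def z sq_algebra(8,9)[where n = n] mtrace_uminus[of _ n] carrier_matD[OF cb_carrier])
qed

text \<open>The mirror image of the cancellation for X: what remains is tr(Q' Y Y Q) - tr(Y Q' Q
  Y).\<close>

lemma bracket_form_Y:
  assumes Q: "Q \<in> carrier_mat n n" "Q' \<in> carrier_mat n n"
    and comm: "Q * Y = Y * Q" "Q' * Y = Y * Q'" "Q' * Q = Q * Q'"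
  shows "bracket_form (0\<^sub>m n n) Q (0\<^sub>m n n) Q' = 0"
proof -
  have z: "A * 0\<^sub>m n n = 0\<^sub>m n n" "0\<^sub>m n n * A = 0\<^sub>m n n" "A - 0\<^sub>m n n = A" "0\<^sub>m n n - A = - A"
    if "A \<in> carrier_mat n n" for A :: "complex mat"
    using that carrier_matD[OF that] by (auto intro!: eq_matI)
  have "(Q' * Y) * (Y * Q) = (Y * Q') * (Q * Y)"
    using Q
    by (simp add: sq_algebra[where n = n] comm sq_left_commute[OF comm(1), where n = n] sq_left_commute[OF comm(2), where n = n]
        sq_left_commute[OF comm(3), where n = n])
  then show ?thesis
    using Q by (simp add: bracket_form_def z sq_algebra(8,9)[where n = n] mtrace_uminus[of _ n] carrier_matD[OF cb_carrier])
qed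

text \<open>Here QY - XP = S XY - XY S is zero, and likewise for the primed matrices, so both
  quadratic terms vanish. After rotation the other four cancel in pairs, as exchanging S and S' does
  not change the products.\<close>

lemma bracket_form_XY:
  assumes S: "S \<in> carrier_mat n n" "S' \<in> carrier_mat n n"
    and comm: "(X * Y) * S = S * (X * Y)" "(X * Y) * S' = S' * (X * Y)" "S' * S = S * S'"
  shows "bracket_form (Y * S) (S * X) (Y * S') (S' * X) = 0"
proof -
  define D where "D = X * Y"
  have D: "D \<in> carrier_mat n n" by (simp add: D_def)
  have DA: "X * (Y * A) = D * A" if "A \<in> carrier_mat n n" for A
    using that by (simp add: D_def sq_algebra[where n = n])
  have c: "D * S = S * D" "D * S' = S' * D" "S' * S = S * S'"
    using comm by (simp_all add: D_def)
  have cA: "D * (S * A) = S * (D * A)" "D * (S' * A) = S' * (D * A)" "S' * (S * A) = S * (S' * A)"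
    if "A \<in> carrier_mat n n" for A
    using S D that by (simp_all only: sq_left_commute[OF c(1), where n = n] sq_left_commute[OF c(2), where n = n] sq_left_commute[OF c(3), where n = n])
  note simps = S D DA c cA sq_algebra[where n = n] D_def[symmetric]
  have zero: "S * X * Y - X * (Y * S) = 0\<^sub>m n n" "S' * X * Y - X * (Y * S') = 0\<^sub>m n n"
    by (simp_all add: simps)
  have t2: "mtrace (((1\<^sub>m n + Y * X) * (Y * S')) * (S * X)) = mtrace ((S * X) * ((1\<^sub>m n + Y * X) * (Y * S')))"
    using S by (intro mtrace_comm[of _ n]) simp_all
  have t3: "mtrace ((Y * S') * ((1\<^sub>m n + X * Y) * (S * X))) = mtrace (((1\<^sub>m n + X * Y) * (S * X)) * (Y * S'))"
    using S by (intro mtrace_comm[of _ n]) simp_all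
  have "mtrace ((S' * X) * ((1\<^sub>m n + Y * X) * (Y * S))) = mtrace ((S * X) * ((1\<^sub>m n + Y * X) * (Y * S')))"
    by (simp add: simps)
  moreover have "mtrace (((1\<^sub>m n + X * Y) * (S' * X)) * (Y * S)) = mtrace (((1\<^sub>m n + X * Y) * (S * X)) * (Y * S'))"
    by (simp add: simps)
  ultimately show ?thesis
    unfolding bracket_form_def t2 t3 zero
    using S by (simp add: left_mult_zero_mat[of _ n n] right_mult_zero_mat[of _ n n] minus_carrier_mat[of _ n n])
qed

text \<open>In terms of Z = Y + V everything simplifies: 1 + YX = ZX, 1 + XY = XZ, QY - XP = SZ and
  PX - YQ = -ZS. The last two traces then involve only Z, S and S', which commute as far as
  needed.\<close>

lemma bracket_form_Y_plus_inverse: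
  assumes S: "S \<in> carrier_mat n n" "S' \<in> carrier_mat n n"
    and V: "V \<in> carrier_mat n n" "X * V = 1\<^sub>m n" "V * X = 1\<^sub>m n"
    and comm: "(Y + V) * S = S * (Y + V)" "(Y + V) * S' = S' * (Y + V)" "S' * S = S * S'"
  shows "bracket_form (- (V * (S * V))) S (- (V * (S' * V))) S' = 0"
proof -
  define Z where "Z = Y + V"
  have Z: "Z \<in> carrier_mat n n" using V by (simp add: Z_def)
  have Y: "Y = Z - V" unfolding Z_def using V carrier_matD[OF cb_carrier[of y_elem]] by (auto intro!: eq_matI)
  have X: "X \<in> carrier_mat n n" by simp
  have VA: "X * (V * A) = A" "V * (X * A) = A" if "A \<in> carrier_mat n n" for A
    using that V by (simp_all add: sq_algebra(1)[where n = n] flip: sq_algebra(3)[where n = n])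
  have cZ: "Z * S = S * Z" "Z * S' = S' * Z" using comm by (simp_all add: Z_def)
  have cA: "Z * (S * A) = S * (Z * A)" "Z * (S' * A) = S' * (Z * A)" "S' * (S * A) = S * (S' * A)"
    if "A \<in> carrier_mat n n" for A
    using S Z that by (simp_all only: sq_left_commute[OF cZ(1), where n = n] sq_left_commute[OF cZ(2), where n = n] sq_left_commute[OF comm(3), where n = n])
  have cancel: "A + (B - A) = B" "B - A + A = B" "A - (A + B) = - B" "- A - (B - A) = - B" "A - B - - B = A"
    if "A \<in> carrier_mat n n" "B \<in> carrier_mat n n" for A B :: "complex mat"
    using that by (auto intro!: eq_matI)
  note simps = S Z V VA sq_algebra[where n = n] minus_carrier_mat[of _ n n] cancel
  have YX: "1\<^sub>m n + Y * X = Z * X" "1\<^sub>m n + X * Y = X * Z"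
    unfolding Y by (simp_all add: simps)
  have PX: "- (V * (T * V)) * X - Y * T = - (Z * T)" "T * Y - X * (- (V * (T * V))) = T * Z"
    if "T \<in> carrier_mat n n" for T
    unfolding Y using that by (simp_all add: simps)
  have tr: "mtrace (A * B) = mtrace (B * A)" if "A \<in> carrier_mat n n" "B \<in> carrier_mat n n" for A B
    using that by (rule mtrace_comm)
  \<comment> \<open>The first four traces form two pairs: \<open>1\<close> and \<open>3\<close> both
    equal -tr(S' Z S V), while \<open>2\<close> and \<open>4\<close> both equal -tr(S Z S' V).
    Within each pair they enter the form with opposite signs.\<close>
  have 1: "mtrace (S' * (Z * X * (- (V * (S * V))))) = - mtrace ((S' * (Z * S)) * V)"
    by (simp add: simps mtrace_uminus[of _ n])
  have 2: "mtrace ((Z * X * (- (V * (S' * V)))) * S) = - mtrace ((S * (Z * S')) * V)"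
  proof -
    have "mtrace ((Z * X * (- (V * (S' * V)))) * S) = mtrace (S * (Z * X * (- (V * (S' * V)))))"
      using S Z V by (intro mtrace_comm[of _ n]) simp_all
    then show ?thesis by (simp add: simps mtrace_uminus[of _ n])
  qed
  have 3: "mtrace ((- (V * (S' * V))) * (X * Z * S)) = - mtrace ((S' * (Z * S)) * V)"
  proof -
    have "mtrace ((- (V * (S' * V))) * (X * Z * S)) = - mtrace (V * (S' * (Z * S)))"
      by (simp add: simps mtrace_uminus[of _ n])
    also have "mtrace (V * (S' * (Z * S))) = mtrace ((S' * (Z * S)) * V)"
      using S Z V by (intro mtrace_comm[of _ n]) simp_all
    finally show ?thesis .
  qed
  have 4: "mtrace ((X * Z * S') * (- (V * (S * V)))) = - mtrace ((S * (Z * S')) * V)"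
  proof -
    have "mtrace ((X * Z * S') * (- (V * (S * V)))) = mtrace ((- (V * (S * V))) * (X * Z * S'))"
      using S Z V by (intro mtrace_comm[of _ n]) simp_all
    also have "\<dots> = - mtrace (V * (S * (Z * S')))"
      by (simp add: simps mtrace_uminus[of _ n])
    also have "mtrace (V * (S * (Z * S'))) = mtrace ((S * (Z * S')) * V)"
      using S Z V by (intro mtrace_comm[of _ n]) simp_all
    finally show ?thesis .
  qed
  have 5: "(S' * Z) * (- (Z * S)) = (- (Z * S')) * (S * Z)"
    by (simp add: simps cZ cA comm(3))
  have 6: "S' * (Z * S) = S * (Z * S')"
    by (simp add: simps cZ cA comm(3))
  show ?thesis
    unfolding bracket_form_def YX PX[OF S(1)] PX[OF S(2)] 1 2 3 4 5 6 by simp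
qed

end

context rep_space
begin

abbreviation dc :: nat where "dc \<equiv> dim_cyc \<alpha>"

abbreviation Xf :: "'m rep \<Rightarrow> complex mat" where "Xf \<equiv> \<lambda>\<rho>. cyc_block \<alpha> (\<rho> x_elem)"
abbreviation Yf :: "'m rep \<Rightarrow> complex mat" where "Yf \<equiv> \<lambda>\<rho>. cyc_block \<alpha> (\<rho> y_elem)"

text \<open>\<open>P\<close> and \<open>Q\<close> are the gradients of \<open>F\<close> at \<open>\<rho>\<close> with respect to \<open>X\<close> and \<open>Y\<close>:
  \<open>dF = tr (P dX) + tr (Q dY)\<close>.\<close>

definition gradient :: "'m rep \<Rightarrow> ('m rep \<Rightarrow> complex) \<Rightarrow> complex mat \<Rightarrow> complex mat \<Rightarrow> bool" where
  "gradient \<rho> F P Q \<longleftrightarrow> P \<in> carrier_mat dc dc \<and> Q \<in> carrier_mat dc dc \<and>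
     (\<forall>d. point_der \<rho> d \<longrightarrow> d F = mtrace (P * mat_der dc d Xf) + mtrace (Q * mat_der dc d Yf))"

text \<open>The gradient of \<open>G\<close> reduces the bracket at \<rho> to brackets of
  \<open>F\<close> with entries of x and y, and the gradient of \<open>F\<close> reduces these to
  brackets of entries, where the defining rule applies.\<close>

lemma bracket_gradient:
  assumes br: "is_rep_bracket \<alpha> U R br" and \<rho>: "\<rho> \<in> U" and FG: "F \<in> \<O>" "G \<in> \<O>"
    and F: "gradient \<rho> F P Q" and G: "gradient \<rho> G P' Q'"
  shows "br F G \<rho> = representation.pairing \<alpha> \<rho> (pad_mat P) (pad_mat Q) (pad_mat P') (pad_mat Q') double_bracket"
proof -
  interpret representation \<alpha> \<rho> using \<rho> U_Rep by unfold_locales auto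
  have c: "P \<in> carrier_mat n n" "Q \<in> carrier_mat n n" "P' \<in> carrier_mat n n" "Q' \<in> carrier_mat n n"
    using F G by (simp_all add: gradient_def)
  have carr: "carrier R = \<O>" by (simp add: fun_ring_def)
  have pd: "point_der \<rho> (\<lambda>K. br H K \<rho>)" if "H \<in> \<O>" for H
  proof -
    have plus: "F \<oplus>\<^bsub>R\<^esub> G = (\<lambda>\<rho>\<in>U. F \<rho> + G \<rho>)" and times: "F \<otimes>\<^bsub>R\<^esub> G = (\<lambda>\<rho>\<in>U. F \<rho> * G \<rho>)" for F G
      by (simp_all add: fun_ring_def)
    have "br H (F \<oplus>\<^bsub>R\<^esub> G) = br H F \<oplus>\<^bsub>R\<^esub> br H G"
      "br H (F \<otimes>\<^bsub>R\<^esub> G) = (F \<otimes>\<^bsub>R\<^esub> br H G) \<oplus>\<^bsub>R\<^esub> (br H F \<otimes>\<^bsub>R\<^esub> G)" if "F \<in> \<O>" "G \<in> \<O>" for F G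
      using br that \<open>H \<in> \<O>\<close> unfolding is_rep_bracket_def carr by blast+
    then have "br H (\<lambda>\<rho>\<in>U. F \<rho> + G \<rho>) \<rho> = br H F \<rho> + br H G \<rho>"
      "br H (\<lambda>\<rho>\<in>U. F \<rho> * G \<rho>) \<rho> = F \<rho> * br H G \<rho> + br H F \<rho> * G \<rho>" if "F \<in> \<O>" "G \<in> \<O>" for F G
      using that \<rho> unfolding plus times by simp_all
    moreover have "br H (\<lambda>\<rho>\<in>U. z) = \<zero>\<^bsub>R\<^esub>" for z
      using br \<open>H \<in> \<O>\<close> unfolding is_rep_bracket_def carr by blast
    then have "br H (\<lambda>\<rho>\<in>U. z) \<rho> = 0" for z
      using \<rho> by (simp add: fun_ring_def)
    ultimately show ?thesis unfolding point_der_def by blast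
  qed
  have anti: "br H K \<rho> = - br K H \<rho>" if "H \<in> \<O>" "K \<in> \<O>" for H K
  proof -
    have "br H K = (\<lambda>\<rho>\<in>U. - br K H \<rho>)"
      using br that unfolding is_rep_bracket_def carr by blast
    from fun_cong[OF this, of \<rho>] show ?thesis using \<rho> by simp
  qed
  let ?e = "\<lambda>a i j. \<lambda>\<rho>\<in>U. \<rho> a $$ (i, j)"
  have e: "?e a i j \<in> \<O>" if "i < n" "j < n" for a i j
    using that by (intro entry) simp_all
  have cb: "(\<lambda>\<rho>\<in>U. cyc_block \<alpha> (\<rho> a) $$ (i, j)) = ?e a i j" if "i < n" "j < n" for a i j
    using that by (intro restrict_ext) (simp add: cyc_block_def)
  have br_e: "br (?e a i j) (?e b k l) \<rho> = tens_entry \<rho> (double_bracket a b) (k, j) (i, l)"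
    if "i < n" "j < n" "k < n" "l < n" for a b i j k l
  proof -
    have "br (?e a i j) (?e b k l) = (\<lambda>\<rho>\<in>U. tens_entry \<rho> (double_bracket a b) (k, j) (i, l))"
      using br that unfolding is_rep_bracket_def by (meson less_SucI)
    then show ?thesis using \<rho> by simp
  qed
  have br_flip: "br (?e b k l) (?e a i j) \<rho> = - tens_entry \<rho> (double_bracket a b) (k, j) (i, l)"
    if "i < n" "j < n" "k < n" "l < n" for a b i j k l
    using anti[OF e[OF that(3,4), of b] e[OF that(1,2), of a]] br_e[OF that, of a b] by simp
  have tr: "mtrace (A * mat_der n d (\<lambda>\<rho>. cyc_block \<alpha> (\<rho> a))) = (\<Sum>l<n. \<Sum>k<n. A $$ (l, k) * d (?e a k l))"
    if "A \<in> carrier_mat n n" for A d a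
    unfolding mtrace_mult[OF that mat_der_carrier] by (simp add: mat_der_def cb)
  have brF: "br F (?e b k l) \<rho> = (\<Sum>j<n. \<Sum>i<n. P $$ (j, i) * tens_entry \<rho> (double_bracket x_elem b) (k, j) (i, l))
      + (\<Sum>j<n. \<Sum>i<n. Q $$ (j, i) * tens_entry \<rho> (double_bracket y_elem b) (k, j) (i, l))"
    if kl: "k < n" "l < n" for b k l
  proof -
    \<comment> \<open>The derivation rule is stated for the second argument; antisymmetry brings
      \<open>F\<close> there.\<close>
    have "br F (?e b k l) \<rho> = - br (?e b k l) F \<rho>"
      by (rule anti[OF FG(1) e[OF kl]])
    also have "br (?e b k l) F \<rho> = mtrace (P * mat_der n (\<lambda>K. br (?e b k l) K \<rho>) Xf)
        + mtrace (Q * mat_der n (\<lambda>K. br (?e b k l) K \<rho>) Yf)"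
      using F pd[OF e[OF kl]] unfolding gradient_def by blast
    also have "\<dots> = (\<Sum>j<n. \<Sum>i<n. P $$ (j, i) * br (?e b k l) (?e x_elem i j) \<rho>)
        + (\<Sum>j<n. \<Sum>i<n. Q $$ (j, i) * br (?e b k l) (?e y_elem i j) \<rho>)"
      using c by (simp only: tr)
    also have "\<dots> = - ((\<Sum>j<n. \<Sum>i<n. P $$ (j, i) * tens_entry \<rho> (double_bracket x_elem b) (k, j) (i, l))
        + (\<Sum>j<n. \<Sum>i<n. Q $$ (j, i) * tens_entry \<rho> (double_bracket y_elem b) (k, j) (i, l)))"
      using kl by (simp add: br_flip sum_negf)
    finally show ?thesis by (simp only: minus_minus)
  qed
  have "br F G \<rho> = mtrace (P' * mat_der n (\<lambda>K. br F K \<rho>) Xf) + mtrace (Q' * mat_der n (\<lambda>K. br F K \<rho>) Yf)"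
    using G pd[OF FG(1)] unfolding gradient_def by blast
  also have "\<dots> = (\<Sum>l<n. \<Sum>k<n. P' $$ (l, k) * br F (?e x_elem k l) \<rho>)
      + (\<Sum>l<n. \<Sum>k<n. Q' $$ (l, k) * br F (?e y_elem k l) \<rho>)"
    using c by (simp only: tr)
  also have "\<dots> = pairing (pad_mat P) (pad_mat Q) (pad_mat P') (pad_mat Q') double_bracket"
    using c by (simp add: brF pairing_def contr_pad_mat Rings.distrib_left sum.distrib)
  finally show ?thesis .
qed

lemma bracket_eq_zero:
  assumes br: "is_rep_bracket \<alpha> U R br" and FG: "F \<in> \<O>" "G \<in> \<O>"
    and grad: "\<And>\<rho>. \<rho> \<in> U \<Longrightarrow> \<exists>P Q P' Q'. gradient \<rho> F P Q \<and> gradient \<rho> G P' Q' \<and>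
      representation.graded_pair \<alpha> \<rho> P Q \<and> representation.graded_pair \<alpha> \<rho> P' Q' \<and>
      representation.bracket_form \<alpha> \<rho> P Q P' Q' = 0"
  shows "br F G = (\<lambda>\<rho>\<in>U. 0)"
proof
  fix \<rho>
  have "br F G \<in> \<O>"
  proof -
    have "carrier R = \<O>" by (simp add: fun_ring_def)
    then show ?thesis using br FG unfolding is_rep_bracket_def by blast
  qed
  moreover have "br F G \<rho> = 0" if \<rho>: "\<rho> \<in> U"
  proof -
    interpret representation \<alpha> \<rho> using \<rho> U_Rep by unfold_locales auto
    obtain P Q P' Q' where g: "gradient \<rho> F P Q" "gradient \<rho> G P' Q'" "graded_pair P Q" "graded_pair P' Q'"
      "bracket_form P Q P' Q' = 0"
      using grad[OF \<rho>] by blast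
    then show ?thesis
      using bracket_gradient[OF br \<rho> FG g(1,2)] pairing_double_bracket_graded[OF g(3,4)] by simp
  qed
  ultimately show "br F G \<rho> = (\<lambda>\<rho>\<in>U. 0) \<rho>"
    using outside by (cases "\<rho> \<in> U") auto
qed

end

section \<open>Integer powers and their gradients\<close>

text \<open>\<open>V\<close> stands for the inverse of \<open>T\<close> but is a separate argument:
  entries are then polynomials in those of \<open>T\<close> and \<open>V\<close>, so regularity is
  immediate.\<close>

definition mat_ipow :: "complex mat \<Rightarrow> complex mat \<Rightarrow> int \<Rightarrow> complex mat" where
  "mat_ipow T V j = (if j < 0 then V ^\<^sub>m nat (- j) else T ^\<^sub>m nat j)"

text \<open>The matrix \<open>j T\<^sup>j\<^sup>-\<^sup>1\<close>, where \<open>V\<close> is the inverse of \<open>T\<close>.\<close>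

definition mat_ipow_der :: "complex mat \<Rightarrow> complex mat \<Rightarrow> int \<Rightarrow> complex mat" where
  "mat_ipow_der T V j =
     (if j < 0 then of_int j \<cdot>\<^sub>m V ^\<^sub>m (nat (- j) + 1) else of_int j \<cdot>\<^sub>m T ^\<^sub>m (nat j - 1))"

lemma mat_ipow_der_carrier [simp]:
  "T \<in> carrier_mat n n \<Longrightarrow> V \<in> carrier_mat n n \<Longrightarrow> mat_ipow_der T V j \<in> carrier_mat n n"
  by (simp add: mat_ipow_der_def)

lemma mat_commute_inverse:
  fixes A T V :: "complex mat"
  assumes "A \<in> carrier_mat n n" "T \<in> carrier_mat n n" "V \<in> carrier_mat n n"
    and "T * V = 1\<^sub>m n" "A * T = T * A"
  shows "A * V = V * A"
proof -
  have VT: "V * T = 1\<^sub>m n" by (rule mat_mult_left_right_inverse[OF assms(2,3,4)])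
  have "A * V = V * (T * A) * V" using assms(1-3) VT
    by (simp add: sq_algebra(1)[where n = n] flip: sq_algebra(3)[where n = n])
  also have "\<dots> = V * A * (T * V)"
    unfolding assms(5)[symmetric] using assms(1-3) by (simp add: sq_algebra[where n = n])
  finally show ?thesis using assms(1,3) by (simp add: assms(4) sq_algebra[where n = n])
qed

lemma mat_ipow_der_commute:
  assumes "A \<in> carrier_mat n n" "T \<in> carrier_mat n n" "V \<in> carrier_mat n n"
    and "T * V = 1\<^sub>m n" "A * T = T * A"
  shows "A * mat_ipow_der T V j = mat_ipow_der T V j * A"
proof -
  have "T ^\<^sub>m k * A = A * T ^\<^sub>m k" "V ^\<^sub>m k * A = A * V ^\<^sub>m k" for k
    using pow_mat_comm[OF assms(2,1) assms(5)[symmetric]]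
      pow_mat_comm[OF assms(3,1) mat_commute_inverse[OF assms, symmetric]] by auto
  then show ?thesis
    using assms(1-3) by (simp add: mat_ipow_der_def sq_algebra(10,11)[where n = n] del: pow_mat.simps)
qed

lemma mat_ipow_der_commutes:
  assumes "T \<in> carrier_mat n n" "V \<in> carrier_mat n n" "T * V = 1\<^sub>m n"
  shows "mat_ipow_der T V j * T = T * mat_ipow_der T V j"
    and "mat_ipow_der T V j * mat_ipow_der T V l = mat_ipow_der T V l * mat_ipow_der T V j"
proof -
  show T: "mat_ipow_der T V j * T = T * mat_ipow_der T V j" for j
    using mat_ipow_der_commute[OF assms(1) assms HOL.refl] by simp
  show "mat_ipow_der T V j * mat_ipow_der T V l = mat_ipow_der T V l * mat_ipow_der T V j"
    using assms by (intro mat_ipow_der_commute[OF _ assms T]) simp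
qed

text \<open>For j = -(k+1) the power rule is applied to V, with dV = -V dT V. Rotating the last
  factor under the trace collects the power V^(k+2), which is T^(j-1).\<close>

lemma (in fun_algebra) point_der_mtrace_ipow:
  assumes d: "point_der \<rho> d" and \<rho>: "\<rho> \<in> U" and TV: "regular_mat n T" "regular_mat n V"
    and inv: "\<And>\<rho>. \<rho> \<in> U \<Longrightarrow> T \<rho> * V \<rho> = 1\<^sub>m n"
  shows "d (\<lambda>\<rho>\<in>U. mtrace (mat_ipow (T \<rho>) (V \<rho>) j)) = mtrace (mat_ipow_der (T \<rho>) (V \<rho>) j * mat_der n d T)"
proof -
  have c: "T \<rho> \<in> carrier_mat n n" "V \<rho> \<in> carrier_mat n n"
    using TV \<rho> by (auto simp: regular_mat_def)
  let ?D = "mat_der n d T"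
  show ?thesis
  proof (cases "j < 0")
    case False
    then show ?thesis
      using point_der_mtrace_pow[OF d \<rho> TV(1), of "nat j"] c
      by (simp add: mat_ipow_def mat_ipow_der_def sq_algebra(10)[where n = n] mtrace_smult[of _ n])
  next
    case True
    define k where "k = nat (- j) - 1"
    have k: "nat (- j) = Suc k" using True by (simp add: k_def)
    have p: "V \<rho> ^\<^sub>m k \<in> carrier_mat n n" using c by simp
    have VD: "mat_der n d V = - (V \<rho> * ?D * V \<rho>)"
      by (rule mat_der_inverse[OF d \<rho> TV inv])
    have "mtrace (V \<rho> ^\<^sub>m k * mat_der n d V) = - mtrace ((V \<rho> ^\<^sub>m k * (V \<rho> * ?D)) * V \<rho>)"
      unfolding VD
      using c p by (simp add: sq_algebra[where n = n] mtrace_uminus[of _ n] del: pow_mat.simps)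
    also have "mtrace ((V \<rho> ^\<^sub>m k * (V \<rho> * ?D)) * V \<rho>) = mtrace (V \<rho> * (V \<rho> ^\<^sub>m k * (V \<rho> * ?D)))"
      using c p by (intro mtrace_comm[of _ n]) simp_all
    also have "V \<rho> * (V \<rho> ^\<^sub>m k * (V \<rho> * ?D)) = (V \<rho> * V \<rho> ^\<^sub>m k) * V \<rho> * ?D"
      using c p by (simp add: sq_algebra[where n = n] del: pow_mat.simps)
    also have "(V \<rho> * V \<rho> ^\<^sub>m k) * V \<rho> = V \<rho> ^\<^sub>m (Suc k + 1)"
      using pow_mat_comm[OF c(2,2) HOL.refl, of k] by simp
    finally have "mtrace (V \<rho> ^\<^sub>m k * mat_der n d V) = - mtrace (V \<rho> ^\<^sub>m (Suc k + 1) * ?D)" .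
    moreover have "(of_nat (Suc k) :: complex) = - of_int j" using True k by (simp add: of_nat_nat flip: k)
    moreover have "V \<rho> ^\<^sub>m (Suc k + 1) \<in> carrier_mat n n" by (rule pow_carrier_mat[OF c(2)])
    ultimately show ?thesis
      using True point_der_mtrace_pow[OF d \<rho> TV(2), of "Suc k"] c
      by (simp add: mat_ipow_def mat_ipow_der_def k sq_algebra(10)[where n = n] mtrace_smult[of _ n]
          del: pow_mat.simps of_nat_Suc)
  qed
qed

lemma (in fun_algebra) regular_mat_ipow:
  "regular_mat n T \<Longrightarrow> regular_mat n V \<Longrightarrow> regular_mat n (\<lambda>\<rho>. mat_ipow (T \<rho>) (V \<rho>) j)"
  by (cases "j < 0") (simp_all add: mat_ipow_def regular_mat_pow)

context representation
begin

lemma homog_ipow_der: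
  assumes "homog \<epsilon> T" "V \<in> carrier_mat n n" "T * V = 1\<^sub>m n" "\<delta> = of_int (j - 1) * \<epsilon>"
  shows "homog \<delta> (mat_ipow_der T V j)"
proof -
  have T: "T \<in> carrier_mat n n" using assms(1) by (simp add: homog_def)
  consider "j < 0" | "j = 0" | "j > 0" by linarith
  then show ?thesis
  proof cases
    case 1
    define k where "k = nat (- j)"
    have "j = - int k" using 1 by (simp add: k_def)
    then have "of_nat (nat (- j) + 1) * - \<epsilon> = \<delta>"
      by (simp add: assms(4) algebra_simps)
    with 1 homog_smult[OF homog_pow[OF homog_inverse[OF assms(1-3)], of "nat (- j) + 1"]] show ?thesis
      by (simp add: mat_ipow_der_def del: pow_mat.simps)
  next
    case 2
    \<comment> \<open>The truncated exponent would give degree 0 here, but the coefficient 0 makes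
      the matrix zero, hence homogeneous of every degree.\<close>
    have "mat_ipow_der T V j = 0\<^sub>m n n"
      using 2 T by (auto simp: mat_ipow_der_def intro!: eq_matI)
    then show ?thesis by (simp add: homog_zero)
  next
    case 3
    have "(of_nat (nat j - 1) :: 'm mod_ring) = of_int (j - 1)"
      using 3 by (simp add: of_nat_diff nat_diff_distrib flip: of_nat_nat)
    with 3 homog_smult[OF homog_pow[OF assms(1), of "nat j - 1"]] show ?thesis
      by (simp add: mat_ipow_der_def assms(4) del: pow_mat.simps)
  qed
qed

text \<open>In Z/m the exponent j m - 1 becomes -1; this is where multiples of m enter. At
  \<open>j = 0\<close> the subtraction is truncated, and the zero coefficient takes care of that
  case.\<close>

lemma homog_pow_der:
  assumes "homog \<epsilon> T"
  shows "homog (- \<epsilon>) (of_nat (j * CARD('m)) \<cdot>\<^sub>m T ^\<^sub>m (j * CARD('m) - 1))"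
proof (cases "j = 0")
  case True
  have "T \<in> carrier_mat n n" using assms by (simp add: homog_def)
  then have "of_nat (j * CARD('m)) \<cdot>\<^sub>m T ^\<^sub>m (j * CARD('m) - 1) = 0\<^sub>m n n"
    using True by (auto intro!: eq_matI)
  then show ?thesis by (simp add: homog_zero)
next
  case False
  then have "j * CARD('m) \<ge> 1" by (simp add: Suc_leI)
  then have "(of_nat (j * CARD('m) - 1) :: 'm mod_ring) = - 1"
    by (simp add: of_nat_diff)
  with homog_smult[OF homog_pow[OF assms, of "j * CARD('m) - 1"]] show ?thesis by simp
qed

end

section \<open>Equivariant matrix functions and the criterion for a commuting family\<close>

context rep_space
begin

definition intertwines :: "complex mat \<Rightarrow> complex mat \<Rightarrow> complex mat \<Rightarrow> bool" where
  "intertwines g g' h' \<longleftrightarrow> g' \<in> carrier_mat dc dc \<and> h' \<in> carrier_mat dc dc \<and>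
     g' * h' = 1\<^sub>m dc \<and> h' * g' = 1\<^sub>m dc \<and>
     (\<forall>\<rho>\<in>U. \<forall>a. cyc_elem a \<longrightarrow> cyc_block \<alpha> (gl_conj \<alpha> g \<rho> a) = h' * cyc_block \<alpha> (\<rho> a) * g')"

text \<open>Conjugating the point conjugates the matrix by the cyclic part of \<open>g\<close>. The
  property passes through sums, products, powers and inverses, and makes the trace
  invariant.\<close>

definition equivariant :: "('m rep \<Rightarrow> complex mat) \<Rightarrow> bool" where
  "equivariant T \<longleftrightarrow> (\<forall>g\<in>GL \<alpha>. \<forall>g' h'. intertwines g g' h' \<longrightarrow>
     (\<forall>\<rho>\<in>U. T (gl_conj \<alpha> g \<rho>) = h' * T \<rho> * g'))"

lemma equivariant_cyc_block: "cyc_elem a \<Longrightarrow> equivariant (\<lambda>\<rho>. cyc_block \<alpha> (\<rho> a))"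
  by (simp add: equivariant_def intertwines_def)

lemma equivariant_one: "equivariant (\<lambda>\<rho>. 1\<^sub>m dc)"
  by (simp add: equivariant_def intertwines_def sq_algebra[where n = dc])

lemma equivariant_mult:
  assumes "regular_mat dc S" "regular_mat dc T" "equivariant S" "equivariant T"
  shows "equivariant (\<lambda>\<rho>. S \<rho> * T \<rho>)"
  unfolding equivariant_def
proof (intro ballI allI impI)
  fix g g' h' \<rho> assume g: "g \<in> GL \<alpha>" "intertwines g g' h'" "\<rho> \<in> U"
  have "(h' * S \<rho> * g') * (h' * T \<rho> * g') = h' * (S \<rho> * T \<rho>) * g'"
    using g assms(1,2) by (intro conj_mult_mat[of _ dc]) (auto simp: intertwines_def regular_mat_def)
  then show "S (gl_conj \<alpha> g \<rho>) * T (gl_conj \<alpha> g \<rho>) = h' * (S \<rho> * T \<rho>) * g'"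
    using assms(3,4) g by (simp add: equivariant_def)
qed

lemma equivariant_add:
  assumes "regular_mat dc S" "regular_mat dc T" "equivariant S" "equivariant T"
  shows "equivariant (\<lambda>\<rho>. S \<rho> + T \<rho>)"
  unfolding equivariant_def
proof (intro ballI allI impI)
  fix g g' h' \<rho> assume g: "g \<in> GL \<alpha>" "intertwines g g' h'" "\<rho> \<in> U"
  have "S \<rho> \<in> carrier_mat dc dc" "T \<rho> \<in> carrier_mat dc dc"
    using assms(1,2) g by (auto simp: regular_mat_def)
  then have "h' * S \<rho> * g' + h' * T \<rho> * g' = h' * (S \<rho> + T \<rho>) * g'"
    using g by (simp add: intertwines_def sq_algebra[where n = dc])
  then show "S (gl_conj \<alpha> g \<rho>) + T (gl_conj \<alpha> g \<rho>) = h' * (S \<rho> + T \<rho>) * g'"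
    using assms(3,4) g by (simp add: equivariant_def)
qed

text \<open>At the conjugated point, the conjugate of \<open>V \<rho>\<close> is an inverse of the
  value of \<open>T\<close>, and inverses are unique.\<close>

lemma equivariant_inverse:
  assumes "regular_mat dc T" "regular_mat dc V" "equivariant T" "\<And>\<rho>. \<rho> \<in> U \<Longrightarrow> T \<rho> * V \<rho> = 1\<^sub>m dc"
  shows "equivariant V"
  unfolding equivariant_def
proof (intro ballI allI impI)
  fix g g' h' \<rho> assume g: "g \<in> GL \<alpha>" "intertwines g g' h'" "\<rho> \<in> U"
  have gU: "gl_conj \<alpha> g \<rho> \<in> U" by (rule gl_conj_U[OF g(1,3)])
  have gh: "g' \<in> carrier_mat dc dc" "h' \<in> carrier_mat dc dc" "g' * h' = 1\<^sub>m dc" "h' * g' = 1\<^sub>m dc"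
    using g(2) by (simp_all add: intertwines_def)
  have c: "T \<rho> \<in> carrier_mat dc dc" "V \<rho> \<in> carrier_mat dc dc" "V (gl_conj \<alpha> g \<rho>) \<in> carrier_mat dc dc"
    "T (gl_conj \<alpha> g \<rho>) \<in> carrier_mat dc dc"
    using assms(1,2) g gU by (auto simp: regular_mat_def)
  have "T (gl_conj \<alpha> g \<rho>) * (h' * V \<rho> * g') = h' * (T \<rho> * V \<rho>) * g'"
    using assms(3) g conj_mult_mat[OF c(1,2) gh(1,2,3)] by (simp add: equivariant_def)
  also have "\<dots> = 1\<^sub>m dc"
    unfolding assms(4)[OF g(3)] using gh(1,2,4) by (simp add: sq_algebra[where n = dc])
  finally have "inv\<^bsub>M dc\<^esub> (T (gl_conj \<alpha> g \<rho>)) = h' * V \<rho> * g'"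
    using gh(1,2) c by (intro ring_mat_inv_eq) simp_all
  then show "V (gl_conj \<alpha> g \<rho>) = h' * V \<rho> * g'"
    using ring_mat_inv_eq[OF c(4,3) assms(4)[OF gU]] by simp
qed

lemma equivariant_pow:
  assumes "regular_mat dc T" "equivariant T"
  shows "equivariant (\<lambda>\<rho>. T \<rho> ^\<^sub>m k)"
  unfolding equivariant_def
proof (intro ballI allI impI)
  fix g g' h' \<rho> assume g: "g \<in> GL \<alpha>" "intertwines g g' h'" "\<rho> \<in> U"
  have "T (gl_conj \<alpha> g \<rho>) = h' * T \<rho> * g'"
    using assms(2) g by (simp add: equivariant_def)
  moreover have "(h' * T \<rho> * g') ^\<^sub>m k = h' * T \<rho> ^\<^sub>m k * g'"
    using g assms(1) by (intro conj_pow_mat[of _ dc]) (auto simp: intertwines_def regular_mat_def)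
  ultimately show "T (gl_conj \<alpha> g \<rho>) ^\<^sub>m k = h' * T \<rho> ^\<^sub>m k * g'" by simp
qed

lemma equivariant_ipow:
  assumes "regular_mat dc T" "regular_mat dc V" "equivariant T" "\<And>\<rho>. \<rho> \<in> U \<Longrightarrow> T \<rho> * V \<rho> = 1\<^sub>m dc"
  shows "equivariant (\<lambda>\<rho>. mat_ipow (T \<rho>) (V \<rho>) j)"
  using equivariant_pow[OF assms(1,3), of "nat j"]
    equivariant_pow[OF assms(2) equivariant_inverse[OF assms], of "nat (- j)"]
  by (cases "j < 0") (simp_all add: mat_ipow_def)

lemma equivariant_inv_funs:
  assumes "regular_mat dc T" "equivariant T"
  shows "(\<lambda>\<rho>\<in>U. mtrace (T \<rho>)) \<in> inv_funs \<alpha> U R"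
proof (rule inv_funs_mtrace[OF assms(1)])
  fix g \<rho> assume g: "g \<in> GL \<alpha>" "\<rho> \<in> U"
  obtain g' h' where gh: "g' \<in> carrier_mat dc dc" "h' \<in> carrier_mat dc dc" "g' * h' = 1\<^sub>m dc" "h' * g' = 1\<^sub>m dc"
    "\<And>\<rho> a. \<rho> \<in> Rep \<alpha> \<Longrightarrow> cyc_elem a \<Longrightarrow>
      cyc_block \<alpha> (gl_conj \<alpha> g \<rho> a) = h' * cyc_block \<alpha> (\<rho> a) * g'"
    by (rule cyc_block_gl_conj[OF g(1)]) blast
  then have "intertwines g g' h'" using U_Rep by (auto simp: intertwines_def)
  then have "T (gl_conj \<alpha> g \<rho>) = h' * T \<rho> * g'"
    using assms(2) g by (simp add: equivariant_def)
  then show "mtrace (T (gl_conj \<alpha> g \<rho>)) = mtrace (T \<rho>)"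
    using mtrace_conj[OF regular_matD(1)[OF assms(1) g(2)] gh(1,2,3)] by simp
qed

text \<open>\<open>T\<close> is the expression in the matrix ring that the theorem uses,
  \<open>S\<close> one built from operations with known regularity and equivariance. Agreement on
  \<open>U\<close> suffices, since \<open>tr_class\<close> restricts to \<open>U\<close>.\<close>

lemma poisson_commuting_family:
  assumes P: "is_reduced_bracket \<alpha> q U R P"
    and S: "\<And>j. regular_mat dc (S j)" "\<And>j. equivariant (S j)"
    and T: "\<And>j \<rho>. \<rho> \<in> U \<Longrightarrow> T j \<rho> = S j \<rho>"
    and grad: "\<And>\<rho> j l. \<rho> \<in> U \<Longrightarrow> \<exists>P Q P' Q'. gradient \<rho> (\<lambda>\<rho>\<in>U. mtrace (S j \<rho>)) P Q \<and>
      gradient \<rho> (\<lambda>\<rho>\<in>U. mtrace (S l \<rho>)) P' Q' \<and>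
      representation.graded_pair \<alpha> \<rho> P Q \<and> representation.graded_pair \<alpha> \<rho> P' Q' \<and>
      representation.bracket_form \<alpha> \<rho> P Q P' Q' = 0"
  shows "poisson_commuting \<alpha> q U R P {tr_class \<alpha> q U R (T j) | j. True}"
proof -
  have "tr_class \<alpha> q U R (T j) = tr_class \<alpha> q U R (S j)" for j
  proof -
    have "(\<lambda>\<rho>\<in>U. mtrace (T j \<rho>)) = (\<lambda>\<rho>\<in>U. mtrace (S j \<rho>))"
      by (rule restrict_ext) (simp add: T)
    then show ?thesis by (simp only: tr_class_def)
  qed
  then have "{tr_class \<alpha> q U R (T j) | j. True} = tr_class \<alpha> q U R ` range S"
    by auto
  moreover have "poisson_commuting \<alpha> q U R P (tr_class \<alpha> q U R ` range S)"
  proof (rule poisson_commutingI[OF P])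
    fix br T T' assume br: "is_rep_bracket \<alpha> U R br" and "T \<in> range S" "T' \<in> range S"
    then obtain j l where jl: "T = S j" "T' = S l" by blast
    have "(\<lambda>\<rho>\<in>U. mtrace (S j \<rho>)) \<in> \<O>" for j
      using regular_mtrace[OF S(1)[of j]] by (simp add: regular_def)
    then show "br (\<lambda>\<rho>\<in>U. mtrace (T \<rho>)) (\<lambda>\<rho>\<in>U. mtrace (T' \<rho>)) = (\<lambda>\<rho>\<in>U. 0)"
      unfolding jl by (intro bracket_eq_zero[OF br]) (use grad in blast)+
  next
    fix T assume "T \<in> range S"
    then show "(\<lambda>\<rho>\<in>U. mtrace (T \<rho>)) \<in> inv_funs \<alpha> U R"
      using equivariant_inv_funs[OF S(1,2)] by blast
  qed
  ultimately show ?thesis by simp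
qed

end

section \<open>The four families\<close>

lemma inverse_commute:
  fixes e u v :: "'a::ring_1"
  assumes "e * u = u * e" "u * v = 1" "v * u = 1"
  shows "v * e = e * v"
proof -
  have "v * e = v * (e * u) * v" by (simp add: mult.assoc assms(2))
  also have "\<dots> = e * v" by (simp add: assms(1,3) flip: mult.assoc)
  finally show ?thesis .
qed

text \<open>Inverses are adjoined for each 1 + x_i y_i rather than for 1 + xy. As xy preserves every
  vertex, cutting these inverses down to their vertices and summing inverts 1 + xy on the cyclic
  part.\<close>

lemma one_plus_xy_inverse:
  obtains w :: "'m::nontriv dpa" where "cyc_elem w"
    "w + x_elem * y_elem * w = (\<Sum>i\<in>UNIV. idem (Cyc i))"
proof -
  define w :: "'m dpa" where "w = (\<Sum>i\<in>UNIV. idem (Cyc i) * inv1 (Ax i))"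
  \<comment> \<open>The loop x_i y_i starts and ends at \<open>i\<close>, so it commutes with every
    idempotent, and then so does the inverse of 1 + x_i y_i.\<close>
  have comm: "inv1 (Ax i) * idem v = idem v * inv1 (Ax i)" for i :: "'m mod_ring" and v
  proof (rule inverse_commute[of _ "1 + arr (Ax i) * arr (Ay i)"])
    have "idem v * (arr (Ax i) * arr (Ay i)) = arr (Ax i) * arr (Ay i) * idem v"
      by (simp add: mult.assoc arr_idem) (simp add: idem_arr flip: mult.assoc)
    then show "idem v * (1 + arr (Ax i) * arr (Ay i)) = (1 + arr (Ax i) * arr (Ay i)) * idem v"
      by (simp add: Rings.distrib_left Rings.distrib_right)
  qed (use inv1_left[of "Ax i"] inv1_right[of "Ax i"] in simp_all)
  have "cyc_elem (idem (Cyc i) * inv1 (Ax i))" for i :: "'m mod_ring"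
    by (simp add: cyc_elem_def mult.assoc comm) (simp add: idem_orth flip: mult.assoc)
  then have "cyc_elem w" by (simp add: w_def)
  moreover have "w + x_elem * y_elem * w = (\<Sum>i\<in>UNIV. idem (Cyc i))"
  proof -
    have "x_elem * y_elem * idem (Cyc i) = idem (Cyc i) * (arr (Ax i) * arr (Ay i))" for i :: "'m mod_ring"
    proof -
      have "x_elem * y_elem * idem (Cyc i) = x_elem * (idem (Cyc (i + 1)) * arr (Ay i))"
        by (simp add: mult.assoc y_elem_idem idem_arr)
      also have "\<dots> = arr (Ax i) * arr (Ay i)"
        by (simp add: x_elem_idem flip: mult.assoc)
      finally show ?thesis by (simp add: idem_arr flip: mult.assoc)
    qed
    then have "x_elem * y_elem * w = (\<Sum>i\<in>UNIV. idem (Cyc i) * (arr (Ax i) * arr (Ay i)) * inv1 (Ax i))"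
      by (simp add: w_def sum_distrib_left flip: mult.assoc)
    then have "w + x_elem * y_elem * w
        = (\<Sum>i\<in>UNIV. idem (Cyc i) * ((1 + arr (Ax i) * arr (Ay i)) * inv1 (Ax i)))"
      by (simp add: w_def Rings.distrib_left Rings.distrib_right mult.assoc sum.distrib)
    moreover have "(1 + arr (Ax i) * arr (Ay i)) * inv1 (Ax i) = 1" for i :: "'m mod_ring"
      using inv1_right[of "Ax i"] by simp
    ultimately show ?thesis by simp
  qed
  ultimately show ?thesis by (rule that)
qed

context rep_space
begin

lemma regular_Xf: "regular_mat dc Xf" and regular_Yf: "regular_mat dc Yf"
  by (rule regular_cyc_block)+

lemma regular_one_plus_XY: "regular_mat dc (\<lambda>\<rho>. 1\<^sub>m dc + Xf \<rho> * Yf \<rho>)"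
  by (intro regular_mat_add regular_mat_mult regular_Xf regular_Yf) (simp add: regular_mat_const)

text \<open>\<open>W\<close> is the cyclic block of an element of the algebra, so its entries are
  regular and negative powers of 1 + XY are regular on all of \<open>U\<close>.\<close>

lemma ex_inverse_one_plus_XY:
  obtains W where "regular_mat dc W" "\<And>\<rho>. \<rho> \<in> U \<Longrightarrow> (1\<^sub>m dc + Xf \<rho> * Yf \<rho>) * W \<rho> = 1\<^sub>m dc"
proof -
  obtain w :: "'m dpa" where w: "cyc_elem w" "w + x_elem * y_elem * w = (\<Sum>i\<in>UNIV. idem (Cyc i))"
    by (rule one_plus_xy_inverse)
  have "(1\<^sub>m dc + Xf \<rho> * Yf \<rho>) * cyc_block \<alpha> (\<rho> w) = 1\<^sub>m dc" if "\<rho> \<in> U" for \<rho>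
  proof -
    interpret representation \<alpha> \<rho> using that U_Rep by unfold_locales auto
    have "cb (\<Sum>i\<in>UNIV. Defs.idem (Cyc i)) + cb (Defs.idem Infty) = 1\<^sub>m n"
      unfolding idem_sum_cyc by (simp add: cb_one flip: cb_add)
    then have "cb (\<Sum>i\<in>UNIV. Defs.idem (Cyc i)) = 1\<^sub>m n"
      by (simp add: cb_idem_Infty)
    then have "cb w + X * Y * cb w = 1\<^sub>m n"
      using w by (simp flip: cb_mult cb_add)
    then show ?thesis by (simp add: sq_algebra[where n = n] flip: cb_def)
  qed
  then show ?thesis by (intro that[OF regular_cyc_block])
qed

lemma gradient_X:
  assumes "\<rho> \<in> U"
  shows "gradient \<rho> (\<lambda>\<rho>\<in>U. mtrace (Xf \<rho> ^\<^sub>m k)) (of_nat k \<cdot>\<^sub>m Xf \<rho> ^\<^sub>m (k - 1)) (0\<^sub>m dc dc)"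
  unfolding gradient_def using point_der_mtrace_pow[OF _ assms regular_Xf, of _ k]
  by (simp add: sq_algebra(10)[where n = dc] mtrace_smult[of _ dc] left_mult_zero_mat[of _ dc dc])

lemma gradient_Y:
  assumes "\<rho> \<in> U"
  shows "gradient \<rho> (\<lambda>\<rho>\<in>U. mtrace (Yf \<rho> ^\<^sub>m k)) (0\<^sub>m dc dc) (of_nat k \<cdot>\<^sub>m Yf \<rho> ^\<^sub>m (k - 1))"
  unfolding gradient_def using point_der_mtrace_pow[OF _ assms regular_Yf, of _ k]
  by (simp add: sq_algebra(10)[where n = dc] mtrace_smult[of _ dc] left_mult_zero_mat[of _ dc dc])

text \<open>The differential is tr(S (X dY + dX Y)); rotating Y to the front in the second summand
  gives the coefficients SX of dY and YS of dX.\<close>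

lemma gradient_one_plus_XY:
  fixes j :: int
  assumes \<rho>: "\<rho> \<in> U" and W: "regular_mat dc W" "\<And>\<rho>. \<rho> \<in> U \<Longrightarrow> (1\<^sub>m dc + Xf \<rho> * Yf \<rho>) * W \<rho> = 1\<^sub>m dc"
  defines "S \<equiv> mat_ipow_der (1\<^sub>m dc + Xf \<rho> * Yf \<rho>) (W \<rho>) j"
  shows "gradient \<rho> (\<lambda>\<rho>\<in>U. mtrace (mat_ipow (1\<^sub>m dc + Xf \<rho> * Yf \<rho>) (W \<rho>) j)) (Yf \<rho> * S) (S * Xf \<rho>)"
proof -
  have S: "S \<in> carrier_mat dc dc"
    using regular_matD(1)[OF W(1) \<rho>] by (simp add: S_def)
  have "d (\<lambda>\<rho>\<in>U. mtrace (mat_ipow (1\<^sub>m dc + Xf \<rho> * Yf \<rho>) (W \<rho>) j))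
      = mtrace (Yf \<rho> * S * mat_der dc d Xf) + mtrace (S * Xf \<rho> * mat_der dc d Yf)"
    if d: "point_der \<rho> d" for d
  proof -
    have "mat_der dc d (\<lambda>\<rho>. 1\<^sub>m dc + Xf \<rho> * Yf \<rho>)
        = mat_der dc d (\<lambda>_. 1\<^sub>m dc) + mat_der dc d (\<lambda>\<rho>. Xf \<rho> * Yf \<rho>)"
      by (intro mat_der_add[OF d] regular_mat_mult regular_Xf regular_Yf) (simp add: regular_mat_const)
    also have "\<dots> = Xf \<rho> * mat_der dc d Yf + mat_der dc d Xf * Yf \<rho>"
      by (simp add: mat_der_const[OF d] mat_der_mult[OF d \<rho> regular_Xf regular_Yf])
    finally have D: "mat_der dc d (\<lambda>\<rho>. 1\<^sub>m dc + Xf \<rho> * Yf \<rho>) = Xf \<rho> * mat_der dc d Yf + mat_der dc d Xf * Yf \<rho>" .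
    have "mtrace (S * (mat_der dc d Xf * Yf \<rho>)) = mtrace (Yf \<rho> * S * mat_der dc d Xf)"
      using mtrace_comm[of "S * mat_der dc d Xf" dc "Yf \<rho>"] S by (simp add: sq_algebra[where n = dc])
    then show ?thesis
      using point_der_mtrace_ipow[OF d \<rho> regular_one_plus_XY W, of j] S
      by (simp add: D mtrace_add[of _ dc] sq_algebra[where n = dc] flip: S_def)
  qed
  then show ?thesis using S by (simp add: gradient_def)
qed

text \<open>The inverse B of X has differential -B dX B, which under the trace contributes the
  coefficient -BSB of dX.\<close>

lemma gradient_Y_plus_inverse:
  fixes j :: int
  assumes \<rho>: "\<rho> \<in> U" and B: "regular_mat dc B" "\<And>\<rho>. \<rho> \<in> U \<Longrightarrow> Xf \<rho> * B \<rho> = 1\<^sub>m dc"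
    and V: "regular_mat dc V" "\<And>\<rho>. \<rho> \<in> U \<Longrightarrow> (Yf \<rho> + B \<rho>) * V \<rho> = 1\<^sub>m dc"
  defines "S \<equiv> mat_ipow_der (Yf \<rho> + B \<rho>) (V \<rho>) j"
  shows "gradient \<rho> (\<lambda>\<rho>\<in>U. mtrace (mat_ipow (Yf \<rho> + B \<rho>) (V \<rho>) j)) (- (B \<rho> * (S * B \<rho>))) S"
proof -
  have c: "B \<rho> \<in> carrier_mat dc dc" "V \<rho> \<in> carrier_mat dc dc"
    using regular_matD(1)[OF _ \<rho>] B V by blast+
  then have S: "S \<in> carrier_mat dc dc" by (simp add: S_def)
  have "d (\<lambda>\<rho>\<in>U. mtrace (mat_ipow (Yf \<rho> + B \<rho>) (V \<rho>) j))
      = mtrace (- (B \<rho> * (S * B \<rho>)) * mat_der dc d Xf) + mtrace (S * mat_der dc d Yf)"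
    if d: "point_der \<rho> d" for d
  proof -
    have D: "mat_der dc d (\<lambda>\<rho>. Yf \<rho> + B \<rho>) = mat_der dc d Yf + - (B \<rho> * mat_der dc d Xf * B \<rho>)"
      by (simp only: mat_der_add[OF d regular_Yf B(1)] mat_der_inverse[OF d \<rho> regular_Xf B])
    have "mtrace (S * (B \<rho> * mat_der dc d Xf * B \<rho>)) = mtrace ((B \<rho> * (S * B \<rho>)) * mat_der dc d Xf)"
      using mtrace_comm[of "S * (B \<rho> * mat_der dc d Xf)" dc "B \<rho>"] S c by (simp add: sq_algebra[where n = dc])
    then show ?thesis
      using point_der_mtrace_ipow[OF d \<rho> regular_mat_add[OF regular_Yf B(1)] V, of j] S c
      by (simp add: D mtrace_add[of _ dc] mtrace_uminus[of _ dc] sq_algebra[where n = dc] flip: S_def)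
  qed
  then show ?thesis using S c by (simp add: gradient_def)
qed

lemma poisson_commuting_X:
  assumes "is_reduced_bracket \<alpha> q U R P"
  shows "poisson_commuting \<alpha> q U R P
    {tr_class \<alpha> q U R (\<lambda>\<rho>. Xmat \<alpha> \<rho> [^]\<^bsub>M dc\<^esub> (j * CARD('m))) | j :: nat. True}"
proof (rule poisson_commuting_family[OF assms, where S = "\<lambda>j \<rho>. Xf \<rho> ^\<^sub>m (j * CARD('m))"])
  fix j l :: nat and \<rho> assume \<rho>: "\<rho> \<in> U"
  interpret representation \<alpha> \<rho> using \<rho> U_Rep by unfold_locales auto
  let ?P = "\<lambda>j. of_nat (j * CARD('m)) \<cdot>\<^sub>m X ^\<^sub>m (j * CARD('m) - 1)"
  have "graded_pair (?P j) (0\<^sub>m n n)" for j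
    by (intro graded_pairI homog_zero homog_pow_der homog_X)
  moreover have "bracket_form (?P j) (0\<^sub>m n n) (?P l) (0\<^sub>m n n) = 0"
    by (intro bracket_form_X smult_pow_commute[of _ n]) simp_all
  ultimately show "\<exists>P Q P' Q'. gradient \<rho> (\<lambda>\<rho>\<in>U. mtrace (Xf \<rho> ^\<^sub>m (j * CARD('m)))) P Q \<and>
      gradient \<rho> (\<lambda>\<rho>\<in>U. mtrace (Xf \<rho> ^\<^sub>m (l * CARD('m)))) P' Q' \<and>
      graded_pair P Q \<and> graded_pair P' Q' \<and> bracket_form P Q P' Q' = 0"
    using gradient_X[OF \<rho>] unfolding cb_def by blast
qed (simp_all add: regular_mat_pow regular_Xf equivariant_pow equivariant_cyc_block Xmat_def
    pow_mat_ring_pow[of _ dc, symmetric])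

lemma poisson_commuting_Y:
  assumes "is_reduced_bracket \<alpha> q U R P"
  shows "poisson_commuting \<alpha> q U R P
    {tr_class \<alpha> q U R (\<lambda>\<rho>. Ymat \<alpha> \<rho> [^]\<^bsub>M dc\<^esub> (j * CARD('m))) | j :: nat. True}"
proof (rule poisson_commuting_family[OF assms, where S = "\<lambda>j \<rho>. Yf \<rho> ^\<^sub>m (j * CARD('m))"])
  fix j l :: nat and \<rho> assume \<rho>: "\<rho> \<in> U"
  interpret representation \<alpha> \<rho> using \<rho> U_Rep by unfold_locales auto
  let ?Q = "\<lambda>j. of_nat (j * CARD('m)) \<cdot>\<^sub>m Y ^\<^sub>m (j * CARD('m) - 1)"
  have "homog 1 (?Q j)" for j
    using homog_pow_der[OF homog_Y] by simp
  then have "graded_pair (0\<^sub>m n n) (?Q j)" for j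
    by (intro graded_pairI homog_zero)
  moreover have "bracket_form (0\<^sub>m n n) (?Q j) (0\<^sub>m n n) (?Q l) = 0"
    by (intro bracket_form_Y smult_pow_commute[of _ n]) simp_all
  ultimately show "\<exists>P Q P' Q'. gradient \<rho> (\<lambda>\<rho>\<in>U. mtrace (Yf \<rho> ^\<^sub>m (j * CARD('m)))) P Q \<and>
      gradient \<rho> (\<lambda>\<rho>\<in>U. mtrace (Yf \<rho> ^\<^sub>m (l * CARD('m)))) P' Q' \<and>
      graded_pair P Q \<and> graded_pair P' Q' \<and> bracket_form P Q P' Q' = 0"
    using gradient_Y[OF \<rho>] unfolding cb_def by blast
qed (simp_all add: regular_mat_pow regular_Yf equivariant_pow equivariant_cyc_block Ymat_def
    pow_mat_ring_pow[of _ dc, symmetric])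

lemma equivariant_one_plus_XY: "equivariant (\<lambda>\<rho>. 1\<^sub>m dc + Xf \<rho> * Yf \<rho>)"
  by (intro equivariant_add equivariant_mult equivariant_one equivariant_cyc_block regular_mat_mult
      regular_Xf regular_Yf) (simp_all add: regular_mat_const)

lemma poisson_commuting_XY:
  assumes "is_reduced_bracket \<alpha> q U R P"
  shows "poisson_commuting \<alpha> q U R P
    {tr_class \<alpha> q U R (\<lambda>\<rho>. (\<one>\<^bsub>M dc\<^esub> \<oplus>\<^bsub>M dc\<^esub> (Xmat \<alpha> \<rho> \<otimes>\<^bsub>M dc\<^esub> Ymat \<alpha> \<rho>)) [^]\<^bsub>M dc\<^esub> j) | j :: int. True}"
proof -
  obtain W where W: "regular_mat dc W" "\<And>\<rho>. \<rho> \<in> U \<Longrightarrow> (1\<^sub>m dc + Xf \<rho> * Yf \<rho>) * W \<rho> = 1\<^sub>m dc"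
    by (rule ex_inverse_one_plus_XY) blast
  let ?T = "\<lambda>\<rho>. 1\<^sub>m dc + Xf \<rho> * Yf \<rho>"
  show ?thesis
  proof (rule poisson_commuting_family[OF assms, where S = "\<lambda>j \<rho>. mat_ipow (?T \<rho>) (W \<rho>) j"])
    fix j l :: int and \<rho> assume \<rho>: "\<rho> \<in> U"
    interpret representation \<alpha> \<rho> using \<rho> U_Rep by unfold_locales auto
    have w: "W \<rho> \<in> carrier_mat n n" by (rule regular_matD(1)[OF W(1) \<rho>])
    have inv: "(1\<^sub>m n + X * Y) * W \<rho> = 1\<^sub>m n" using W(2)[OF \<rho>] by (simp add: cb_def)
    let ?S = "\<lambda>j. mat_ipow_der (1\<^sub>m n + X * Y) (W \<rho>) j"
    have S: "?S j \<in> carrier_mat n n" for j using w by simp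
    have T: "homog 0 (1\<^sub>m n + X * Y)"
      using homog_add[OF homog_one] homog_mult[OF homog_X homog_Y] by simp
    have "homog 0 (?S j)" for j
      by (rule homog_ipow_der[OF T w inv]) simp
    then have g: "graded_pair (Y * ?S j) (?S j * X)" for j
      using homog_mult[OF homog_Y, of 0 "?S j"] homog_mult[OF _ homog_X, of 0 "?S j"]
      by (intro graded_pairI) simp_all
    have comm: "(X * Y) * ?S j = ?S j * (X * Y)" for j
    proof (rule mat_ipow_der_commute[OF _ _ w inv])
      show "X * Y * (1\<^sub>m n + X * Y) = (1\<^sub>m n + X * Y) * (X * Y)"
        by (simp add: sq_algebra[where n = n])
    qed simp_all
    have "bracket_form (Y * ?S j) (?S j * X) (Y * ?S l) (?S l * X) = 0"
      using w inv by (intro bracket_form_XY comm S mat_ipow_der_commutes(2)[of _ n]) simp_all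
    with g gradient_one_plus_XY[OF \<rho> W]
    show "\<exists>P Q P' Q'. gradient \<rho> (\<lambda>\<rho>\<in>U. mtrace (mat_ipow (?T \<rho>) (W \<rho>) j)) P Q \<and>
        gradient \<rho> (\<lambda>\<rho>\<in>U. mtrace (mat_ipow (?T \<rho>) (W \<rho>) l)) P' Q' \<and>
        graded_pair P Q \<and> graded_pair P' Q' \<and> bracket_form P Q P' Q' = 0"
      unfolding cb_def by blast
  next
    fix j :: int and \<rho> assume \<rho>: "\<rho> \<in> U"
    show "(\<one>\<^bsub>M dc\<^esub> \<oplus>\<^bsub>M dc\<^esub> (Xmat \<alpha> \<rho> \<otimes>\<^bsub>M dc\<^esub> Ymat \<alpha> \<rho>)) [^]\<^bsub>M dc\<^esub> j = mat_ipow (?T \<rho>) (W \<rho>) j"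
      using ring_mat_int_pow[OF _ regular_matD(1)[OF W(1) \<rho>] W(2)[OF \<rho>], of j]
      by (simp add: ring_mat_simps Xmat_def Ymat_def mat_ipow_def)
  qed (intro regular_mat_ipow equivariant_ipow regular_one_plus_XY equivariant_one_plus_XY W; assumption)+
qed

lemma poisson_commuting_Y_plus_inverse:
  assumes "is_reduced_bracket \<alpha> q U R P"
    and B: "regular_mat dc (\<lambda>\<rho>. inv\<^bsub>M dc\<^esub> (Xmat \<alpha> \<rho>))"
      "\<And>\<rho>. \<rho> \<in> U \<Longrightarrow> Xmat \<alpha> \<rho> * inv\<^bsub>M dc\<^esub> (Xmat \<alpha> \<rho>) = 1\<^sub>m dc"
  shows "poisson_commuting \<alpha> q U R P
    {tr_class \<alpha> q U R (\<lambda>\<rho>. (Ymat \<alpha> \<rho> \<oplus>\<^bsub>M dc\<^esub> inv\<^bsub>M dc\<^esub> (Xmat \<alpha> \<rho>)) [^]\<^bsub>M dc\<^esub> (j * int CARD('m))) | j :: int. True}"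
proof -
  define B where "B \<rho> = inv\<^bsub>M dc\<^esub> (Xmat \<alpha> \<rho>)" for \<rho>
  have rB: "regular_mat dc B" and XB: "\<And>\<rho>. \<rho> \<in> U \<Longrightarrow> Xf \<rho> * B \<rho> = 1\<^sub>m dc"
    using assms(2,3) by (simp_all add: B_def[abs_def] Xmat_def)
  obtain W where W: "regular_mat dc W" "\<And>\<rho>. \<rho> \<in> U \<Longrightarrow> (1\<^sub>m dc + Xf \<rho> * Yf \<rho>) * W \<rho> = 1\<^sub>m dc"
    by (rule ex_inverse_one_plus_XY) blast
  \<comment> \<open>From (Y + X^(-1)) X = 1 + YX the inverse must be X (1 + YX)^(-1), and (1 +
    YX)^(-1) = 1 - Y (1 + XY)^(-1) X. This form has regular entries because those of
    \<open>W\<close> are regular.\<close>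
  define V where "V \<rho> = Xf \<rho> * (1\<^sub>m dc + (- 1) \<cdot>\<^sub>m (Yf \<rho> * W \<rho> * Xf \<rho>))" for \<rho>
  have rV: "regular_mat dc V"
    unfolding V_def[abs_def]
    by (intro regular_mat_mult regular_mat_add regular_mat_smult regular_Xf regular_Yf W(1) regular_const)
       (simp add: regular_mat_const)
  let ?T = "\<lambda>\<rho>. Yf \<rho> + B \<rho>"
  have TV: "?T \<rho> * V \<rho> = 1\<^sub>m dc" if \<rho>: "\<rho> \<in> U" for \<rho>
  proof -
    let ?X = "Xf \<rho>" and ?Y = "Yf \<rho>"
    have c: "?X \<in> carrier_mat dc dc" "?Y \<in> carrier_mat dc dc" "B \<rho> \<in> carrier_mat dc dc" "W \<rho> \<in> carrier_mat dc dc"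
      using regular_matD(1)[OF rB \<rho>] regular_matD(1)[OF W(1) \<rho>] by simp_all
    have BX: "B \<rho> * ?X = 1\<^sub>m dc" by (rule mat_mult_left_right_inverse[OF c(1,3) XB[OF \<rho>]])
    let ?K = "?Y * (W \<rho> * ?X)" and ?L = "?Y * (?X * (?Y * (W \<rho> * ?X)))"
    have "?Y * ((1\<^sub>m dc + ?X * ?Y) * W \<rho>) * ?X = ?Y * ?X"
      unfolding W(2)[OF \<rho>] using c by (simp add: sq_algebra[where n = dc])
    \<comment> \<open>This is Y (1 + XY) W X = YX expanded, the cancellation that makes (1 + YX)(1 -
      Y W X) equal to 1.\<close>
    then have KL: "?K + ?L = ?Y * ?X"
      using c by (simp add: sq_algebra[where n = dc])
    have "?T \<rho> * V \<rho> = (?Y * ?X + B \<rho> * ?X) * (1\<^sub>m dc + (- 1) \<cdot>\<^sub>m ?K)"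
      using c by (simp add: V_def sq_algebra[where n = dc])
    also have "\<dots> = (?Y * ?X + (- 1) \<cdot>\<^sub>m ?L) + (1\<^sub>m dc + (- 1) \<cdot>\<^sub>m ?K)"
    proof -
      have rearrange: "A + 1\<^sub>m dc + (- 1) \<cdot>\<^sub>m (L + K) = (A + (- 1) \<cdot>\<^sub>m L) + (1\<^sub>m dc + (- 1) \<cdot>\<^sub>m K)"
        if "A \<in> carrier_mat dc dc" "L \<in> carrier_mat dc dc" "K \<in> carrier_mat dc dc" for A L K :: "complex mat"
        using that by (auto intro!: eq_matI)
      show ?thesis
        unfolding BX using c by (simp add: sq_algebra[where n = dc]) (rule rearrange; simp)
    qed
    also have "\<dots> = 1\<^sub>m dc"
    proof -
      have kl: "?K \<in> carrier_mat dc dc" "?L \<in> carrier_mat dc dc" using c by simp_all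
      have "(A + C + (- 1) \<cdot>\<^sub>m C) + (1\<^sub>m dc + (- 1) \<cdot>\<^sub>m A) = 1\<^sub>m dc"
        if "A \<in> carrier_mat dc dc" "C \<in> carrier_mat dc dc" for A C :: "complex mat"
        using that by (auto intro!: eq_matI)
      from this[OF kl] show ?thesis unfolding KL .
    qed
    finally show ?thesis .
  qed
  have eB: "equivariant B"
    by (rule equivariant_inverse[OF regular_Xf rB equivariant_cyc_block XB]) simp_all
  show ?thesis
  proof (rule poisson_commuting_family[OF assms(1), where S = "\<lambda>j \<rho>. mat_ipow (?T \<rho>) (V \<rho>) (j * int CARD('m))"])
    fix j l :: int and \<rho> assume \<rho>: "\<rho> \<in> U"
    interpret representation \<alpha> \<rho> using \<rho> U_Rep by unfold_locales auto
    have v: "V \<rho> \<in> carrier_mat n n" "B \<rho> \<in> carrier_mat n n"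
      using regular_matD(1)[OF _ \<rho>] rV rB by blast+
    have inv: "(Y + B \<rho>) * V \<rho> = 1\<^sub>m n" using TV[OF \<rho>] by (simp add: cb_def)
    have XBr: "X * B \<rho> = 1\<^sub>m n" using XB[OF \<rho>] by (simp add: cb_def)
    let ?S = "\<lambda>j. mat_ipow_der (Y + B \<rho>) (V \<rho>) (j * int CARD('m))"
    have S: "?S j \<in> carrier_mat n n" for j using v by simp
    have hB: "homog (- 1) (B \<rho>)" by (rule homog_inverse[OF homog_X v(2) XBr])
    have hS: "homog 1 (?S j)" for j
      by (rule homog_ipow_der[OF homog_add[OF homog_Y hB] v(1) inv]) simp
    have g: "graded_pair (- (B \<rho> * (?S j * B \<rho>))) (?S j)" for j
      using homog_mult[OF hB homog_mult[OF hS hB]] hS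
      by (intro graded_pairI homog_uminus) simp_all
    have c: "Y + B \<rho> \<in> carrier_mat n n" using v by simp
    have "bracket_form (- (B \<rho> * (?S j * B \<rho>))) (?S j) (- (B \<rho> * (?S l * B \<rho>))) (?S l) = 0"
      using mat_mult_left_right_inverse[OF cb_carrier v(2) XBr] mat_ipow_der_commutes[OF c v(1) inv]
      by (intro bracket_form_Y_plus_inverse S v XBr) simp_all
    with g gradient_Y_plus_inverse[OF \<rho> rB XB rV TV]
    show "\<exists>P Q P' Q'. gradient \<rho> (\<lambda>\<rho>\<in>U. mtrace (mat_ipow (?T \<rho>) (V \<rho>) (j * int CARD('m)))) P Q \<and>
        gradient \<rho> (\<lambda>\<rho>\<in>U. mtrace (mat_ipow (?T \<rho>) (V \<rho>) (l * int CARD('m)))) P' Q' \<and>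
        graded_pair P Q \<and> graded_pair P' Q' \<and> bracket_form P Q P' Q' = 0"
      unfolding cb_def by blast
  next
    fix j :: int and \<rho> assume \<rho>: "\<rho> \<in> U"
    show "(Ymat \<alpha> \<rho> \<oplus>\<^bsub>M dc\<^esub> inv\<^bsub>M dc\<^esub> (Xmat \<alpha> \<rho>)) [^]\<^bsub>M dc\<^esub> (j * int CARD('m))
        = mat_ipow (?T \<rho>) (V \<rho>) (j * int CARD('m))"
      using ring_mat_int_pow[OF _ regular_matD(1)[OF rV \<rho>] TV[OF \<rho>], of "j * int CARD('m)"]
        regular_matD(1)[OF rB \<rho>]
      by (simp add: ring_mat_simps Ymat_def mat_ipow_def flip: B_def)
  qed (intro regular_mat_ipow equivariant_ipow regular_mat_add equivariant_add equivariant_cyc_block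
      regular_Yf rB rV eB TV cyc_elem_xy; assumption)+
qed

end

theorem theorem4p6:
  fixes \<alpha> :: "'m::nontriv mod_ring \<Rightarrow> nat"
    and q :: "'m mod_ring \<Rightarrow> complex"
    and P P0 :: "('m rep \<Rightarrow> complex) set \<Rightarrow> ('m rep \<Rightarrow> complex) set \<Rightarrow> ('m rep \<Rightarrow> complex) set"
  defines "X \<equiv> Xmat \<alpha>" and "Y \<equiv> Ymat \<alpha>" and "Mn \<equiv> M (dim_cyc \<alpha>)" and "m \<equiv> CARD('m)"
  assumes "\<And>i. \<alpha> i > 0" and "\<And>i. q i \<noteq> 0"
    and "is_reduced_bracket \<alpha> q (Rep \<alpha>) (ORep \<alpha>) P"
    and "is_reduced_bracket \<alpha> q (Rep0 \<alpha>) (ORep0 \<alpha>) P0"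
  shows "poisson_commuting \<alpha> q (Rep \<alpha>) (ORep \<alpha>) P
           {tr_class \<alpha> q (Rep \<alpha>) (ORep \<alpha>) (\<lambda>\<rho>. X \<rho> [^]\<^bsub>Mn\<^esub> (j * m)) | j :: nat. True} \<and>
         poisson_commuting \<alpha> q (Rep \<alpha>) (ORep \<alpha>) P
           {tr_class \<alpha> q (Rep \<alpha>) (ORep \<alpha>) (\<lambda>\<rho>. Y \<rho> [^]\<^bsub>Mn\<^esub> (j * m)) | j :: nat. True} \<and>
         poisson_commuting \<alpha> q (Rep \<alpha>) (ORep \<alpha>) P
           {tr_class \<alpha> q (Rep \<alpha>) (ORep \<alpha>)
              (\<lambda>\<rho>. (\<one>\<^bsub>Mn\<^esub> \<oplus>\<^bsub>Mn\<^esub> (X \<rho> \<otimes>\<^bsub>Mn\<^esub> Y \<rho>)) [^]\<^bsub>Mn\<^esub> j) | j :: int. True} \<and>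
         poisson_commuting \<alpha> q (Rep0 \<alpha>) (ORep0 \<alpha>) P0
           {tr_class \<alpha> q (Rep0 \<alpha>) (ORep0 \<alpha>)
              (\<lambda>\<rho>. (Y \<rho> \<oplus>\<^bsub>Mn\<^esub> inv\<^bsub>Mn\<^esub> (X \<rho>)) [^]\<^bsub>Mn\<^esub> (j * int m)) | j :: int. True}"
  unfolding X_def Y_def Mn_def m_def
  using Rep.poisson_commuting_X[OF assms(7)] Rep.poisson_commuting_Y[OF assms(7)]
    Rep.poisson_commuting_XY[OF assms(7)]
    Rep0.poisson_commuting_Y_plus_inverse[OF assms(8) regular_mat_inv_Xmat inv_Xmat(2)]
  by blast

end
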